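(* Let $n\ge2$. Given any cocompact torsion-free lattice $L$ in $\mathrm{PSp}(2n,\mathbb{R})$, the group $\Gamma=L^\uparrow\subset\mathcal{E}=\mathcal{G}\times_{Z(\mathcal{G})}\mathcal{H}\mathcal{R}/\mathcal{H}$ arising from $L$ is Siegel--Seifert.
   Context: Groups. $\mathrm{Sp}(2n,\mathbb{R})=\{M\in M_{2n}(\mathbb{R}): M^T\Omega M=\Omega\}$, $\Omega=\begin{pmatrix} 0 & I_n \\ -I_n & 0 \end{pmatrix}$; $\mathrm{PSp}(2n,\mathbb{R})=\mathrm{Sp}(2n,\mathbb{R})/\{\pm\mathrm{id}\}$. $\mathrm{U}(n)$ is embedded in $\mathrm{Sp}(2n,\mathbb{R})$ by $A+iB\mapsto\begin{pmatrix} A & -B \\ B & A \end{pmatrix}$ ($A,B$ real). Let $\pi:\widetilde{\mathrm{Sp}(2n,\mathbb{R})}\to\mathrm{Sp}(2n,\mathbb{R})$ be the universal covering and $\widetilde{\mathrm{U}(n)}=\pi^{-1}(\mathrm{U}(n))$. Put $\mathcal{G}=\widetilde{\mathrm{Sp}(2n,\mathbb{R})}$; $\mathcal{H}=\mathrm{SU}(n)\subset\mathcal{G}$, the identity component of $\pi^{-1}(\mathrm{SU}(n))$; $\mathcal{R}\cong\mathbb{R}$, the identity component of $\pi^{-1}(\{e^{ia}\mathrm{id}:a\in\mathbb{R}\})$. Then $\mathcal{H}\mathcal{R}=\widetilde{\mathrm{U}(n)}$ is a direct product and contains the center $Z(\mathcal{G})=\pi^{-1}(\{\pm\mathrm{id}\})$.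 Let $i:Z(\mathcal{G})\to\mathcal{G}$ be the inclusion and $\iota:Z(\mathcal{G})\to\mathcal{H}\mathcal{R}/\mathcal{H}\cong\mathbb{R}$ the restriction of the quotient map $\mathcal{H}\mathcal{R}\to\mathcal{H}\mathcal{R}/\mathcal{H}$. Define $$\mathcal{E}=\mathcal{G}\times_{Z(\mathcal{G})}\mathcal{H}\mathcal{R}/\mathcal{H}:=\frac{\mathcal{G}\times\mathcal{H}\mathcal{R}/\mathcal{H}}{\{(i(z),\iota(z)^{-1}):z\in Z(\mathcal{G})\}},$$ with quotient map $\theta:\mathcal{G}\times\mathcal{H}\mathcal{R}/\mathcal{H}\to\mathcal{E}$. $\mathcal{E}$ acts on $\mathcal{X}=\mathcal{G}/\mathcal{H}$ by $(g,r\mathcal{H})\cdot x\mathcal{H}=gxr\mathcal{H}$ ($r\in\mathcal{R}$). The surjective homomorphism $\eta:\mathcal{E}\to\mathcal{G}/Z(\mathcal{G})\cong\mathrm{PSp}(2n,\mathbb{R})$ is $\theta(g,r\mathcal{H})\mapsto gZ(\mathcal{G})$. $\mathfrak{H}_n=\widetilde{\mathrm{Sp}(2n,\mathbb{R})}/\widetilde{\mathrm{U}(n)}\cong\mathrm{Sp}(2n,\mathbb{R})/\mathrm{U}(n)$ is the Siegel upper half-space with the usual action of $\mathrm{PSp}(2n,\mathbb{R})$. Lattice. A lattice in $\mathrm{PSp}(2n,\mathbb{R})$ is a discrete subgroup $L$ such that $L\backslash\mathrm{PSp}(2n,\mathbb{R})$ has finite Haar volume; it is cocompact if this quotient is compact.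 Arising from. For a subgroup $L\subset\mathrm{PSp}(2n,\mathbb{R})$ let $L'\subset\mathcal{G}$ be its inverse image; the group arising from $L$ is $L^\uparrow:=\theta(L'\times\{\mathrm{id}\})\subset\mathcal{E}$. Siegel--Seifert. A subgroup $\Gamma\subset\mathcal{E}$ is Siegel--Seifert if: (i) $\Gamma$ is discrete and torsion-free, and $\Gamma\curvearrowright\mathcal{X}$ is cocompact and properly discontinuous; (ii) $\eta(\Gamma)\subset\mathcal{G}/Z(\mathcal{G})$ is discrete and torsion-free, and $\eta(\Gamma)\curvearrowright\mathfrak{H}_n$ is cocompact and properly discontinuous; (iii) $\Gamma\cap\ker\eta$ is infinite cyclic. *)

theory Defs
  imports
    "HOL-Analysis.Analysis"
    "HOL-Algebra.Left_Coset"
    "HOL-Algebra.Elementary_Groups"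
    "HOL-Algebra.Group_Action"
begin

section \<open>Quotient topologies, topological groups and actions\<close>

definition quotient_topology :: "'a topology \<Rightarrow> ('a \<Rightarrow> 'b) \<Rightarrow> 'b topology" where
  "quotient_topology X f =
     topology (\<lambda>U. U \<subseteq> f ` topspace X \<and> openin X {x \<in> topspace X. f x \<in> U})"

lemma openin_quotient_topology:
  "openin (quotient_topology X f) U \<longleftrightarrow>
     U \<subseteq> f ` topspace X \<and> openin X {x \<in> topspace X. f x \<in> U}"
proof -
  have "istopology (\<lambda>U. U \<subseteq> f ` topspace X \<and> openin X {x \<in> topspace X. f x \<in> U})"
    unfolding istopology_def
  proof (intro conjI allI impI; (elim conjE)?)
    fix S T
    assume "openin X {x \<in> topspace X. f x \<in> S}" "openin X {x \<in> topspace X. f x \<in> T}"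
    then have "openin X ({x \<in> topspace X. f x \<in> S} \<inter> {x \<in> topspace X. f x \<in> T})"
      by (rule openin_Int)
    then show "openin X {x \<in> topspace X. f x \<in> S \<inter> T}"
      by (rule back_subst[where P = "openin X"]) auto
  next
    fix K
    assume K: "\<forall>S\<in>K. S \<subseteq> f ` topspace X \<and> openin X {x \<in> topspace X. f x \<in> S}"
    have "openin X (\<Union>S\<in>K. {x \<in> topspace X. f x \<in> S})"
      using K by blast
    then show "openin X {x \<in> topspace X. f x \<in> \<Union> K}"
      by (rule back_subst[where P = "openin X"]) auto
  qed auto
  then show ?thesis
    unfolding quotient_topology_def by (simp add: topology_inverse')
qed

lemma topspace_quotient_topology: "topspace (quotient_topology X f) = f ` topspace X"
proof
  have "openin (quotient_topology X f) (f ` topspace X)"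
    unfolding openin_quotient_topology
    by (auto intro: back_subst[where P = "openin X", OF openin_topspace])
  then show "f ` topspace X \<subseteq> topspace (quotient_topology X f)"
    by (rule openin_subset)
  show "topspace (quotient_topology X f) \<subseteq> f ` topspace X"
    using openin_topspace[of "quotient_topology X f"] unfolding openin_quotient_topology by blast
qed

lemma quotient_map_quotient_topology: "quotient_map X (quotient_topology X f) f"
  unfolding quotient_map_def topspace_quotient_topology openin_quotient_topology by auto

definition topological_group :: "('a, 'm) monoid_scheme \<Rightarrow> 'a topology \<Rightarrow> bool" where
  "topological_group G T \<longleftrightarrow>
     group G \<and> topspace T = carrier G \<and>
     continuous_map (prod_topology T T) T (\<lambda>(x, y). x \<otimes>\<^bsub>G\<^esub> y) \<and>
     continuous_map T T (\<lambda>x. inv\<^bsub>G\<^esub> x)"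

definition discrete_in :: "'a topology \<Rightarrow> 'a set \<Rightarrow> bool" where
  "discrete_in T S \<longleftrightarrow> S \<subseteq> topspace T \<and> subtopology T S = discrete_topology S"

definition torsion_free :: "('a, 'm) monoid_scheme \<Rightarrow> 'a set \<Rightarrow> bool" where
  "torsion_free G S \<longleftrightarrow>
     (\<forall>x\<in>S. \<forall>k::nat. k > 0 \<and> x [^]\<^bsub>G\<^esub> k = \<one>\<^bsub>G\<^esub> \<longrightarrow> x = \<one>\<^bsub>G\<^esub>)"

definition group_center :: "('a, 'm) monoid_scheme \<Rightarrow> 'a set" where
  "group_center G = {z \<in> carrier G. \<forall>g\<in>carrier G. z \<otimes>\<^bsub>G\<^esub> g = g \<otimes>\<^bsub>G\<^esub> z}"

definition cocompact_action ::
    "('a, 'm) monoid_scheme \<Rightarrow> 'x topology \<Rightarrow> ('a \<Rightarrow> 'x \<Rightarrow> 'x) \<Rightarrow> bool" where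
  "cocompact_action A X act \<longleftrightarrow> compact_space (quotient_topology X (orbit A act))"

definition properly_discontinuous_action ::
    "('a, 'm) monoid_scheme \<Rightarrow> 'x topology \<Rightarrow> ('a \<Rightarrow> 'x \<Rightarrow> 'x) \<Rightarrow> bool" where
  "properly_discontinuous_action A X act \<longleftrightarrow>
     (\<forall>K. compactin X K \<longrightarrow> finite {a \<in> carrier A. act a ` K \<inter> K \<noteq> {}})"

text \<open>The universal covering group of \<open>B\<close> is characterised, up to isomorphism, as a simply
  connected topological group with a covering homomorphism onto \<open>B\<close>. Both groups carry the
  subspace topologies of their carriers. In the library, simple connectedness includes path
  connectedness.\<close>

definition universal_covering_group ::
    "('g::topological_space) monoid \<Rightarrow> ('b::topological_space) monoid \<Rightarrow> ('g \<Rightarrow> 'b) \<Rightarrow> bool" where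
  "universal_covering_group G B \<pi> \<longleftrightarrow>
     topological_group G (top_of_set (carrier G)) \<and>
     \<pi> \<in> hom G B \<and>
     covering_space (carrier G) \<pi> (carrier B) \<and>
     simply_connected (carrier G)"


section \<open>Lattices\<close>

text \<open>The regularity conditions on a Haar measure are omitted: they hold automatically in a
  second countable locally compact Hausdorff group.\<close>

definition haar_measure :: "('a, 'm) monoid_scheme \<Rightarrow> 'a topology \<Rightarrow> 'a measure \<Rightarrow> bool" where
  "haar_measure G T \<mu> \<longleftrightarrow>
     space \<mu> = carrier G \<and>
     sets \<mu> = sigma_sets (carrier G) {U. openin T U} \<and>
     (\<forall>g\<in>carrier G. \<forall>A\<in>sets \<mu>. emeasure \<mu> (g <#\<^bsub>G\<^esub> A) = emeasure \<mu> A) \<and>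
     (\<forall>K. compactin T K \<and> K \<in> sets \<mu> \<longrightarrow> emeasure \<mu> K < \<infinity>) \<and>
     (\<forall>U. openin T U \<and> U \<noteq> {} \<longrightarrow> emeasure \<mu> U > 0)"

text \<open>The space \<open>L\G\<close> of cosets \<open>Lg\<close>.\<close>

definition rcoset_topology :: "('a, 'm) monoid_scheme \<Rightarrow> 'a topology \<Rightarrow> 'a set \<Rightarrow> 'a set topology" where
  "rcoset_topology G T L = quotient_topology T (\<lambda>g. L #>\<^bsub>G\<^esub> g)"

text \<open>The Haar volume \<open>\<nu>\<close> of \<open>L\G\<close> is the Borel measure that agrees with the Haar measure
  \<open>\<mu>\<close> on Borel sets on which the projection \<open>G \<rightarrow> L\G\<close> is injective.\<close>

definition finite_covolume :: "('a, 'm) monoid_scheme \<Rightarrow> 'a topology \<Rightarrow> 'a set \<Rightarrow> bool" where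
  "finite_covolume G T L \<longleftrightarrow>
     (\<exists>\<mu> \<nu>. haar_measure G T \<mu> \<and>
        space \<nu> = rcosets\<^bsub>G\<^esub> L \<and>
        sets \<nu> = sigma_sets (rcosets\<^bsub>G\<^esub> L) {U. openin (rcoset_topology G T L) U} \<and>
        (\<forall>A\<in>sets \<mu>. inj_on (\<lambda>g. L #>\<^bsub>G\<^esub> g) A \<longrightarrow>
            emeasure \<nu> ((\<lambda>g. L #>\<^bsub>G\<^esub> g) ` A) = emeasure \<mu> A) \<and>
        emeasure \<nu> (space \<nu>) < \<infinity>)"

definition lattice_in :: "('a, 'm) monoid_scheme \<Rightarrow> 'a topology \<Rightarrow> 'a set \<Rightarrow> bool" where
  "lattice_in G T L \<longleftrightarrow> subgroup L G \<and> discrete_in T L \<and> finite_covolume G T L"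

definition cocompact_lattice_in :: "('a, 'm) monoid_scheme \<Rightarrow> 'a topology \<Rightarrow> 'a set \<Rightarrow> bool" where
  "cocompact_lattice_in G T L \<longleftrightarrow> lattice_in G T L \<and> compact_space (rcoset_topology G T L)"


section \<open>Symplectic and unitary groups\<close>

text \<open>The index type \<open>'n\<close> has \<open>n\<close> elements and the index type \<open>'n + 'n\<close> splits
  \<open>2n \<times> 2n\<close> matrices into four \<open>n \<times> n\<close> blocks.\<close>

type_synonym 'n real_2n_matrix = "real ^ ('n + 'n) ^ ('n + 'n)"

definition block_matrix ::
    "real^'n^'n \<Rightarrow> real^'n^'n \<Rightarrow> real^'n^'n \<Rightarrow> real^'n^'n \<Rightarrow> ('n::finite) real_2n_matrix" where
  "block_matrix A B C D = (\<chi> i j.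
     case i of
       Inl a \<Rightarrow> (case j of Inl b \<Rightarrow> A $ a $ b | Inr b \<Rightarrow> B $ a $ b)
     | Inr a \<Rightarrow> (case j of Inl b \<Rightarrow> C $ a $ b | Inr b \<Rightarrow> D $ a $ b))"

definition symplectic_form :: "('n::finite) real_2n_matrix" where
  "symplectic_form = block_matrix 0 (mat 1) (- mat 1) 0"

definition Sp :: "('n::finite) real_2n_matrix monoid" where
  "Sp = \<lparr>carrier = {M. transpose M ** symplectic_form ** M = symplectic_form},
         monoid.mult = (**), one = mat 1\<rparr>"

definition PSp :: "('n::finite) real_2n_matrix set monoid" where
  "PSp = Sp Mod {mat 1, - mat 1}"

definition PSp_topology :: "('n::finite) real_2n_matrix set topology" where
  "PSp_topology = rcoset_topology Sp (top_of_set (carrier Sp)) {mat 1, - mat 1}"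

definition unitary_matrices :: "(complex^'n^'n::finite) set" where
  "unitary_matrices = {A. (\<chi> i j. cnj (A $ j $ i)) ** A = mat 1}"

text \<open>The embedding \<open>A + iB \<mapsto> (A, -B; B, A)\<close>.\<close>

definition realification :: "complex^'n^'n \<Rightarrow> ('n::finite) real_2n_matrix" where
  "realification U =
     (let A = (\<chi> i j. Re (U $ i $ j)); B = (\<chi> i j. Im (U $ i $ j))
      in block_matrix A (- B) B A)"

definition U_subgroup :: "('n::finite) real_2n_matrix set" where
  "U_subgroup = realification ` unitary_matrices"

definition SU_subgroup :: "('n::finite) real_2n_matrix set" where
  "SU_subgroup = realification ` {A \<in> unitary_matrices. det A = 1}"

definition scalar_U_subgroup :: "('n::finite) real_2n_matrix set" where
  "scalar_U_subgroup = {realification (mat (cis a)) | a::real. True}"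


section \<open>The group \<open>\<E>\<close> and its actions\<close>

text \<open>Throughout, \<open>\<pi>\<close> from \<open>G\<close> to \<open>Sp\<close> is meant to be the universal covering group.\<close>

definition preimage_in :: "'g monoid \<Rightarrow> ('g \<Rightarrow> 'b) \<Rightarrow> 'b set \<Rightarrow> 'g set" where
  "preimage_in G \<pi> S = {g \<in> carrier G. \<pi> g \<in> S}"

definition H_subgroup ::
    "'g::topological_space monoid \<Rightarrow> ('g \<Rightarrow> ('n::finite) real_2n_matrix) \<Rightarrow> 'g set" where
  "H_subgroup G \<pi> = connected_component_set (preimage_in G \<pi> SU_subgroup) \<one>\<^bsub>G\<^esub>"

definition R_subgroup ::
    "'g::topological_space monoid \<Rightarrow> ('g \<Rightarrow> ('n::finite) real_2n_matrix) \<Rightarrow> 'g set" where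
  "R_subgroup G \<pi> = connected_component_set (preimage_in G \<pi> scalar_U_subgroup) \<one>\<^bsub>G\<^esub>"

definition HR_subgroup ::
    "'g::topological_space monoid \<Rightarrow> ('g \<Rightarrow> ('n::finite) real_2n_matrix) \<Rightarrow> 'g set" where
  "HR_subgroup G \<pi> = H_subgroup G \<pi> <#>\<^bsub>G\<^esub> R_subgroup G \<pi>"

definition HR_mod_H ::
    "'g::topological_space monoid \<Rightarrow> ('g \<Rightarrow> ('n::finite) real_2n_matrix) \<Rightarrow> 'g set monoid" where
  "HR_mod_H G \<pi> = (G\<lparr>carrier := HR_subgroup G \<pi>\<rparr>) Mod (H_subgroup G \<pi>)"

definition HR_mod_H_topology ::
    "'g::topological_space monoid \<Rightarrow> ('g \<Rightarrow> ('n::finite) real_2n_matrix) \<Rightarrow> 'g set topology" where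
  "HR_mod_H_topology G \<pi> =
     rcoset_topology G (top_of_set (HR_subgroup G \<pi>)) (H_subgroup G \<pi>)"

definition iota ::
    "'g::topological_space monoid \<Rightarrow> ('g \<Rightarrow> ('n::finite) real_2n_matrix) \<Rightarrow> 'g \<Rightarrow> 'g set" where
  "iota G \<pi> z = H_subgroup G \<pi> #>\<^bsub>G\<^esub> z"

definition amalgam ::
    "'g::topological_space monoid \<Rightarrow> ('g \<Rightarrow> ('n::finite) real_2n_matrix) \<Rightarrow> ('g \<times> 'g set) set" where
  "amalgam G \<pi> = {(z, inv\<^bsub>HR_mod_H G \<pi>\<^esub> (iota G \<pi> z)) | z. z \<in> group_center G}"

definition E_group ::
    "'g::topological_space monoid \<Rightarrow> ('g \<Rightarrow> ('n::finite) real_2n_matrix)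
       \<Rightarrow> ('g \<times> 'g set) set monoid" where
  "E_group G \<pi> = (G \<times>\<times> HR_mod_H G \<pi>) Mod (amalgam G \<pi>)"

definition theta ::
    "'g::topological_space monoid \<Rightarrow> ('g \<Rightarrow> ('n::finite) real_2n_matrix)
       \<Rightarrow> 'g \<times> 'g set \<Rightarrow> ('g \<times> 'g set) set" where
  "theta G \<pi> p = amalgam G \<pi> #>\<^bsub>G \<times>\<times> HR_mod_H G \<pi>\<^esub> p"

definition E_topology ::
    "'g::topological_space monoid \<Rightarrow> ('g \<Rightarrow> ('n::finite) real_2n_matrix)
       \<Rightarrow> ('g \<times> 'g set) set topology" where
  "E_topology G \<pi> =
     quotient_topology (prod_topology (top_of_set (carrier G)) (HR_mod_H_topology G \<pi>)) (theta G \<pi>)"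

text \<open>The space \<open>G/K\<close> of cosets \<open>gK\<close>.\<close>

definition lcoset_space :: "'g::topological_space monoid \<Rightarrow> 'g set \<Rightarrow> 'g set topology" where
  "lcoset_space G K = quotient_topology (top_of_set (carrier G)) (\<lambda>g. g <#\<^bsub>G\<^esub> K)"

definition X_space ::
    "'g::topological_space monoid \<Rightarrow> ('g \<Rightarrow> ('n::finite) real_2n_matrix) \<Rightarrow> 'g set topology" where
  "X_space G \<pi> = lcoset_space G (H_subgroup G \<pi>)"

text \<open>The action \<open>(g, rH) \<cdot> yH = gyrH\<close>, where \<open>r\<close> is in \<open>R\<close>. All choices of
  representatives give the same coset, so that the set below has one element.\<close>

definition E_action ::
    "'g::topological_space monoid \<Rightarrow> ('g \<Rightarrow> ('n::finite) real_2n_matrix)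
       \<Rightarrow> ('g \<times> 'g set) set \<Rightarrow> 'g set \<Rightarrow> 'g set" where
  "E_action G \<pi> e x = the_elem
     {(g \<otimes>\<^bsub>G\<^esub> y \<otimes>\<^bsub>G\<^esub> r) <#\<^bsub>G\<^esub> H_subgroup G \<pi> | g r y.
        r \<in> R_subgroup G \<pi> \<and> (g, H_subgroup G \<pi> #>\<^bsub>G\<^esub> r) \<in> e \<and> y \<in> x}"

definition G_mod_center :: "'g monoid \<Rightarrow> 'g set monoid" where
  "G_mod_center G = G Mod (group_center G)"

definition G_mod_center_topology :: "'g::topological_space monoid \<Rightarrow> 'g set topology" where
  "G_mod_center_topology G = rcoset_topology G (top_of_set (carrier G)) (group_center G)"

definition eta :: "'g monoid \<Rightarrow> ('g \<times> 'g set) set \<Rightarrow> 'g set" where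
  "eta G e = the_elem ((\<lambda>(g, s). group_center G #>\<^bsub>G\<^esub> g) ` e)"

definition U_tilde ::
    "'g monoid \<Rightarrow> ('g \<Rightarrow> ('n::finite) real_2n_matrix) \<Rightarrow> 'g set" where
  "U_tilde G \<pi> = preimage_in G \<pi> U_subgroup"

definition siegel_space ::
    "'g::topological_space monoid \<Rightarrow> ('g \<Rightarrow> ('n::finite) real_2n_matrix) \<Rightarrow> 'g set topology" where
  "siegel_space G \<pi> = lcoset_space G (U_tilde G \<pi>)"

text \<open>The action of the quotient of \<open>G\<close> by its center \<open>Z\<close> on the Siegel space: as sets,
  \<open>(gZ)(y \<tilde>U) = gy \<tilde>U\<close>, because \<open>Z\<close> is central and contained in \<open>\<tilde>U\<close>.\<close>

definition siegel_action :: "'g monoid \<Rightarrow> 'g set \<Rightarrow> 'g set \<Rightarrow> 'g set" where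
  "siegel_action G c x = c <#>\<^bsub>G\<^esub> x"


section \<open>Siegel--Seifert groups\<close>

definition siegel_seifert ::
    "'g::topological_space monoid \<Rightarrow> ('g \<Rightarrow> ('n::finite) real_2n_matrix)
       \<Rightarrow> ('g \<times> 'g set) set set \<Rightarrow> bool" where
  "siegel_seifert G \<pi> \<Gamma> \<longleftrightarrow>
     (let E = E_group G \<pi>; Q = G_mod_center G; K = kernel E Q (eta G) in
      subgroup \<Gamma> E \<and>
      (discrete_in (E_topology G \<pi>) \<Gamma> \<and> torsion_free E \<Gamma> \<and>
       cocompact_action (E\<lparr>carrier := \<Gamma>\<rparr>) (X_space G \<pi>) (E_action G \<pi>) \<and>
       properly_discontinuous_action (E\<lparr>carrier := \<Gamma>\<rparr>) (X_space G \<pi>) (E_action G \<pi>)) \<and>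
      (discrete_in (G_mod_center_topology G) (eta G ` \<Gamma>) \<and> torsion_free Q (eta G ` \<Gamma>) \<and>
       cocompact_action (Q\<lparr>carrier := eta G ` \<Gamma>\<rparr>) (siegel_space G \<pi>) (siegel_action G) \<and>
       properly_discontinuous_action (Q\<lparr>carrier := eta G ` \<Gamma>\<rparr>) (siegel_space G \<pi>)
         (siegel_action G)) \<and>
      E\<lparr>carrier := \<Gamma> \<inter> K\<rparr> \<cong> integer_group)"

definition arising_from ::
    "'g::topological_space monoid \<Rightarrow> ('g \<Rightarrow> ('n::finite) real_2n_matrix)
       \<Rightarrow> 'n real_2n_matrix set set \<Rightarrow> ('g \<times> 'g set) set set" where
  "arising_from G \<pi> L =
     theta G \<pi> ` ({g \<in> carrier G. {mat 1, - mat 1} #>\<^bsub>Sp\<^esub> \<pi> g \<in> L} \<times> {\<one>\<^bsub>HR_mod_H G \<pi>\<^esub>})"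

end

theory Submission
  imports Defs
begin

text \<open>Let \<open>U\<close> be the preimage of the unitary group in \<open>G\<close>. Since \<open>G\<close> is simply connected, the
  determinant of the complex linear part of \<open>\<pi> g\<close>, which does not vanish on \<open>Sp\<close>, has a continuous
  logarithm on \<open>G\<close>; its imaginary part \<open>angle\<close> satisfies \<open>angle (g u) = angle g + angle u\<close> for \<open>u\<close>
  in \<open>U\<close>. The polar decomposition yields a retraction of \<open>G\<close> onto \<open>U\<close>; hence \<open>H\<close> is the kernel
  of \<open>angle\<close> on \<open>U\<close>, and \<open>HR = U\<close>. On the center \<open>Z\<close>, the preimage of \<open>{1, -1}\<close>, the angle takes
  values in the integer multiples of \<open>pi\<close>, and it extends to a continuous function on \<open>\<E>\<close>. An
  element of the group arising from \<open>L\<close> is determined by its image in \<open>G/Z\<close> and its angle, which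
  reduces every assertion about \<open>\<E>\<close> and \<open>G/H\<close> to the corresponding one about \<open>L\<close> in \<open>PSp\<close>.\<close>

section \<open>Square roots of positive definite matrices\<close>

text \<open>\<open>G\<close> is an abstract topological group known only through
  \<open>\<pi>\<close>, without metric or coordinates. Continuous maps into it are therefore built
  from local sections along explicit paths in \<open>Sp\<close>; Cayley paths supply these, both
  near the identity and towards positive parts. The subgroup \<open>H\<close> is defined as a
  connected component, so one inclusion in its description asks for connectedness of the angle-zero
  part of the preimage of U(n). This comes from mapping the connected \<open>G\<close> onto that
  part, not from the topology of SU(n). The complex determinant is not multiplicative on
  \<open>Sp\<close>, but a unitary right factor splits off, and the cosets \<open>gH\<close> and the
  central translations involve only such factors. The center may contain elements of angle 0 other
  than the identity: for even n, -1 lies in SU(n). The homomorphism from \<open>G\<close> to \<E>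
  kills exactly the central elements of angle 0, so the image of the center is described by angles
  alone. It is isomorphic to a nonzero group of integer multiples of pi, hence infinite cyclic,
  whether or not the center has torsion.\<close>

lemma continuous_on_matrix_mult [continuous_intros]:
  fixes f :: "'a::topological_space \<Rightarrow> ('b::real_normed_algebra_1)^'n^'m"
    and g :: "'a \<Rightarrow> 'b^'p^'n"
  assumes "continuous_on S f" "continuous_on S g"
  shows "continuous_on S (\<lambda>x. f x ** g x)"
  unfolding matrix_matrix_mult_def by (intro continuous_intros assms)

lemma continuous_on_transpose [continuous_intros]:
  fixes f :: "'a::topological_space \<Rightarrow> ('b::topological_space)^'n^'m"
  assumes "continuous_on S f"
  shows "continuous_on S (\<lambda>x. transpose (f x))"
  unfolding transpose_def by (intro continuous_intros assms)

lemma continuous_on_matrix_det [continuous_intros]: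
  fixes f :: "'a::topological_space \<Rightarrow> ('b::real_normed_field)^'n^'n"
  assumes "continuous_on S f"
  shows "continuous_on S (\<lambda>x. det (f x))"
  unfolding det_def by (intro continuous_intros assms)

lemma matrix_vector_mult_uminus [simp]:
  fixes A :: "real^'n^'m"
  shows "(- A) *v x = - (A *v x)" "A *v (- x) = - (A *v x)"
  by (simp_all add: matrix_vector_mult_def vec_eq_iff sum_negf)

lemma matrix_mult_uminus [simp]:
  fixes A :: "('a::ring_1)^'n^'m" and B :: "'a^'p^'n"
  shows "(- A) ** B = - (A ** B)" "A ** (- B) = - (A ** B)"
  by (simp_all add: matrix_matrix_mult_def vec_eq_iff sum_negf)

lemma matrix_mult_add_distrib:
  fixes A :: "('a::ring_1)^'n^'m"
  shows "A ** (B + C) = A ** B + A ** C" "(D + E) ** F = D ** F + E ** (F :: 'a^'n^'m)"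
    "A ** (B - C) = A ** B - A ** C" "(D - E) ** F = D ** F - E ** (F :: 'a^'n^'m)"
  by (simp_all add: matrix_matrix_mult_def vec_eq_iff sum.distrib sum_subtractf algebra_simps)

lemma transpose_simps [simp]:
  fixes A :: "('a::ring_1)^'n^'m" and M :: "real^'n^'m"
  shows "transpose (A + B) = transpose A + transpose B"
    "transpose (A - B) = transpose A - transpose B"
    "transpose (- A) = - transpose A"
    "transpose (c *\<^sub>R M) = c *\<^sub>R transpose M"
  by (simp_all add: transpose_def vec_eq_iff)

lemma matrix_inv_mult:
  fixes A :: "'a::semiring_1^'n^'n"
  assumes "invertible A"
  shows "A ** matrix_inv A = mat 1" "matrix_inv A ** A = mat 1"
  using someI_ex[OF assms[unfolded invertible_def]] unfolding matrix_inv_def by blast+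

text \<open>Cramer's rule writes every entry of the inverse as a quotient of determinants, with
  nonvanishing denominator \<open>det (f x)\<close>.\<close>

lemma continuous_on_matrix_inv:
  fixes f :: "'a::topological_space \<Rightarrow> real^'n^'n"
  assumes f: "continuous_on S f" and inv: "\<And>x. x \<in> S \<Longrightarrow> invertible (f x)"
  shows "continuous_on S (\<lambda>x. matrix_inv (f x))"
proof -
  have d: "det (f x) \<noteq> 0" if "x \<in> S" for x
    using inv[OF that] by (simp add: invertible_det_nz)
  have eq: "matrix_inv (f x) =
      (\<chi> i l. det (\<chi> k j. if j = i then axis l 1 $ k else f x $ k $ j) / det (f x))" if "x \<in> S" for x
  proof -
    have "f x *v (matrix_inv (f x) *v axis l 1) = axis l 1" for l
      using inv[OF that] by (simp add: matrix_vector_mul_assoc matrix_inv_mult)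
    then have "matrix_inv (f x) *v axis l 1 =
        (\<chi> i. det (\<chi> k j. if j = i then axis l 1 $ k else f x $ k $ j) / det (f x))" for l
      using cramer[OF d[OF that]] by blast
    then show ?thesis
      by (simp add: vec_eq_iff matrix_vector_mult_basis column_def)
  qed
  have "continuous_on S (\<lambda>x. \<chi> i l.
      det (\<chi> k j. if j = i then axis l 1 $ k else f x $ k $ j) / det (f x) :: real^'n^'n)"
  proof (intro continuous_on_vec_lambda continuous_intros)
    fix i l k j
    show "continuous_on S (\<lambda>x. if j = i then axis l 1 $ k else f x $ k $ j)"
      by (cases "j = i") (auto intro!: continuous_intros f)
  qed (use d f in auto)
  then show ?thesis
    using eq by (simp cong: continuous_on_cong)
qed

section \<open>Symmetric forms, contractions and the square root\<close>

definition pos_def :: "real^'n^'n \<Rightarrow> bool" where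
  "pos_def S \<longleftrightarrow> transpose S = S \<and> (\<forall>x. x \<noteq> 0 \<longrightarrow> x \<bullet> (S *v x) > 0)"

lemma symmetric_matrix_inner:
  fixes A :: "real^'n^'n"
  assumes "transpose A = A"
  shows "x \<bullet> (A *v y) = (A *v x) \<bullet> y"
  using assms by (metis dot_lmul_matrix transpose_matrix_vector)

text \<open>The Cauchy--Schwarz inequality of the form \<open>x \<bullet> A y\<close>, applied to \<open>y = A x\<close>.\<close>

lemma norm_less_of_form_bounds:
  fixes A :: "real^'n^'n"
  assumes sym: "transpose A = A" and x: "x \<noteq> 0"
    and nonneg: "\<And>x. 0 \<le> x \<bullet> (A *v x)"
    and upper: "\<And>x. x \<noteq> 0 \<Longrightarrow> x \<bullet> (A *v x) < x \<bullet> x"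
  shows "norm (A *v x) < norm x"
proof (rule ccontr)
  define y where "y = A *v x"
  assume "\<not> norm (A *v x) < norm x"
  then have le: "norm x \<le> norm y" by (simp add: y_def)
  then have y0: "y \<noteq> 0" using x by auto
  have cs: "(y \<bullet> y)\<^sup>2 \<le> (x \<bullet> y) * (y \<bullet> (A *v y))"
  proof -
    have xy: "x \<bullet> (A *v y) = y \<bullet> y" "y \<bullet> (A *v x) = y \<bullet> y"
      using symmetric_matrix_inner[OF sym] by (simp_all add: y_def)
    define a b c where "a = x \<bullet> y" and "b = y \<bullet> y" and "c = y \<bullet> (A *v y)"
    have q: "0 \<le> s\<^sup>2 * a - 2 * s * t * b + t\<^sup>2 * c" for s t :: real
    proof -
      have "0 \<le> (s *\<^sub>R x - t *\<^sub>R y) \<bullet> (A *v (s *\<^sub>R x - t *\<^sub>R y))"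
        by (rule nonneg)
      also have "\<dots> = s\<^sup>2 * a - 2 * s * t * b + t\<^sup>2 * c"
        using xy unfolding a_def b_def c_def
        by (simp add: algebra_simps inner_diff_left inner_diff_right power2_eq_square)
           (simp add: y_def)
      finally show ?thesis .
    qed
    have b: "b > 0" using y0 by (simp add: b_def)
    have "0 \<le> c" unfolding c_def by (rule nonneg)
    \<comment> \<open>The choice \<open>s = b\<close>, \<open>t = a\<close> turns the quadratic form
      into \<open>a\<close> times the determinant \<open>a * c - b * b\<close>, so it remains to see
      that \<open>a\<close> is positive.\<close>
    have "a * (a * c - b\<^sup>2) \<ge> 0" using q[of b a] by (simp add: power2_eq_square algebra_simps)
    moreover have "a > 0"
    proof (rule ccontr)
      assume "\<not> a > 0"
      moreover have "a \<ge> 0" using nonneg[of x] by (simp add: a_def y_def)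
      ultimately have a0: "a = 0" by simp
      \<comment> \<open>For \<open>a = 0\<close> and \<open>t = 1\<close> the form is affine in
        \<open>s\<close> with slope \<open>- 2 * b\<close>; at \<open>s = c / b + 1\<close> it is
        already negative.\<close>
      have "0 \<le> 2 * (c / b + 1) * b" using \<open>0 \<le> c\<close> b by simp
      moreover have "2 * (c / b + 1) * b \<le> c" using q[of "c / b + 1" 1] a0 by simp
      ultimately show False using b \<open>0 \<le> c\<close> by (simp add: algebra_simps)
    qed
    ultimately show ?thesis
      unfolding a_def[symmetric] b_def[symmetric] c_def[symmetric]
      by (simp add: zero_le_mult_iff)
  qed
  have "x \<bullet> y < x \<bullet> x" using upper[OF x] by (simp add: y_def)
  moreover have "x \<bullet> x \<le> y \<bullet> y" using le by (simp add: norm_le)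
  ultimately have 1: "x \<bullet> y < y \<bullet> y" by simp
  have 2: "y \<bullet> (A *v y) < y \<bullet> y" using upper[OF y0] .
  have "(x \<bullet> y) * (y \<bullet> (A *v y)) \<le> (x \<bullet> y) * (y \<bullet> y)"
    using 2 nonneg[of x] by (intro mult_left_mono) (auto simp: y_def)
  also have "\<dots> < (y \<bullet> y) * (y \<bullet> y)" using 1 y0 by (intro mult_strict_right_mono) auto
  finally show False using cs by (simp add: power2_eq_square)
qed

text \<open>The unit sphere is compact, so the operator norm is attained and the pointwise strict
  inequality becomes a uniform one.\<close>

lemma contraction_constant:
  fixes A :: "real^'n^'n"
  assumes "\<And>x. x \<noteq> 0 \<Longrightarrow> norm (A *v x) < norm x"
  shows "onorm ((*v) A) < 1"
proof -
  obtain w :: "real^'n" where "norm w = 1" using vector_choose_size[of 1] by auto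
  then have "sphere (0 :: real^'n) 1 \<noteq> {}" by force
  then have "\<exists>z\<in>sphere 0 1. \<forall>y\<in>sphere 0 1. norm (A *v y) \<le> norm (A *v z)"
    by (intro continuous_attains_sup compact_sphere continuous_on_norm
        matrix_vector_mult_linear_continuous_on)
  then obtain z where "z \<in> sphere 0 1" "\<And>y. y \<in> sphere 0 1 \<Longrightarrow> norm (A *v y) \<le> norm (A *v z)"
    by blast
  then have z: "norm z = 1" "\<And>y. norm y = 1 \<Longrightarrow> norm (A *v y) \<le> norm (A *v z)"
    by simp_all
  have "onorm ((*v) A) \<le> norm (A *v z)"
  proof (rule onorm_bound)
    fix x :: "real^'n"
    show "norm (A *v x) \<le> norm (A *v z) * norm x"
    proof (cases "x = 0")
      case False
      then have "norm (A *v ((1 / norm x) *\<^sub>R x)) \<le> norm (A *v z)" by (intro z) simp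
      then show ?thesis using False by (simp add: matrix_vector_mult_scaleR field_simps)
    qed simp
  qed simp
  also have "\<dots> < 1" using assms[of z] z(1) by force
  finally show ?thesis .
qed

text \<open>\<open>(1 - x)\<^sup>2 = 1 - a\<close> is the fixed point equation \<open>x = (a + x\<^sup>2) / 2\<close>, which is a contraction
  on the ball of radius \<open>norm a < 1\<close>.\<close>

definition sqrt_defect :: "('a::real_inner \<Rightarrow>\<^sub>L 'a) \<Rightarrow> 'a \<Rightarrow>\<^sub>L 'a" where
  "sqrt_defect a = (SOME x :: 'a \<Rightarrow>\<^sub>L 'a. norm x \<le> norm a \<and> (\<forall>u v. u \<bullet> blinfun_apply x v = blinfun_apply x u \<bullet> v) \<and>
     x = (1/2) *\<^sub>R (a + (x o\<^sub>L x)))"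

text \<open>The identity x x - y y = x (x - y) + (x - y) y holds without commutativity.\<close>

lemma norm_blinfun_square_diff:
  fixes x y :: "'a::real_normed_vector \<Rightarrow>\<^sub>L 'a"
  assumes "norm x \<le> r" "norm y \<le> r"
  shows "norm ((x o\<^sub>L x) - (y o\<^sub>L y)) \<le> 2 * r * norm (x - y)"
proof -
  have "(x o\<^sub>L x) - (y o\<^sub>L y) = (x o\<^sub>L (x - y)) + ((x - y) o\<^sub>L y)"
    by (rule blinfun_eqI) (simp add: blinfun.bilinear_simps)
  then have "norm ((x o\<^sub>L x) - (y o\<^sub>L y)) \<le> norm x * norm (x - y) + norm (x - y) * norm y"
    by (metis norm_triangle_le add_mono norm_blinfun_compose)
  also have "\<dots> \<le> r * norm (x - y) + norm (x - y) * r"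
    using assms by (intro add_mono mult_right_mono mult_left_mono) auto
  finally show ?thesis by simp
qed

text \<open>Banach's theorem on the self-adjoint operators of norm at most \<open>norm a\<close>.
  This set is closed, and it is mapped into itself because the square of such an operator has norm
  at most \<open>norm a\<close>. The contraction factor is half of \<open>2 * norm a\<close>.
  Self-adjointness is built into the set so that the fixed point inherits it.\<close>

lemma sqrt_defect:
  fixes a :: "'a::euclidean_space \<Rightarrow>\<^sub>L 'a"
  assumes a: "norm a < 1" "\<And>u v. u \<bullet> blinfun_apply a v = blinfun_apply a u \<bullet> v"
  shows "norm (sqrt_defect a) \<le> norm a"
    and "u \<bullet> blinfun_apply (sqrt_defect a) v = blinfun_apply (sqrt_defect a) u \<bullet> v"
    and "sqrt_defect a = (1/2) *\<^sub>R (a + (sqrt_defect a o\<^sub>L sqrt_defect a))"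
proof -
  define B where "B = {x :: 'a \<Rightarrow>\<^sub>L 'a. norm x \<le> norm a \<and> (\<forall>u v. u \<bullet> blinfun_apply x v = blinfun_apply x u \<bullet> v)}"
  have "\<exists>!x\<in>B. (1/2) *\<^sub>R (a + (x o\<^sub>L x)) = x"
  proof (rule Banach_fix[where c = "norm a"])
    have "closed {x :: 'a \<Rightarrow>\<^sub>L 'a. \<forall>u v. u \<bullet> blinfun_apply x v = blinfun_apply x u \<bullet> v}"
      by (intro closed_Collect_all closed_Collect_eq continuous_intros)
    moreover have "B = cball 0 (norm a) \<inter> {x :: 'a \<Rightarrow>\<^sub>L 'a. \<forall>u v. u \<bullet> blinfun_apply x v = blinfun_apply x u \<bullet> v}"
      by (auto simp: B_def)
    ultimately show "complete B"
      by (simp add: complete_eq_closed closed_Int)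
    have "0 \<in> B" by (simp add: B_def)
    then show "B \<noteq> {}" by blast
    show "0 \<le> norm a" "norm a < 1" using a by auto
    show "(\<lambda>x. (1/2) *\<^sub>R (a + (x o\<^sub>L x))) ` B \<subseteq> B"
    proof (rule image_subsetI)
      fix x assume "x \<in> B"
      then have x: "norm x \<le> norm a" and sym: "\<forall>u v. u \<bullet> blinfun_apply x v = blinfun_apply x u \<bullet> v"
        by (auto simp: B_def)
      have "norm (a + (x o\<^sub>L x)) \<le> norm a + norm x * norm x"
        by (intro norm_triangle_le add_left_mono norm_blinfun_compose)
      also have "norm x * norm x \<le> norm a * 1"
        using x a by (intro mult_mono) auto
      finally have "norm (a + (x o\<^sub>L x)) \<le> 2 * norm a" by simp
      moreover have "u \<bullet> blinfun_apply ((1/2) *\<^sub>R (a + (x o\<^sub>L x))) v = blinfun_apply ((1/2) *\<^sub>R (a + (x o\<^sub>L x))) u \<bullet> v" for u v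
        using sym a(2) by (simp add: blinfun.bilinear_simps inner_add_left inner_add_right)
      ultimately show "(1/2) *\<^sub>R (a + (x o\<^sub>L x)) \<in> B"
        by (simp add: B_def)
    qed
    fix x y assume "x \<in> B" "y \<in> B"
    then have "norm ((x o\<^sub>L x) - (y o\<^sub>L y)) \<le> 2 * norm a * norm (x - y)"
      by (intro norm_blinfun_square_diff) (auto simp: B_def)
    moreover have "(1/2) *\<^sub>R (a + (x o\<^sub>L x)) - (1/2) *\<^sub>R (a + (y o\<^sub>L y)) = (1/2) *\<^sub>R ((x o\<^sub>L x) - (y o\<^sub>L y))"
      by (simp add: algebra_simps)
    ultimately show "dist ((1/2) *\<^sub>R (a + (x o\<^sub>L x))) ((1/2) *\<^sub>R (a + (y o\<^sub>L y))) \<le> norm a * dist x y"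
      by (simp add: dist_norm)
  qed
  then have "\<exists>x :: 'a \<Rightarrow>\<^sub>L 'a. norm x \<le> norm a \<and> (\<forall>u v. u \<bullet> blinfun_apply x v = blinfun_apply x u \<bullet> v) \<and>
     x = (1/2) *\<^sub>R (a + (x o\<^sub>L x))"
    unfolding B_def by (smt (verit, best) mem_Collect_eq)
  from someI_ex[OF this, folded sqrt_defect_def]
  show "norm (sqrt_defect a) \<le> norm a" "u \<bullet> blinfun_apply (sqrt_defect a) v = blinfun_apply (sqrt_defect a) u \<bullet> v"
    "sqrt_defect a = (1/2) *\<^sub>R (a + (sqrt_defect a o\<^sub>L sqrt_defect a))" by blast+
qed

text \<open>Subtracting the two fixed point equations bounds twice the distance of the solutions by
  \<open>norm (a - b)\<close> plus \<open>2 * r\<close> times that distance; since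
  \<open>r < 1\<close>, the last term can be absorbed.\<close>

lemma sqrt_defect_lipschitz:
  fixes a b :: "'a::euclidean_space \<Rightarrow>\<^sub>L 'a"
  assumes a: "norm a \<le> r" "\<And>u v. u \<bullet> blinfun_apply a v = blinfun_apply a u \<bullet> v"
    and b: "norm b \<le> r" "\<And>u v. u \<bullet> blinfun_apply b v = blinfun_apply b u \<bullet> v" and "r < 1"
  shows "norm (sqrt_defect a - sqrt_defect b) \<le> norm (a - b) / (2 * (1 - r))"
proof -
  let ?x = "sqrt_defect a" and ?y = "sqrt_defect b"
  have xa: "norm ?x \<le> r" "?x = (1/2) *\<^sub>R (a + (?x o\<^sub>L ?x))"
    using sqrt_defect[of a] a \<open>r < 1\<close> by force+
  have yb: "norm ?y \<le> r" "?y = (1/2) *\<^sub>R (b + (?y o\<^sub>L ?y))"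
    using sqrt_defect[of b] b \<open>r < 1\<close> by force+
  have "?x - ?y = (1/2) *\<^sub>R (a + (?x o\<^sub>L ?x)) - (1/2) *\<^sub>R (b + (?y o\<^sub>L ?y))"
    using xa(2) yb(2) by argo
  also have "\<dots> = (1/2) *\<^sub>R ((a - b) + ((?x o\<^sub>L ?x) - (?y o\<^sub>L ?y)))"
    by (simp add: algebra_simps)
  finally have "2 * norm (?x - ?y) = norm ((a - b) + ((?x o\<^sub>L ?x) - (?y o\<^sub>L ?y)))"
    by simp
  also have "\<dots> \<le> norm (a - b) + 2 * r * norm (?x - ?y)"
    using norm_blinfun_square_diff[OF xa(1) yb(1)] by (intro norm_triangle_le) simp
  finally show ?thesis using \<open>r < 1\<close> by (simp add: field_simps)
qed

lemma continuous_on_sqrt_defect: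
  fixes S :: "('a::euclidean_space \<Rightarrow>\<^sub>L 'a) set"
  assumes "\<And>a. a \<in> S \<Longrightarrow> norm a < 1 \<and> (\<forall>u v. u \<bullet> blinfun_apply a v = blinfun_apply a u \<bullet> v)"
  shows "continuous_on S sqrt_defect"
  unfolding continuous_on_iff
proof (intro ballI allI impI)
  fix a e assume a: "a \<in> S" and e: "(0::real) < e"
  \<comment> \<open>The Lipschitz constant blows up as the radius tends to 1, so the estimate is
    made on a ball whose radius lies halfway between \<open>norm a\<close> and 1.\<close>
  define r where "r = (1 + norm a) / 2"
  have r: "norm a < r" "r < 1" using assms[OF a] by (auto simp: r_def)
  show "\<exists>d>0. \<forall>b\<in>S. dist b a < d \<longrightarrow> dist (sqrt_defect b) (sqrt_defect a) < e"
  proof (intro exI[of _ "min (r - norm a) (e * (2 * (1 - r)))"] conjI ballI impI)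
    show "0 < min (r - norm a) (e * (2 * (1 - r)))" using r e by simp
    fix b assume b: "b \<in> S" "dist b a < min (r - norm a) (e * (2 * (1 - r)))"
    have "norm b \<le> norm a + norm (b - a)" using norm_triangle_sub by blast
    then have "norm b \<le> r" using b(2) by (simp add: dist_norm)
    then have "dist (sqrt_defect b) (sqrt_defect a) \<le> norm (b - a) / (2 * (1 - r))"
      using assms[OF a] assms[OF b(1)] r unfolding dist_norm
      by (intro sqrt_defect_lipschitz) auto
    also have "\<dots> < e" using b(2) r by (simp add: dist_norm field_simps)
    finally show "dist (sqrt_defect b) (sqrt_defect a) < e" .
  qed
qed

text \<open>Dividing by the norm brings the spectrum of a positive definite \<open>S\<close> into
  the interval from 0 (excluded) to 1, so that 1 - S / |S| is a contraction. The root of S / |S| is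
  1 minus the defect of this contraction.\<close>

definition matrix_sqrt :: "real^'n^'n \<Rightarrow> real^'n^'n" where
  "matrix_sqrt S = sqrt (norm S) *\<^sub>R
     (mat 1 - matrix (blinfun_apply (sqrt_defect (Blinfun ((*v) (mat 1 - (1 / norm S) *\<^sub>R S))))))"

text \<open>Cauchy--Schwarz in each row; the norm of a matrix is the Euclidean norm of its entries,
  not the operator norm.\<close>

lemma norm_matrix_vector_mult_le:
  fixes A :: "real^'n^'m"
  shows "norm (A *v x) \<le> norm A * norm x"
proof -
  have "(norm (A *v x))\<^sup>2 = (\<Sum>i\<in>UNIV. (A $ i \<bullet> x)\<^sup>2)"
    by (simp add: norm_vec_def L2_set_def matrix_vector_mult_def inner_vec_def sum_nonneg)
  also have "\<dots> \<le> (\<Sum>i\<in>UNIV. (norm (A $ i) * norm x)\<^sup>2)"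
    by (intro sum_mono) (metis Cauchy_Schwarz_ineq2 power2_abs power_mono abs_ge_zero)
  also have "\<dots> = (norm A * norm x)\<^sup>2"
    by (simp add: norm_vec_def[of A] L2_set_def power_mult_distrib sum_distrib_right sum_nonneg)
  finally show ?thesis by (rule power2_le_imp_le) simp
qed

context
  fixes S :: "real^'n^'n"
  assumes S: "pos_def S"
begin

lemma pos_def_norm_pos: "norm S > 0"
proof -
  obtain x :: "real^'n" where "x \<noteq> 0" using vector_choose_size[of 1, where 'a="real^'n"] by auto
  then have "S \<noteq> 0" using S unfolding pos_def_def by force
  then show ?thesis by simp
qed

text \<open>The form of \<open>S\<close> is positive and at most |S| times the square of the
  Euclidean norm. The form of 1 - S / |S| is therefore nonnegative and strictly below that of the
  identity, which makes it a contraction.\<close>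

lemma pos_def_defect:
  fixes a :: "(real^'n) \<Rightarrow>\<^sub>L (real^'n)"
  defines "a \<equiv> Blinfun ((*v) (mat 1 - (1 / norm S) *\<^sub>R S))"
  shows "blinfun_apply a = (*v) (mat 1 - (1 / norm S) *\<^sub>R S)" "norm a < 1" "u \<bullet> blinfun_apply a v = blinfun_apply a u \<bullet> v"
proof -
  let ?A = "mat 1 - (1 / norm S) *\<^sub>R S"
  show app: "blinfun_apply a = (*v) ?A" by (simp add: a_def bounded_linear_Blinfun_apply)
  have sym: "transpose ?A = ?A" using S by (simp add: pos_def_def transpose_mat)
  have form: "x \<bullet> (?A *v x) = x \<bullet> x - (x \<bullet> (S *v x)) / norm S" for x
    by (simp add: matrix_vector_mult_diff_rdistrib inner_diff_right scaleR_matrix_vector_assoc[symmetric])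
  have "norm (?A *v x) < norm x" if "x \<noteq> 0" for x
  proof (rule norm_less_of_form_bounds[OF sym that])
    fix x
    have "x \<bullet> (S *v x) \<le> norm x * norm (S *v x)" by (rule norm_cauchy_schwarz)
    also have "\<dots> \<le> norm x * (norm S * norm x)"
      by (intro mult_left_mono norm_matrix_vector_mult_le) simp
    finally show "0 \<le> x \<bullet> (?A *v x)" unfolding form using pos_def_norm_pos
      by (simp add: field_simps power2_norm_eq_inner[symmetric] power2_eq_square)
    assume "x \<noteq> 0"
    then show "x \<bullet> (?A *v x) < x \<bullet> x" unfolding form using S pos_def_norm_pos
      by (simp add: pos_def_def)
  qed
  then show "norm a < 1" using contraction_constant[of ?A] by (simp add: norm_blinfun.rep_eq app)
  show "u \<bullet> blinfun_apply a v = blinfun_apply a u \<bullet> v" unfolding app by (rule symmetric_matrix_inner[OF sym])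
qed

text \<open>With \<open>x\<close> the defect of \<open>a\<close>, the square of 1 - x is 1 - 2 x + x
  x = 1 - a = S / |S|. Positivity of 1 - x follows from \<open>norm x\<close> being at most
  \<open>norm a\<close>, which is less than 1.\<close>

lemma matrix_sqrt: "pos_def (matrix_sqrt S)" "matrix_sqrt S ** matrix_sqrt S = S"
proof -
  define a :: "(real^'n) \<Rightarrow>\<^sub>L (real^'n)" where "a = Blinfun ((*v) (mat 1 - (1 / norm S) *\<^sub>R S))"
  note a = pos_def_defect[folded a_def]
  define x where "x = sqrt_defect a"
  note x = sqrt_defect[OF a(2,3), folded x_def]
  have sq: "matrix_sqrt S *v v = sqrt (norm S) *\<^sub>R (v - blinfun_apply x v)" for v
    unfolding matrix_sqrt_def a_def[symmetric] x_def[symmetric]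
    by (simp add: scaleR_matrix_vector_assoc[symmetric] matrix_vector_mult_diff_rdistrib
        matrix_works blinfun.bounded_linear_right bounded_linear.linear)
  have fix_eq: "2 *\<^sub>R blinfun_apply x v = blinfun_apply a v + blinfun_apply x (blinfun_apply x v)" for v
  proof -
    have "blinfun_apply (2 *\<^sub>R x) v = blinfun_apply (a + (x o\<^sub>L x)) v"
      by (subst x(3)) simp
    then show ?thesis by (simp add: blinfun.bilinear_simps)
  qed
  show "matrix_sqrt S ** matrix_sqrt S = S"
  proof (unfold matrix_eq, intro allI)
    fix v
    have "(matrix_sqrt S ** matrix_sqrt S) *v v = norm S *\<^sub>R ((v - blinfun_apply x v) - blinfun_apply x (v - blinfun_apply x v))"
      using pos_def_norm_pos by (simp only: matrix_vector_mul_assoc[symmetric] sq blinfun.scaleR_right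
          scaleR_diff_right[symmetric] scaleR_scaleR) simp
    also have "(v - blinfun_apply x v) - blinfun_apply x (v - blinfun_apply x v) = v - 2 *\<^sub>R blinfun_apply x v + blinfun_apply x (blinfun_apply x v)"
      by (simp add: blinfun.bilinear_simps scaleR_2)
    also have "\<dots> = v - blinfun_apply a v" unfolding fix_eq by simp
    also have "norm S *\<^sub>R (v - blinfun_apply a v) = S *v v"
      using pos_def_norm_pos unfolding a(1)
      by (simp add: matrix_vector_mult_diff_rdistrib scaleR_matrix_vector_assoc[symmetric])
    finally show "(matrix_sqrt S ** matrix_sqrt S) *v v = S *v v" .
  qed
  show "pos_def (matrix_sqrt S)"
    unfolding pos_def_def
  proof (intro conjI allI impI)
    have "u \<bullet> (transpose (matrix_sqrt S) *v v) = u \<bullet> (matrix_sqrt S *v v)" for u v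
    proof -
      have "u \<bullet> (transpose (matrix_sqrt S) *v v) = (matrix_sqrt S *v u) \<bullet> v"
        by (metis dot_lmul_matrix inner_commute transpose_matrix_vector)
      also have "\<dots> = u \<bullet> (matrix_sqrt S *v v)"
        using x(2)[of u v] by (simp add: sq inner_diff_left inner_diff_right)
      finally show ?thesis .
    qed
    then show "transpose (matrix_sqrt S) = matrix_sqrt S"
      unfolding matrix_eq by (metis vector_eq_ldot)
    fix v :: "real^'n" assume "v \<noteq> 0"
    have "v \<bullet> blinfun_apply x v \<le> norm v * norm (blinfun_apply x v)" by (rule norm_cauchy_schwarz)
    also have "\<dots> \<le> norm v * (norm x * norm v)"
      by (intro mult_left_mono norm_blinfun) simp
    also have "\<dots> < norm v * (1 * norm v)"
      using \<open>v \<noteq> 0\<close> x(1) a(2) by (intro mult_strict_left_mono mult_strict_right_mono) auto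
    finally have "v \<bullet> blinfun_apply x v < v \<bullet> v" by (simp add: power2_norm_eq_inner[symmetric] power2_eq_square)
    then show "0 < v \<bullet> (matrix_sqrt S *v v)"
      using pos_def_norm_pos by (simp add: sq inner_diff_right)
  qed
qed

end

lemma continuous_on_matrix_sqrt: "continuous_on {S :: real^'n^'n. pos_def S} matrix_sqrt"
proof -
  let ?D = "{S :: real^'n^'n. pos_def S}"
  define F :: "real^'n^'n \<Rightarrow> (real^'n) \<Rightarrow>\<^sub>L (real^'n)" where "F = (\<lambda>A. Blinfun ((*v) A))"
  define F' :: "((real^'n) \<Rightarrow>\<^sub>L (real^'n)) \<Rightarrow> real^'n^'n" where "F' = (\<lambda>x. matrix (blinfun_apply x))"
  have F_app: "blinfun_apply (F A) = (*v) A" for A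
    by (simp add: F_def bounded_linear_Blinfun_apply)
  have "linear F"
    by (intro linearI blinfun_eqI)
      (simp_all add: F_app blinfun.bilinear_simps matrix_vector_mult_add_rdistrib
        scaleR_matrix_vector_assoc)
  then have cF: "continuous_on X F" for X
    by (intro linear_continuous_on linear_conv_bounded_linear[THEN iffD1])
  have cF': "continuous_on X F'" for X
    unfolding F'_def matrix_def by (intro continuous_intros)
  have nz: "norm S \<noteq> 0" if "S \<in> ?D" for S
    using pos_def_norm_pos that by (metis mem_Collect_eq less_irrefl)
  have 1: "continuous_on ?D (\<lambda>S. F (mat 1 - (1 / norm S) *\<^sub>R S))"
    by (rule continuous_on_compose2[OF cF[of UNIV]]) (use nz in \<open>auto intro!: continuous_intros\<close>)
  have 2: "continuous_on ((\<lambda>S. F (mat 1 - (1 / norm S) *\<^sub>R S)) ` ?D) sqrt_defect"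
  proof (rule continuous_on_sqrt_defect, clarify)
    fix S :: "real^'n^'n" assume "pos_def S"
    from pos_def_defect[OF this, folded F_def]
    show "norm (F (mat 1 - (1 / norm S) *\<^sub>R S)) < 1 \<and>
      (\<forall>u v. u \<bullet> blinfun_apply (F (mat 1 - (1 / norm S) *\<^sub>R S)) v =
        blinfun_apply (F (mat 1 - (1 / norm S) *\<^sub>R S)) u \<bullet> v)"
      by (simp add: F_def)
  qed
  have "continuous_on ?D (\<lambda>S. sqrt_defect (F (mat 1 - (1 / norm S) *\<^sub>R S)))"
    by (rule continuous_on_compose2[OF 2 1 subset_refl])
  then have "continuous_on ?D (\<lambda>S. F' (sqrt_defect (F (mat 1 - (1 / norm S) *\<^sub>R S))))"
    by (rule continuous_on_compose2[OF cF'[of UNIV]]) auto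
  then show ?thesis
    unfolding matrix_sqrt_def[abs_def] F_def F'_def
    by (intro continuous_on_scaleR continuous_on_diff continuous_on_const continuous_on_real_sqrt
        continuous_on_norm continuous_on_id)
qed

text \<open>For D = P - R the hypothesis gives P D + D R = 0. Multiplying by D and taking the trace
  yields tr (D P D) + tr (D R D) = 0. Both terms are nonnegative, being sums of values of positive
  definite forms at the columns of D, so these columns vanish.\<close>

lemma pos_def_sqrt_unique:
  fixes P R :: "real^'n^'n"
  assumes P: "pos_def P" and R: "pos_def R" and eq: "P ** P = R ** R"
  shows "P = R"
proof -
  define D where "D = P - R"
  have D: "transpose D = D" using P R by (simp add: D_def pos_def_def)
  have "P ** D + D ** R = 0" by (simp add: D_def matrix_mult_add_distrib eq)
  then have "D ** P ** D + D ** D ** R = 0"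
    by (metis matrix_mul_assoc matrix_add_ldistrib times0_right)
  then have "trace (D ** P ** D) + trace (D ** D ** R) = 0"
    by (metis trace_add trace_0 mat_0)
  moreover have "trace (D ** D ** R) = trace (D ** R ** D)"
    by (metis matrix_mul_assoc trace_mul_sym)
  moreover have tr: "trace (D ** Q ** D) = (\<Sum>j\<in>UNIV. (D *v axis j 1) \<bullet> (Q *v (D *v axis j 1)))" for Q
  proof -
    have "(D ** Q ** D) $ j $ j = (D *v axis j 1) \<bullet> (Q *v (D *v axis j 1))" for j
    proof -
      have "(D ** Q ** D) $ j $ j = axis j 1 \<bullet> ((D ** Q ** D) *v axis j 1)"
        by (simp add: inner_axis' matrix_vector_mult_basis column_def)
      also have "\<dots> = axis j 1 \<bullet> (D *v (Q *v (D *v axis j 1)))"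
        by (simp add: matrix_vector_mul_assoc matrix_mul_assoc)
      finally show ?thesis by (simp add: symmetric_matrix_inner[OF D])
    qed
    then show ?thesis by (simp add: trace_def)
  qed
  moreover have nonneg: "0 \<le> x \<bullet> (Q *v x)" if "pos_def Q" for Q :: "real^'n^'n" and x
    using that unfolding pos_def_def by (cases "x = 0") (auto intro: less_imp_le)
  have "0 \<le> trace (D ** P ** D)" "0 \<le> trace (D ** R ** D)"
    unfolding tr using nonneg P R by (auto intro!: sum_nonneg)
  ultimately have "trace (D ** P ** D) = 0" by linarith
  then have "(\<Sum>j\<in>UNIV. (D *v axis j 1) \<bullet> (P *v (D *v axis j 1))) = 0"
    unfolding tr .
  then have "(D *v axis j 1) \<bullet> (P *v (D *v axis j 1)) = 0" for j
    using nonneg[OF P] by (simp add: sum_nonneg_eq_0_iff)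
  then have "D *v axis j 1 = 0" for j
    using P unfolding pos_def_def by (metis less_irrefl)
  then have "D = 0" by (simp add: vec_eq_iff matrix_vector_mult_basis column_def)
  then show ?thesis by (simp add: D_def)
qed

lemma inner_matrix_vector:
  fixes A :: "real^'n^'m"
  shows "(A *v x) \<bullet> y = x \<bullet> (transpose A *v y)"
  by (metis dot_lmul_matrix inner_commute transpose_matrix_vector)

lemma invertible_transpose:
  fixes A :: "real^'n^'n"
  shows "invertible A \<Longrightarrow> invertible (transpose A)"
  by (simp add: invertible_det_nz det_transpose)

section \<open>The symplectic group\<close>

notation symplectic_form ("\<Omega>")

lemma sum_UNIV_sum:
  fixes f :: "'a::finite + 'b::finite \<Rightarrow> 'c::comm_monoid_add"
  shows "(\<Sum>x\<in>UNIV. f x) = (\<Sum>a\<in>UNIV. f (Inl a)) + (\<Sum>b\<in>UNIV. f (Inr b))"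
  by (subst UNIV_Plus_UNIV[symmetric], subst sum.Plus) auto

lemma block_matrix_mult:
  "block_matrix A B C D ** block_matrix A' B' C' D' =
     block_matrix (A ** A' + B ** C') (A ** B' + B ** D') (C ** A' + D ** C') (C ** B' + D ** D')"
  unfolding block_matrix_def
  by (simp add: vec_eq_iff matrix_matrix_mult_def sum_UNIV_sum split: sum.split)

lemma block_matrix_simps:
  "transpose (block_matrix A B C D) = block_matrix (transpose A) (transpose C) (transpose B) (transpose D)"
  "- block_matrix A B C D = block_matrix (- A) (- B) (- C) (- D)"
  "mat 1 = block_matrix (mat 1) 0 0 (mat 1)"
  unfolding block_matrix_def
  by (simp_all add: vec_eq_iff transpose_def mat_def split: sum.split)

lemma symplectic_form_square [simp]: "\<Omega> ** \<Omega> = - mat 1"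
  by (simp add: symplectic_form_def block_matrix_mult block_matrix_simps)

lemma symplectic_form_transpose [simp]: "transpose \<Omega> = - \<Omega>"
  unfolding symplectic_form_def
  by (simp add: block_matrix_simps transpose_mat) (simp add: transpose_def zero_vec_def)

lemma symplectic_form_assoc [simp]: "M ** \<Omega> ** \<Omega> = - M"
  by (simp add: matrix_mul_assoc[symmetric])

lemma Sp_simps [simp]:
  "monoid.mult Sp = (**)" "one Sp = mat 1"
  by (simp_all add: Sp_def)

lemma carrier_Sp: "M \<in> carrier Sp \<longleftrightarrow> transpose M ** \<Omega> ** M = \<Omega>"
  by (simp add: Sp_def)

text \<open>This is the conjugate transpose with respect to the symplectic form, rewritten with the
  inverse of \<Omega> equal to - \<Omega>. Being polynomial in the entries, it is continuous on all
  matrices.\<close>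

definition Sp_inv :: "('n::finite) real_2n_matrix \<Rightarrow> 'n real_2n_matrix" where
  "Sp_inv M = - (\<Omega> ** transpose M ** \<Omega>)"

lemma Sp_inv:
  assumes "M \<in> carrier Sp"
  shows "Sp_inv M ** M = mat 1" "M ** Sp_inv M = mat 1"
proof -
  have "Sp_inv M ** M = - (\<Omega> ** (transpose M ** \<Omega> ** M))"
    by (simp add: Sp_inv_def matrix_mul_assoc)
  then show "Sp_inv M ** M = mat 1" using assms by (simp add: carrier_Sp)
  then show "M ** Sp_inv M = mat 1" by (simp add: matrix_left_right_inverse)
qed

lemma Sp_one: "mat 1 \<in> carrier Sp" and Sp_uminus: "M \<in> carrier Sp \<Longrightarrow> - M \<in> carrier Sp"
  by (simp_all add: carrier_Sp transpose_mat)

lemma Sp_mult: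
  assumes "M \<in> carrier Sp" "N \<in> carrier Sp"
  shows "M ** N \<in> carrier Sp"
proof -
  have "transpose (M ** N) ** \<Omega> ** (M ** N) = transpose N ** (transpose M ** \<Omega> ** M) ** N"
    by (simp add: matrix_transpose_mul matrix_mul_assoc)
  then show ?thesis using assms by (simp add: carrier_Sp)
qed

lemma Sp_transpose:
  assumes "M \<in> carrier Sp"
  shows "transpose M \<in> carrier Sp"
proof -
  have "M ** \<Omega> ** transpose M = (M ** - (\<Omega> ** transpose M ** \<Omega>)) ** \<Omega>"
    by (simp add: matrix_mul_assoc)
  also have "\<dots> = \<Omega>" using Sp_inv(2)[OF assms] by (simp add: Sp_inv_def)
  finally show ?thesis by (simp add: carrier_Sp)
qed

lemma Sp_symplectic_form: "\<Omega> \<in> carrier Sp"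
  by (simp add: carrier_Sp)

lemma Sp_inv_in: "M \<in> carrier Sp \<Longrightarrow> Sp_inv M \<in> carrier Sp"
  unfolding Sp_inv_def by (intro Sp_uminus Sp_mult Sp_symplectic_form Sp_transpose)

lemma group_Sp: "group Sp"
proof (rule groupI)
  show "\<exists>y\<in>carrier Sp. y \<otimes>\<^bsub>Sp\<^esub> x = \<one>\<^bsub>Sp\<^esub>" if "x \<in> carrier Sp" for x :: "'a real_2n_matrix"
    using that Sp_inv Sp_inv_in by (intro bexI[of _ "Sp_inv x"]) auto
qed (simp_all add: Sp_mult Sp_one matrix_mul_assoc)

lemma inv_Sp: "M \<in> carrier Sp \<Longrightarrow> inv\<^bsub>Sp\<^esub> M = Sp_inv M"
  by (rule group.inv_equality[OF group_Sp]) (simp_all add: Sp_inv Sp_inv_in)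

lemma invertible_Sp: "M \<in> carrier Sp \<Longrightarrow> invertible M"
  using Sp_inv unfolding invertible_def by blast

lemma closed_Sp: "closed (carrier Sp :: ('n::finite) real_2n_matrix set)"
proof -
  have "carrier Sp = {M :: 'n real_2n_matrix. transpose M ** \<Omega> ** M = \<Omega>}"
    by (auto simp: carrier_Sp)
  then show ?thesis by (simp add: closed_Collect_eq continuous_intros)
qed

lemma continuous_on_Sp_inv [continuous_intros]:
  "continuous_on S f \<Longrightarrow> continuous_on S (\<lambda>x. Sp_inv (f x))"
  unfolding Sp_inv_def by (intro continuous_intros)

lemma symplectic_form_alternating:
  "x \<bullet> (\<Omega> *v y) = - (y \<bullet> (\<Omega> *v x))" "x \<bullet> (\<Omega> *v x) = 0"
proof -
  show *: "x \<bullet> (\<Omega> *v y) = - (y \<bullet> (\<Omega> *v x))" for x y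
  proof -
    have "x \<bullet> (\<Omega> *v y) = (transpose \<Omega> *v x) \<bullet> y"
      by (simp only: dot_lmul_matrix transpose_matrix_vector)
    then show ?thesis by (simp only: symplectic_form_transpose) (simp add: inner_commute)
  qed
  show "x \<bullet> (\<Omega> *v x) = 0" using *[of x x] by simp
qed

lemma Sp_iff_form:
  "M \<in> carrier Sp \<longleftrightarrow> (\<forall>x y. (M *v x) \<bullet> (\<Omega> *v (M *v y)) = x \<bullet> (\<Omega> *v y))"
proof -
  have "(M *v x) \<bullet> (\<Omega> *v (M *v y)) = x \<bullet> ((transpose M ** \<Omega> ** M) *v y)" for x y
    by (simp only: inner_matrix_vector matrix_vector_mul_assoc matrix_mul_assoc)
  then show ?thesis
    unfolding carrier_Sp matrix_eq by (simp only:) (metis vector_eq_ldot)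
qed

text \<open>A matrix commuting with the transvections \<open>x \<mapsto> x + \<omega>(v, x) v\<close> has every vector \<open>v\<close> as an
  eigenvector.\<close>

lemma Sp_center:
  fixes M :: "('n::finite) real_2n_matrix"
  assumes M: "M \<in> carrier Sp" and comm: "\<And>T. T \<in> carrier Sp \<Longrightarrow> M ** T = T ** M"
  shows "M = mat 1 \<or> M = - mat 1"
proof -
  define T where "T = (\<lambda>v. mat 1 + (\<chi> i j. v $ i * (v v* \<Omega>) $ j) :: 'n real_2n_matrix)"
  have T: "T v *v x = x + (v \<bullet> (\<Omega> *v x)) *\<^sub>R v" for v x
  proof -
    have "(\<chi> i j. v $ i * (v v* \<Omega>) $ j) *v x = ((v v* \<Omega>) \<bullet> x) *\<^sub>R v"
      by (simp add: vec_eq_iff matrix_vector_mult_def inner_vec_def sum_distrib_left mult_ac)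
    then show ?thesis
      by (simp add: T_def matrix_vector_mult_add_rdistrib dot_lmul_matrix)
  qed
  have T_Sp: "T v \<in> carrier Sp" for v
    unfolding Sp_iff_form T
  proof (intro allI)
    fix x y
    have "(x + (v \<bullet> (\<Omega> *v x)) *\<^sub>R v) \<bullet> (\<Omega> *v (y + (v \<bullet> (\<Omega> *v y)) *\<^sub>R v)) =
      x \<bullet> (\<Omega> *v y) + (v \<bullet> (\<Omega> *v y)) * (x \<bullet> (\<Omega> *v v)) + (v \<bullet> (\<Omega> *v x)) * (v \<bullet> (\<Omega> *v y))
        + (v \<bullet> (\<Omega> *v x)) * (v \<bullet> (\<Omega> *v y)) * (v \<bullet> (\<Omega> *v v))"
      by (simp add: matrix_vector_right_distrib matrix_vector_mult_scaleR inner_add_left inner_add_right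
          algebra_simps)
    then show "(x + (v \<bullet> (\<Omega> *v x)) *\<^sub>R v) \<bullet> (\<Omega> *v (y + (v \<bullet> (\<Omega> *v y)) *\<^sub>R v)) = x \<bullet> (\<Omega> *v y)"
      using symplectic_form_alternating(1)[of x v] symplectic_form_alternating(2)[of v] by simp
  qed
  have eig: "\<exists>c. M *v v = c *\<^sub>R v" if "v \<noteq> 0" for v
  proof -
    \<comment> \<open>Since \<Omega> squares to -1, this \<open>w\<close> has pairing |v|^2 with
      \<open>v\<close>. The transvection then moves \<open>w\<close> by a nonzero multiple of
      \<open>v\<close>, and commutation with \<open>M\<close> exhibits \<open>M *v v\<close> as a
      multiple of \<open>v\<close>.\<close>
    define w where "w = \<Omega> *v (- v)"
    have w: "v \<bullet> (\<Omega> *v w) = v \<bullet> v" by (simp add: w_def matrix_vector_mul_assoc)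
    have "M *v (T v *v w) = T v *v (M *v w)"
      using comm[OF T_Sp] by (simp add: matrix_vector_mul_assoc)
    then have "(v \<bullet> v) *\<^sub>R (M *v v) = (v \<bullet> (\<Omega> *v (M *v w))) *\<^sub>R v"
      unfolding T by (simp add: matrix_vector_right_distrib matrix_vector_mult_scaleR w)
    then have "M *v v = ((v \<bullet> (\<Omega> *v (M *v w))) / (v \<bullet> v)) *\<^sub>R v"
      using that by (simp add: eq_vector_fraction_iff)
    then show ?thesis by blast
  qed
  then obtain c where c: "\<And>v. v \<noteq> 0 \<Longrightarrow> M *v v = c v *\<^sub>R v" by metis
  \<comment> \<open>The sum of two distinct basis vectors is an eigenvector as well; comparing
    coordinates forces the two eigenvalues to agree.\<close>
  have same: "c (axis i 1) = c (axis j 1)" for i j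
  proof (cases "i = j")
    case False
    let ?e = "axis i 1 :: real^('n+'n)" and ?f = "axis j 1 :: real^('n+'n)"
    have "?e + ?f \<noteq> 0" by (auto simp: vec_eq_iff axis_def intro!: exI[of _ i])
    then have "c (?e + ?f) *\<^sub>R (?e + ?f) = M *v (?e + ?f)" by (rule c[symmetric])
    also have "\<dots> = c ?e *\<^sub>R ?e + c ?f *\<^sub>R ?f"
      by (simp add: matrix_vector_right_distrib c axis_eq_0_iff)
    finally have "c (?e + ?f) *\<^sub>R (?e + ?f) = c ?e *\<^sub>R ?e + c ?f *\<^sub>R ?f" .
    from arg_cong[OF this, of "\<lambda>v. v $ i"] arg_cong[OF this, of "\<lambda>v. v $ j"] show ?thesis
      using False by (simp add: axis_def)
  qed simp
  fix k :: "'n + 'n"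
  have "M = c (axis k 1) *\<^sub>R mat 1"
  proof -
    have "M $ i $ j = c (axis k 1) * (if i = j then 1 else 0)" for i j
    proof -
      have "column j M = c (axis k 1) *\<^sub>R axis j 1"
        using c[of "axis j 1"] same[of j k] by (simp add: matrix_vector_mult_basis axis_eq_0_iff)
      from arg_cong[OF this, of "\<lambda>v. v $ i"] show ?thesis by (simp add: column_def axis_def)
    qed
    then show ?thesis by (simp add: vec_eq_iff mat_def)
  qed
  then obtain a where a: "M = a *\<^sub>R mat 1" by blast
  then have "(a * a) *\<^sub>R \<Omega> = (\<Omega> :: 'n real_2n_matrix)"
    using M by (simp add: carrier_Sp transpose_mat scalar_matrix_assoc[symmetric] matrix_scalar_ac)
  moreover have "\<Omega> \<noteq> (0 :: 'n real_2n_matrix)"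
  proof
    assume "\<Omega> = (0 :: 'n real_2n_matrix)"
    then have "(mat 1 :: 'n real_2n_matrix) = 0" using symplectic_form_square by (metis neg_0_equal_iff_equal times0_left)
    from arg_cong[OF this, of "\<lambda>A. A $ undefined $ undefined"] show False by (simp add: mat_def)
  qed
  ultimately have "a * a = 1" by (metis scaleR_cancel_right scaleR_one)
  then have "a = 1 \<or> a = - 1" by (simp add: square_eq_1_iff)
  then show ?thesis using a by auto
qed

subsection \<open>Paths in the symplectic group\<close>

text \<open>Unlike \<open>pos_def\<close> this asks for no symmetry, so it also covers every matrix
  at distance less than 1 from the identity, where short paths are wanted.\<close>

definition form_positive :: "real^'n^'n \<Rightarrow> bool" where
  "form_positive M \<longleftrightarrow> (\<forall>x. x \<noteq> 0 \<longrightarrow> x \<bullet> (M *v x) > 0)"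

text \<open>The Cayley transform turns the segment from \<open>0\<close> to \<open>(M - 1) (M + 1)\<^sup>-\<^sup>1\<close> into this path from
  \<open>1\<close> to \<open>M\<close>.\<close>

definition cayley_path :: "real^'n^'n \<Rightarrow> real \<Rightarrow> real^'n^'n" where
  "cayley_path M t = ((1 + t) *\<^sub>R M + (1 - t) *\<^sub>R mat 1) **
     matrix_inv ((1 - t) *\<^sub>R M + (1 + t) *\<^sub>R mat 1)"

lemma form_positive_invertible: "form_positive M \<Longrightarrow> invertible M"
  unfolding form_positive_def invertible_left_inverse matrix_left_invertible_ker
  by (metis inner_zero_right less_irrefl)

lemma cayley_denominator_invertible:
  assumes "form_positive M" "t \<in> {0..1}"
  shows "invertible ((1 - t) *\<^sub>R M + (1 + t) *\<^sub>R mat 1)"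
proof (rule form_positive_invertible, unfold form_positive_def, intro allI impI)
  fix x :: "real^'a" assume "x \<noteq> 0"
  then have "0 \<le> x \<bullet> (M *v x)" "0 < x \<bullet> x"
    using assms(1) by (auto simp: form_positive_def intro: less_imp_le)
  then have "0 \<le> (1 - t) * (x \<bullet> (M *v x))" "0 < (1 + t) * (x \<bullet> x)"
    using assms(2) by simp_all
  then show "0 < x \<bullet> (((1 - t) *\<^sub>R M + (1 + t) *\<^sub>R mat 1) *v x)"
    by (simp add: matrix_vector_mult_add_rdistrib scaleR_matrix_vector_assoc[symmetric] inner_add_right)
qed

lemma cayley_path_endpoints:
  assumes "form_positive M"
  shows "cayley_path M 0 = mat 1" "cayley_path M 1 = M"
proof -
  show "cayley_path M 0 = mat 1"
    using cayley_denominator_invertible[OF assms, of 0]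
    by (simp add: cayley_path_def matrix_inv_mult)
  have "matrix_inv (2 *\<^sub>R mat 1 :: real^'a^'a) = (1/2) *\<^sub>R mat 1"
  proof -
    have "invertible (2 *\<^sub>R mat 1 :: real^'a^'a)"
      using cayley_denominator_invertible[OF assms, of 1] by simp
    from matrix_inv_mult(1)[OF this]
    have "2 *\<^sub>R matrix_inv (2 *\<^sub>R mat 1 :: real^'a^'a) = mat 1"
      by (simp add: scalar_matrix_assoc[symmetric])
    then show ?thesis by (metis scaleR_half_double scaleR_scaleR scaleR_2 scaleR_one
          field_sum_of_halves nonzero_eq_divide_eq zero_neq_numeral scaleR_left_imp_eq divide_self)
  qed
  then show "cayley_path M 1 = M"
    by (simp add: cayley_path_def matrix_scalar_ac)
qed

text \<open>Constancy of the path at the identity starts the tube argument for local path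
  connectedness and makes the lifted retraction fix unitary elements.\<close>

lemma cayley_path_one:
  assumes "t \<in> {0..1}"
  shows "cayley_path (mat 1) t = mat 1"
proof -
  have "form_positive (mat 1 :: real^'a^'a)" by (simp add: form_positive_def)
  from matrix_inv_mult(1)[OF cayley_denominator_invertible[OF this assms]]
  show ?thesis by (simp add: cayley_path_def scaleR_add_left[symmetric])
qed

text \<open>For symplectic \<open>M\<close>, the form pulled back by a M + b is symmetric in a and
  b. Numerator and denominator of the path arise from each other by exchanging 1 + t and 1 - t, so
  they pull \<Omega> back to the same form and their quotient preserves \<Omega>.\<close>

lemma cayley_path_Sp:
  assumes M: "M \<in> carrier Sp" "form_positive M" and t: "t \<in> {0..1}"
  shows "cayley_path M t \<in> carrier Sp"
proof -
  define F where "F = (\<lambda>a b :: real. a *\<^sub>R M + b *\<^sub>R mat 1)"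
  have F: "transpose (F a b) ** \<Omega> ** F a b =
      (a * a + b * b) *\<^sub>R \<Omega> + (a * b) *\<^sub>R (transpose M ** \<Omega> + \<Omega> ** M)" for a b
    using M(1) unfolding F_def carrier_Sp
    by (simp add: transpose_mat matrix_mult_add_distrib scalar_matrix_assoc[symmetric] matrix_scalar_ac
        algebra_simps)
  let ?D = "F (1 - t) (1 + t)"
  have inv: "?D ** matrix_inv ?D = mat 1"
    using matrix_inv_mult(1)[OF cayley_denominator_invertible[OF M(2) t]] by (simp add: F_def)
  have "transpose (cayley_path M t) ** \<Omega> ** cayley_path M t =
     transpose (matrix_inv ?D) ** (transpose (F (1 + t) (1 - t)) ** \<Omega> ** F (1 + t) (1 - t)) ** matrix_inv ?D"
    by (simp add: cayley_path_def F_def matrix_transpose_mul matrix_mul_assoc)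
  also have "transpose (F (1 + t) (1 - t)) ** \<Omega> ** F (1 + t) (1 - t) = transpose ?D ** \<Omega> ** ?D"
    unfolding F by (simp add: mult.commute add.commute)
  also have "transpose (matrix_inv ?D) ** (transpose ?D ** \<Omega> ** ?D) ** matrix_inv ?D =
      transpose (?D ** matrix_inv ?D) ** \<Omega> ** (?D ** matrix_inv ?D)"
    by (simp add: matrix_transpose_mul matrix_mul_assoc)
  also have "\<dots> = \<Omega>" by (simp add: inv transpose_mat)
  finally show ?thesis by (simp add: carrier_Sp)
qed

lemma continuous_on_cayley_path:
  fixes f :: "'a::topological_space \<Rightarrow> real^'n^'n"
  assumes f: "continuous_on S f" "\<And>x. x \<in> S \<Longrightarrow> form_positive (f x)"
    and g: "continuous_on S g" "\<And>x. x \<in> S \<Longrightarrow> g x \<in> {0..1}"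
  shows "continuous_on S (\<lambda>x. cayley_path (f x) (g x))"
  unfolding cayley_path_def
  by (intro continuous_on_matrix_mult continuous_on_matrix_inv cayley_denominator_invertible
      continuous_intros f g)

subsection \<open>Polar decomposition\<close>

text \<open>The factor P in the polar decomposition M = P u with u orthogonal on the right.\<close>

definition positive_part :: "real^'n^'n \<Rightarrow> real^'n^'n" where
  "positive_part M = matrix_sqrt (M ** transpose M)"

lemma pos_def_mult_transpose:
  fixes M :: "real^'n^'n"
  assumes "invertible M"
  shows "pos_def (M ** transpose M)"
  unfolding pos_def_def
proof (intro conjI allI impI)
  fix x :: "real^'n" assume "x \<noteq> 0"
  have "inj ((*v) (transpose M))" using assms by (intro inj_matrix_vector_mult) (simp add: invertible_transpose)
  then have "transpose M *v x \<noteq> 0" using \<open>x \<noteq> 0\<close> by (metis injD matrix_vector_mult_0_right)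
  moreover have "x \<bullet> ((M ** transpose M) *v x) = (transpose M *v x) \<bullet> (transpose M *v x)"
    by (simp only: inner_matrix_vector matrix_vector_mul_assoc transpose_transpose)
  ultimately show "0 < x \<bullet> ((M ** transpose M) *v x)" by simp
qed (simp add: matrix_transpose_mul)

text \<open>Let P be the root of S = M M^T. The matrix R = - \<Omega> P^(-1) \<Omega> is again
  positive definite, and its square is - \<Omega> S^(-1) \<Omega>, which equals S because S is
  symmetric and symplectic. Uniqueness of the root gives R = P, and this equation says that P is
  symplectic.\<close>

lemma positive_part_Sp:
  assumes M: "M \<in> carrier Sp"
  shows "pos_def (positive_part M)" "positive_part M \<in> carrier Sp"
    "positive_part M ** positive_part M = M ** transpose M"
proof -
  let ?S = "M ** transpose M" and ?Q = "positive_part M"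
  have pd: "pos_def ?S" by (intro pos_def_mult_transpose invertible_Sp M)
  show Q: "pos_def ?Q" "?Q ** ?Q = ?S" unfolding positive_part_def by (rule matrix_sqrt[OF pd])+
  have S: "?S \<in> carrier Sp" by (intro Sp_mult Sp_transpose M)
  have form: "form_positive ?Q" using Q(1) by (simp add: pos_def_def form_positive_def)
  define I where "I = matrix_inv ?Q"
  note I = matrix_inv_mult[OF form_positive_invertible[OF form], folded I_def]
  have I_sym: "transpose I = I"
  proof -
    have "transpose I ** ?Q = mat 1"
      using arg_cong[OF I(1), of transpose] Q(1) by (simp add: matrix_transpose_mul transpose_mat pos_def_def)
    then show ?thesis by (metis I(1) matrix_mul_assoc matrix_mul_lid matrix_mul_rid)
  qed
  define R where "R = - (\<Omega> ** I ** \<Omega>)"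
  have "R ** R = - (\<Omega> ** (I ** I) ** \<Omega>)"
    by (simp add: R_def matrix_mul_assoc)
  also have "I ** I = Sp_inv ?S"
  proof -
    have "I ** I ** ?S = I ** (I ** ?Q) ** ?Q" by (simp only: Q(2)[symmetric] matrix_mul_assoc)
    then have "I ** I ** ?S = mat 1" using I by simp
    then have "I ** I ** (?S ** Sp_inv ?S) = Sp_inv ?S" by (simp only: matrix_mul_assoc matrix_mul_lid)
    then show ?thesis by (simp only: Sp_inv(2)[OF S] matrix_mul_rid)
  qed
  also have "- (\<Omega> ** Sp_inv ?S ** \<Omega>) = ?S"
    by (simp add: Sp_inv_def matrix_mul_assoc matrix_transpose_mul)
  finally have RR: "R ** R = ?S" .
  have "pos_def R"
    unfolding pos_def_def
  proof (intro conjI allI impI)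
    show "transpose R = R" by (simp add: R_def matrix_transpose_mul I_sym matrix_mul_assoc)
    fix x :: "real^('a+'a)" assume x: "x \<noteq> 0"
    define y where "y = I *v (\<Omega> *v x)"
    have y: "?Q *v y = \<Omega> *v x" by (simp add: y_def matrix_vector_mul_assoc matrix_mul_assoc I)
    have "y \<noteq> 0"
    proof
      assume "y = 0"
      then have "\<Omega> *v (\<Omega> *v x) = 0" using y by simp
      then show False using x by (simp add: matrix_vector_mul_assoc)
    qed
    have "x \<bullet> (R *v x) = - (x \<bullet> (\<Omega> *v y))"
      by (simp add: R_def y_def matrix_vector_mul_assoc[symmetric])
    also have "\<dots> = y \<bullet> (?Q *v y)" unfolding y by (simp add: symplectic_form_alternating(1)[of x y])
    finally show "0 < x \<bullet> (R *v x)" using Q(1) \<open>y \<noteq> 0\<close> by (simp add: pos_def_def)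
  qed
  then have "R = ?Q" using pos_def_sqrt_unique[OF _ Q(1)] Q(2) RR by simp
  then have "?Q ** \<Omega> ** ?Q = - (\<Omega> ** I ** \<Omega>) ** \<Omega> ** ?Q" by (simp add: R_def)
  also have "\<dots> = \<Omega> ** (I ** ?Q)" by (simp add: matrix_mul_assoc)
  finally show "?Q \<in> carrier Sp" using I Q(1) by (simp add: carrier_Sp pos_def_def)
qed

lemma polar_orthogonal:
  assumes M: "M \<in> carrier Sp"
  defines "u \<equiv> Sp_inv (positive_part M) ** M"
  shows "transpose u ** u = mat 1"
proof -
  let ?Q = "positive_part M"
  note Q = positive_part_Sp[OF M]
  have I_sym: "transpose (Sp_inv ?Q) = Sp_inv ?Q"
    using Q(1) by (simp add: Sp_inv_def matrix_transpose_mul pos_def_def matrix_mul_assoc)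
  have "u ** transpose u = Sp_inv ?Q ** (M ** transpose M) ** Sp_inv ?Q"
    by (simp add: u_def matrix_transpose_mul I_sym matrix_mul_assoc)
  also have "\<dots> = (Sp_inv ?Q ** ?Q) ** (?Q ** Sp_inv ?Q)"
    by (simp only: Q(3)[symmetric] matrix_mul_assoc)
  also have "\<dots> = mat 1" by (simp add: Sp_inv[OF Q(2)])
  finally show ?thesis by (simp add: matrix_left_right_inverse)
qed

lemma positive_part_orthogonal:
  assumes "M ** transpose M = mat 1"
  shows "positive_part M = mat 1"
proof -
  have "pos_def (mat 1 :: real^'a^'a)" by (simp add: pos_def_def transpose_mat)
  from pos_def_sqrt_unique[OF matrix_sqrt(1)[OF this] this] matrix_sqrt(2)[OF this]
  show ?thesis by (simp add: positive_part_def assms)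
qed

lemma continuous_on_positive_part: "continuous_on (carrier Sp) positive_part"
  unfolding positive_part_def
  by (rule continuous_on_compose2[OF continuous_on_matrix_sqrt])
    (auto intro!: continuous_intros pos_def_mult_transpose invertible_Sp)

subsection \<open>The unitary group and the complex determinant\<close>

lemma realification_mult: "realification (U ** V) = realification U ** realification V"
  unfolding realification_def Let_def block_matrix_mult
  by (simp add: block_matrix_def vec_eq_iff matrix_matrix_mult_def sum.distrib sum_subtractf sum_negf
      split: sum.split)

lemma realification_simps:
  "realification (mat 1) = mat 1" "realification (mat (- \<i>)) = \<Omega>"
  "realification (- U) = - realification U"
  "realification (\<chi> i j. cnj (U $ j $ i)) = transpose (realification U)"
  unfolding realification_def Let_def block_matrix_simps symplectic_form_def
  by (simp_all add: block_matrix_def vec_eq_iff mat_def transpose_def split: sum.split)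

text \<open>The average of \<open>M\<close> and its conjugate by \<Omega>, read as a complex matrix:
  the projection of a real linear map onto the complex linear ones, and a left inverse of
  \<open>realification\<close>.\<close>

definition complex_part :: "('n::finite) real_2n_matrix \<Rightarrow> complex^'n^'n" where
  "complex_part M = (\<chi> i j. Complex ((M $ Inl i $ Inl j + M $ Inr i $ Inr j) / 2)
     ((M $ Inr i $ Inl j - M $ Inl i $ Inr j) / 2))"

lemma complex_part_realification [simp]: "complex_part (realification U) = U"
  by (simp add: complex_part_def realification_def Let_def block_matrix_def vec_eq_iff)

lemma inj_realification: "realification U = realification V \<Longrightarrow> U = V"
  by (metis complex_part_realification)

lemma block_matrix_exhaust:
  fixes M :: "('n::finite) real_2n_matrix"
  obtains A B C D where "M = block_matrix A B C D"
proof
  show "M = block_matrix (\<chi> i j. M $ Inl i $ Inl j) (\<chi> i j. M $ Inl i $ Inr j)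
    (\<chi> i j. M $ Inr i $ Inl j) (\<chi> i j. M $ Inr i $ Inr j)"
    by (simp add: block_matrix_def vec_eq_iff split: sum.split)
qed

lemma realification_complex_part:
  "realification (complex_part M) = (1/2) *\<^sub>R (M - \<Omega> ** M ** \<Omega>)"
proof -
  obtain A B C D where M: "M = block_matrix A B C D" by (rule block_matrix_exhaust)
  have "\<Omega> ** M ** \<Omega> = block_matrix (- D) C B (- A)"
    by (simp add: M symplectic_form_def block_matrix_mult)
  then have *: "M - \<Omega> ** M ** \<Omega> = block_matrix (A + D) (B - C) (C - B) (A + D)"
    by (simp add: M block_matrix_def vec_eq_iff split: sum.split)
  show ?thesis
    unfolding * unfolding M
    by (simp add: realification_def Let_def complex_part_def block_matrix_def vec_eq_iff field_simps
        split: sum.split)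
qed

text \<open>\<Omega> is the realification of the scalar -i, which commutes with every complex
  matrix.\<close>

lemma realification_commute: "\<Omega> ** realification U = realification U ** \<Omega>"
  unfolding realification_simps(2)[symmetric] realification_mult[symmetric]
  by (rule arg_cong[of _ _ realification])
    (simp add: matrix_matrix_mult_def mat_def vec_eq_iff if_distrib if_distribR cong: if_cong)

text \<open>For an orthogonal matrix, preserving \<Omega> is the same as commuting with \<Omega>,
  that is, being complex linear. Hence U(n) is the intersection of \<open>Sp\<close> with the
  orthogonal group.\<close>

lemma mem_U_subgroup: "M \<in> U_subgroup \<longleftrightarrow> M \<in> carrier Sp \<and> transpose M ** M = mat 1"
proof
  assume "M \<in> U_subgroup"
  then obtain U where M: "M = realification U" and "U \<in> unitary_matrices" by (auto simp: U_subgroup_def)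
  then have 1: "transpose M ** M = mat 1"
    by (simp add: unitary_matrices_def realification_simps(1,4)[symmetric] realification_mult[symmetric])
  have "transpose M ** \<Omega> ** M = transpose M ** M ** \<Omega>"
    unfolding M by (metis matrix_mul_assoc realification_commute)
  with 1 show "M \<in> carrier Sp \<and> transpose M ** M = mat 1" by (simp add: carrier_Sp)
next
  assume M: "M \<in> carrier Sp \<and> transpose M ** M = mat 1"
  then have "M ** transpose M = mat 1" by (simp add: matrix_left_right_inverse)
  then have "\<Omega> ** M = M ** \<Omega>" using M unfolding carrier_Sp by (metis matrix_mul_assoc matrix_mul_lid)
  then have MU: "realification (complex_part M) = M"
    by (simp add: realification_complex_part scaleR_2[symmetric])
  have "realification ((\<chi> i j. cnj (complex_part M $ j $ i)) ** complex_part M) = realification (mat 1)"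
    using M by (simp add: realification_mult realification_simps MU)
  then have "complex_part M \<in> unitary_matrices"
    by (simp add: unitary_matrices_def inj_realification)
  then show "M \<in> U_subgroup" using MU by (metis U_subgroup_def image_eqI)
qed

lemma U_subgroup_Sp: "M \<in> U_subgroup \<Longrightarrow> M \<in> carrier Sp"
  by (simp add: mem_U_subgroup)

lemma realification_complex_part_U: "M \<in> U_subgroup \<Longrightarrow> realification (complex_part M) = M"
  by (auto simp: U_subgroup_def)

text \<open>A unitary \<open>u\<close> commutes with \<Omega>, so it passes through the averaging
  that defines the complex part.\<close>

lemma complex_part_mult_U:
  assumes "u \<in> U_subgroup"
  shows "complex_part (M ** u) = complex_part M ** complex_part u"
proof (rule inj_realification)
  have "\<Omega> ** u = u ** \<Omega>" using assms by (auto simp: U_subgroup_def realification_commute)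
  then have "\<Omega> ** (M ** u) ** \<Omega> = \<Omega> ** M ** \<Omega> ** u" by (metis matrix_mul_assoc)
  then show "realification (complex_part (M ** u)) = realification (complex_part M ** complex_part u)"
    by (simp add: realification_mult realification_complex_part_U[OF assms])
      (simp add: realification_complex_part matrix_mult_add_distrib scalar_matrix_assoc[symmetric])
qed

text \<open>A continuous extension of the determinant of U(n) that vanishes nowhere on
  \<open>Sp\<close>. It is not a homomorphism on \<open>Sp\<close>, but it is multiplicative for a
  unitary right factor.\<close>

definition cdet :: "('n::finite) real_2n_matrix \<Rightarrow> complex" where
  "cdet M = det (complex_part M)"

lemma cdet_mult_U: "u \<in> U_subgroup \<Longrightarrow> cdet (M ** u) = cdet M * cdet u"
  by (simp add: cdet_def complex_part_mult_U det_mul)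

lemma continuous_on_cdet: "continuous_on S cdet"
  unfolding cdet_def complex_part_def Complex_eq by (intro continuous_intros) auto

text \<open>The realification of the complex part of \<open>M\<close> is \<open>(M + M\<^sup>-\<^sup>T) / 2 = M\<^sup>-\<^sup>T (M\<^sup>T M + 1) / 2\<close>.\<close>

lemma cdet_nonzero:
  fixes M :: "('n::finite) real_2n_matrix"
  assumes M: "M \<in> carrier Sp"
  shows "cdet M \<noteq> 0"
proof -
  let ?A = "realification (complex_part M)"
  have Mt: "transpose M ** - (\<Omega> ** M ** \<Omega>) = mat 1"
    using M by (simp add: carrier_Sp matrix_mul_assoc)
  have "2 *\<^sub>R (transpose M ** ?A) = transpose M ** (2 *\<^sub>R ?A)"
    by (simp only: matrix_scalar_ac scalar_matrix_assoc)
  also have "\<dots> = transpose M ** M + transpose M ** - (\<Omega> ** M ** \<Omega>)"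
    by (simp add: realification_complex_part matrix_mult_add_distrib)
  finally have *: "2 *\<^sub>R (transpose M ** ?A) = transpose M ** M + mat 1" unfolding Mt .
  have "x = 0" if "complex_part M *v x = 0" for x
  proof (rule ccontr)
    assume "x \<noteq> 0"
    \<comment> \<open>All columns of \<open>X\<close> equal the kernel vector \<open>x\<close>, so
      that multiplicativity of the realification of square matrices applies to it.\<close>
    define X where "X = ((\<chi> i j. x $ i) :: complex^'n^'n)"
    have "complex_part M ** X = 0"
      using that by (simp add: X_def matrix_matrix_mult_def matrix_vector_mult_def vec_eq_iff)
    then have "?A ** realification X = 0"
      unfolding realification_mult[symmetric]
      by (simp add: realification_def Let_def block_matrix_def vec_eq_iff split: sum.split)
    then have 0: "(transpose M ** M + mat 1) ** realification X = 0"
      unfolding *[symmetric] by (simp add: scalar_matrix_assoc[symmetric] matrix_mul_assoc[symmetric])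
    \<comment> \<open>M^T M + 1 is positive definite: pairing its value at z with z gives |M z|^2 +
      |z|^2.\<close>
    have "realification X *v y = 0" for y
    proof -
      let ?z = "realification X *v y"
      have "(transpose M *v (M *v ?z)) + ?z = 0"
        using arg_cong[OF 0, of "\<lambda>A. A *v y"]
        by (simp only: matrix_vector_mul_assoc matrix_vector_mult_add_rdistrib matrix_mult_add_distrib
            matrix_mul_lid matrix_vector_mult_0 matrix_mul_assoc)
      then have "?z \<bullet> (transpose M *v (M *v ?z)) + ?z \<bullet> ?z = 0"
        by (metis inner_add_right inner_zero_right)
      moreover have "?z \<bullet> (transpose M *v (M *v ?z)) = (M *v ?z) \<bullet> (M *v ?z)"
        by (simp only: inner_matrix_vector)
      ultimately show ?thesis by (metis add_nonneg_eq_0_iff inner_eq_zero_iff inner_ge_zero)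
    qed
    then have "realification X = 0" by (simp add: matrix_eq)
    then have "complex_part (realification X) = 0" by (simp add: complex_part_def vec_eq_iff zero_complex.ctr)
    then show False using \<open>x \<noteq> 0\<close> by (simp add: X_def vec_eq_iff)
  qed
  then show ?thesis
    unfolding cdet_def invertible_det_nz[symmetric] invertible_left_inverse matrix_left_invertible_ker
    by blast
qed

lemma det_cnj_transpose: "det (\<chi> i j. cnj (U $ j $ i)) = cnj (det U)"
proof -
  have "det (\<chi> i j. cnj (U $ j $ i)) = det (transpose (\<chi> i j. cnj (U $ i $ j)))"
    by (rule arg_cong[of _ _ det]) (simp add: transpose_def vec_eq_iff)
  also have "\<dots> = det (\<chi> i j. cnj (U $ i $ j))" by (rule det_transpose)
  also have "\<dots> = cnj (det U)"
    by (simp add: det_def sign_def cnj_sum cnj_prod)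
  finally show ?thesis .
qed

lemma norm_cdet_U: 
  assumes "u \<in> U_subgroup"
  shows "norm (cdet u) = 1"
proof -
  obtain U where u: "u = realification U" "(\<chi> i j. cnj (U $ j $ i)) ** U = mat 1"
    using assms by (auto simp: U_subgroup_def unitary_matrices_def)
  then have "cnj (det U) * det U = 1" by (metis det_I det_cnj_transpose det_mul)
  then have "(norm (det U))\<^sup>2 = 1"
    by (metis complex_norm_square mult.commute of_real_eq_1_iff of_real_power)
  then show ?thesis by (simp add: u(1) cdet_def power2_eq_1_iff) (smt (verit) norm_ge_zero)
qed

lemma SU_subgroup_eq: "SU_subgroup = {u \<in> U_subgroup. cdet u = 1}"
  by (auto simp: SU_subgroup_def U_subgroup_def cdet_def)

lemma mat_mult_mat: "mat a ** mat b = (mat (a * b) :: ('a::semiring_1)^'n^'n)"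
proof -
  have "(\<Sum>k\<in>UNIV. (if i = k then a else 0) * (if k = j then b else 0)) = (if i = j then a * b else 0)"
    for i j :: 'n
    by (subst sum.remove[of _ i]) (auto intro!: sum.neutral)
  then show ?thesis by (simp add: vec_eq_iff matrix_matrix_mult_def mat_def)
qed

definition scalar_rotation :: "real \<Rightarrow> ('n::finite) real_2n_matrix" where
  "scalar_rotation a = realification (mat (cis a))"

lemma scalar_rotation_mem:
  "scalar_rotation a \<in> (scalar_U_subgroup :: ('n::finite) real_2n_matrix set)"
  "scalar_rotation a \<in> (U_subgroup :: 'n real_2n_matrix set)"
proof -
  show "scalar_rotation a \<in> (scalar_U_subgroup :: 'n real_2n_matrix set)" by (auto simp: scalar_rotation_def scalar_U_subgroup_def)
  have "(\<chi> i j. cnj (mat (cis a) $ j $ i)) ** mat (cis a) = (mat 1 :: complex^'n^'n)"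
  proof -
    have "(\<chi> i j. cnj (mat (cis a) $ j $ i)) = (mat (cis (- a)) :: complex^'n^'n)"
      by (auto simp: vec_eq_iff mat_def cis_cnj)
    then show ?thesis by (simp add: mat_mult_mat cis_mult)
  qed
  then show "scalar_rotation a \<in> (U_subgroup :: 'n real_2n_matrix set)"
    by (auto simp: scalar_rotation_def U_subgroup_def unitary_matrices_def)
qed

lemma scalar_U_subgroup_subset: "scalar_U_subgroup \<subseteq> U_subgroup"
  using scalar_rotation_mem(2) by (auto simp: scalar_U_subgroup_def scalar_rotation_def)

lemma cdet_scalar_rotation: "cdet (scalar_rotation a :: ('n::finite) real_2n_matrix) = cis (real CARD('n) * a)"
proof -
  have "det (mat (cis a) :: complex^'n^'n) = (\<Prod>i\<in>UNIV. (mat (cis a) :: complex^'n^'n) $ i $ i)"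
    by (rule det_diagonal) (simp add: mat_def)
  also have "\<dots> = cis a ^ CARD('n)" by (simp add: mat_def)
  finally show ?thesis
    by (simp only: cdet_def scalar_rotation_def complex_part_realification Complex.DeMoivre)
qed

lemma scalar_rotation_values:
  "scalar_rotation 0 = (mat 1 :: ('n::finite) real_2n_matrix)"
  "scalar_rotation pi = (- mat 1 :: 'n real_2n_matrix)"
  "scalar_rotation (2 * pi) = (mat 1 :: 'n real_2n_matrix)"
proof -
  have "mat (- 1) = (- mat 1 :: complex^'n^'n)" by (simp add: mat_def vec_eq_iff)
  then show "scalar_rotation pi = (- mat 1 :: 'n real_2n_matrix)"
    by (simp add: scalar_rotation_def realification_simps)
qed (simp_all add: scalar_rotation_def realification_simps)

lemma scalar_rotation_eq: "scalar_rotation a = cos a *\<^sub>R mat 1 - sin a *\<^sub>R \<Omega>"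
  unfolding scalar_rotation_def realification_def Let_def symplectic_form_def block_matrix_simps(3)
  by (simp add: block_matrix_def vec_eq_iff mat_def split: sum.split)

lemma continuous_on_scalar_rotation [continuous_intros]:
  "continuous_on S f \<Longrightarrow> continuous_on S (\<lambda>x. scalar_rotation (f x))"
  unfolding scalar_rotation_eq
  by (intro continuous_intros continuous_on_compose2[of UNIV cos S f]
      continuous_on_compose2[of UNIV sin S f]) auto

section \<open>Logarithms on simply connected spaces\<close>

text \<open>Simple connectedness makes any two loops freely homotopic. For two constant loops, the
  track of the base point during the homotopy is a path between the points.\<close>

lemma simply_connected_path_between:
  fixes S :: "'a::topological_space set"
  assumes S: "simply_connected S" and ab: "a \<in> S" "b \<in> S"
  obtains p where "path p" "path_image p \<subseteq> S" "pathstart p = a" "pathfinish p = b"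
proof -
  have "homotopic_loops S (\<lambda>_. a) (\<lambda>_. b)"
    using ab by (intro S[unfolded simply_connected_def, rule_format])
      (auto simp: path_def path_image_def pathstart_def pathfinish_def)
  then obtain h where h: "continuous_on ({0..1::real} \<times> {0..1::real}) h"
      "h ` ({0..1} \<times> {0..1}) \<subseteq> S" "\<forall>x\<in>{0..1}. h (0, x) = a" "\<forall>x\<in>{0..1}. h (1, x) = b"
    unfolding homotopic_loops by (auto simp: image_subset_iff_funcset)
  have "path (\<lambda>t. h (t, 0))"
    unfolding path_def by (rule continuous_on_compose2[OF h(1)]) (auto intro!: continuous_intros)
  then show ?thesis
    using h(2-4) by (intro that[of "\<lambda>t. h (t, 0)"]) (auto simp: path_image_def pathstart_def pathfinish_def)
qed

lemma simply_connected_connected: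
  fixes S :: "'a::topological_space set"
  assumes "simply_connected S"
  shows "connected S"
  by (rule path_connected_imp_connected)
    (use simply_connected_path_between[OF assms] in \<open>unfold path_connected_def; metis\<close>)

text \<open>The difference \<open>F - H\<close> takes values in the multiples of 2 pi i. Where it
  varies by less than 1, far below the gap 2 pi, it is constant, and connectedness does the
  rest.\<close>

lemma exp_eq_imp_diff_constant:
  fixes F H :: "'a::topological_space \<Rightarrow> complex"
  assumes S: "connected S" and F: "continuous_on S F" and H: "continuous_on S H"
    and eq: "\<And>x. x \<in> S \<Longrightarrow> exp (F x) = exp (H x)" and xy: "x \<in> S" "y \<in> S"
  shows "F x - H x = F y - H y"
proof -
  have "(\<lambda>x. F x - H x) constant_on S"
  proof (rule locally_constant_imp_constant[OF S])
    fix a assume a: "a \<in> S"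
    let ?T = "S \<inter> (\<lambda>x. F x - H x) -` ball (F a - H a) 1"
    have "openin (top_of_set S) ?T"
      by (intro continuous_openin_preimage_gen continuous_intros F H) simp
    moreover have "F x - H x = F a - H a" if "x \<in> ?T" for x
    proof (rule exp_complex_eqI)
      show "exp (F x - H x) = exp (F a - H a)" using that a eq by (simp add: exp_diff)
      have "\<bar>Im (F x - H x) - Im (F a - H a)\<bar> \<le> norm ((F x - H x) - (F a - H a))"
        using abs_Im_le_cmod[of "(F x - H x) - (F a - H a)"] by simp
      also have "\<dots> < 1" using that by (simp add: dist_norm norm_minus_commute)
      finally show "\<bar>Im (F x - H x) - Im (F a - H a)\<bar> < 2 * pi" using pi_gt3 by linarith
    qed
    moreover have "a \<in> ?T" using a by simp
    ultimately show "\<exists>T. openin (top_of_set S) T \<and> a \<in> T \<and> (\<forall>x\<in>T. F x - H x = F a - H a)"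
      by blast
  qed
  then show ?thesis using xy unfolding constant_on_def by metis
qed

text \<open>The change of a continuous logarithm along \<open>p\<close>: the integral of dp / p, in
  a form that makes sense for merely continuous nonvanishing paths.\<close>

definition log_increment :: "(real \<Rightarrow> complex) \<Rightarrow> complex \<Rightarrow> bool" where
  "log_increment p d \<longleftrightarrow> (\<exists>\<theta>. continuous_on {0..1} \<theta> \<and> (\<forall>t\<in>{0..1}. p t = exp (\<theta> t)) \<and> d = \<theta> 1 - \<theta> 0)"

lemma log_increment_exists:
  assumes "continuous_on {0..1} p" "\<And>t. t \<in> {0..1} \<Longrightarrow> p t \<noteq> 0"
  obtains d where "log_increment p d"
proof -
  obtain \<theta> where "continuous_on {0..1} \<theta>" "\<And>t. t \<in> {0..1} \<Longrightarrow> p t = exp (\<theta> t)"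
    using continuous_logarithm_on_contractible[OF assms(1) convex_imp_contractible assms(2)]
    by (metis convex_real_interval(5))
  then show ?thesis using that unfolding log_increment_def by blast
qed

lemma log_increment_unique:
  assumes "log_increment p d" "log_increment p e"
  shows "d = e"
proof -
  obtain \<theta> \<theta>' where *: "continuous_on {0..1} \<theta>" "\<forall>t\<in>{0..1}. p t = exp (\<theta> t)" "d = \<theta> 1 - \<theta> 0"
     "continuous_on {0..1} \<theta>'" "\<forall>t\<in>{0..1}. p t = exp (\<theta>' t)" "e = \<theta>' 1 - \<theta>' 0"
    using assms unfolding log_increment_def by blast
  have "\<theta> 1 - \<theta>' 1 = \<theta> 0 - \<theta>' 0"
    by (rule exp_eq_imp_diff_constant[of "{0..1::real}"]) (use * in auto)
  then have "\<theta> 1 - \<theta> 0 = \<theta>' 1 - \<theta>' 0" by algebra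
  then show ?thesis using * by simp
qed

lemma log_increment_exp:
  assumes "log_increment p d"
  shows "p 1 = p 0 * exp d"
  using assms unfolding log_increment_def by (auto simp: exp_diff)

lemma log_increment_reversepath:
  assumes "log_increment p d"
  shows "log_increment (reversepath p) (- d)"
proof -
  obtain \<theta> where *: "continuous_on {0..1} \<theta>" "\<forall>t\<in>{0..1}. p t = exp (\<theta> t)" "d = \<theta> 1 - \<theta> 0"
    using assms unfolding log_increment_def by blast
  then show ?thesis
    unfolding log_increment_def reversepath_def
    by (intro exI[of _ "\<lambda>t. \<theta> (1 - t)"])
      (auto intro!: continuous_intros continuous_on_compose2[OF *(1)])
qed

lemma log_increment_joinpaths:
  assumes pq: "log_increment (p +++ q) d" and p: "log_increment p d1" and q: "log_increment q d2"
    and j: "pathfinish p = pathstart q"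
  shows "d = d1 + d2"
proof -
  obtain \<theta> where *: "continuous_on {0..1} \<theta>" "\<forall>t\<in>{0..1}. (p +++ q) t = exp (\<theta> t)" "d = \<theta> 1 - \<theta> 0"
    using pq unfolding log_increment_def by blast
  have 1: "log_increment p (\<theta> (1 / 2) - \<theta> 0)"
    unfolding log_increment_def
  proof (intro exI[of _ "\<lambda>t. \<theta> (t / 2)"] conjI ballI)
    fix t :: real assume "t \<in> {0..1}"
    then show "p t = exp (\<theta> (t / 2))" using *(2)[rule_format, of "t / 2"] by (simp add: joinpaths_def)
  qed (auto intro!: continuous_intros continuous_on_compose2[OF *(1)])
  have 2: "log_increment q (\<theta> 1 - \<theta> (1 / 2))"
    unfolding log_increment_def
  proof (intro exI[of _ "\<lambda>t. \<theta> ((t + 1) / 2)"] conjI ballI)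
    fix t :: real assume t: "t \<in> {0..1}"
    show "q t = exp (\<theta> ((t + 1) / 2))"
    proof (cases "t = 0")
      case True
      then show ?thesis
        using *(2)[rule_format, of "1 / 2"] j by (simp add: joinpaths_def pathfinish_def pathstart_def)
    next
      case False
      then show ?thesis using t *(2)[rule_format, of "(t + 1) / 2"]
        by (simp add: joinpaths_def add_divide_distrib)
    qed
  qed (auto intro!: continuous_intros continuous_on_compose2[OF *(1)])
  show ?thesis using log_increment_unique[OF 1 p] log_increment_unique[OF 2 q] *(3) by auto
qed

text \<open>Take a logarithm of \<open>f\<close> on the whole square of the homotopy. On the two
  edges t = 0 and t = 1 the homotopy agrees, so the difference of the logarithms there does not
  depend on the stage; at the last stage the loop is constant and the difference is 0.\<close>

lemma log_increment_null_loop: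
  assumes h: "homotopic_loops S p (\<lambda>_. a)" and f: "continuous_on S f" "\<And>x. x \<in> S \<Longrightarrow> f x \<noteq> 0"
  shows "log_increment (f \<circ> p) 0"
proof -
  obtain h where h: "continuous_on ({0..1::real} \<times> {0..1::real}) h" "h ` ({0..1} \<times> {0..1}) \<subseteq> S"
      "\<And>x. x \<in> {0..1} \<Longrightarrow> h (0, x) = p x" "\<And>x. x \<in> {0..1} \<Longrightarrow> h (1, x) = a"
      "\<And>t. t \<in> {0..1} \<Longrightarrow> h (t, 1) = h (t, 0)"
    using h unfolding homotopic_loops by (auto simp: image_subset_iff_funcset pathfinish_def pathstart_def)
  have fh: "continuous_on ({0..1} \<times> {0..1}) (\<lambda>z. f (h z))"
    by (rule continuous_on_compose2[OF f(1) h(1,2)])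
  have "convex ({0..1::real} \<times> {0..1::real})" by (intro convex_Times) auto
  then obtain \<theta> where \<theta>: "continuous_on ({0..1} \<times> {0..1}) \<theta>"
      "\<And>z. z \<in> {0..1} \<times> {0..1} \<Longrightarrow> f (h z) = exp (\<theta> z)"
    using continuous_logarithm_on_contractible[OF fh convex_imp_contractible] f(2) h(2)
    by (metis (no_types, lifting) image_subset_iff)
  have "\<theta> (0, 1) - \<theta> (0, 0) = \<theta> (1, 1) - \<theta> (1, 0)"
    by (rule exp_eq_imp_diff_constant[of "{0..1::real}" "\<lambda>s. \<theta> (s, 1)" "\<lambda>s. \<theta> (s, 0)"])
      (auto intro!: continuous_intros continuous_on_compose2[OF \<theta>(1)] simp: \<theta>(2)[symmetric] h(5))
  moreover have 1: "log_increment (\<lambda>t. f (h (1, t))) (\<theta> (1, 1) - \<theta> (1, 0))"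
    unfolding log_increment_def
    by (intro exI[of _ "\<lambda>t. \<theta> (1, t)"])
      (auto intro!: continuous_intros continuous_on_compose2[OF \<theta>(1)] simp: \<theta>(2)[symmetric])
  moreover have 2: "log_increment (\<lambda>t. f (h (1, t))) 0"
    unfolding log_increment_def
    by (intro exI[of _ "\<lambda>t. \<theta> (1, 0)"]) (auto simp: \<theta>(2)[symmetric] h(4))
  ultimately have "\<theta> (0, 1) - \<theta> (0, 0) = 0" using log_increment_unique[OF 1 2] by simp
  then show ?thesis
    unfolding log_increment_def
    by (intro exI[of _ "\<lambda>t. \<theta> (0, t)"])
      (auto intro!: continuous_intros continuous_on_compose2[OF \<theta>(1)] simp: \<theta>(2)[symmetric] h(3))
qed

text \<open>Monodromy argument: the value at \<open>x\<close> is the principal logarithm at a base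
  point plus the increment along any path to \<open>x\<close>. Two such paths differ by a
  null-homotopic loop, so the value is well defined. The local hypothesis gives continuity, because
  nearby points are reached by paths on which \<open>f\<close> changes little.\<close>

proposition simply_connected_continuous_log:
  fixes S :: "'a::topological_space set" and f :: "'a \<Rightarrow> complex"
  assumes S: "simply_connected S"
    and local: "\<And>U x. openin (top_of_set S) U \<Longrightarrow> x \<in> U \<Longrightarrow>
      \<exists>V. openin (top_of_set S) V \<and> x \<in> V \<and>
        (\<forall>y\<in>V. \<exists>p. path p \<and> path_image p \<subseteq> U \<and> pathstart p = x \<and> pathfinish p = y)"
    and f: "continuous_on S f" "\<And>x. x \<in> S \<Longrightarrow> f x \<noteq> 0"
  obtains g where "continuous_on S g" "\<And>x. x \<in> S \<Longrightarrow> f x = exp (g x)"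
proof (cases "S = {}")
  case True
  then show ?thesis using that[of "\<lambda>_. 0"] by simp
next
  case False
  then obtain a where a: "a \<in> S" by blast
  define joins where "joins = (\<lambda>p x y. path p \<and> path_image p \<subseteq> S \<and> pathstart p = x \<and> pathfinish p = y)"
  have inc_ex: "\<exists>d. log_increment (f \<circ> p) d" if "joins p x y" for p x y
  proof -
    have "continuous_on {0..1} (f \<circ> p)"
      using that by (intro continuous_on_compose continuous_on_subset[OF f(1)])
        (auto simp: joins_def path_def path_image_def)
    then show ?thesis
      using log_increment_exists[of "f \<circ> p"] that f(2) unfolding joins_def path_image_def
      by (metis comp_apply image_subset_iff)
  qed
  have join: "joins (p +++ q) x z" if "joins p x y" "joins q y z" for p q x y z
    using that by (auto simp: joins_def intro: subset_path_image_join[THEN subsetD])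
  have rev: "joins (reversepath p) y x" if "joins p x y" for p x y
    using that by (auto simp: joins_def)
  have loop: "log_increment (f \<circ> p) 0" if "joins p x x" for p x
  proof -
    have "x \<in> S" using that by (auto simp: joins_def pathstart_def path_image_def)
    then have "homotopic_loops S p (\<lambda>_. x)"
      using that by (intro S[unfolded simply_connected_def, rule_format])
        (auto simp: joins_def path_def path_image_def pathstart_def pathfinish_def)
    then show ?thesis by (rule log_increment_null_loop[OF _ f])
  qed
  have add: "d = d1 + d2"
    if "joins p x y" "joins q y z" "log_increment (f \<circ> (p +++ q)) d" "log_increment (f \<circ> p) d1"
      "log_increment (f \<circ> q) d2" for p q x y z d d1 d2
    using that log_increment_joinpaths[of "f \<circ> p" "f \<circ> q"]
    by (auto simp: joins_def path_compose_join pathfinish_compose pathstart_compose)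
  have unique: "d = e" if "joins p a x" "joins q a x" "log_increment (f \<circ> p) d" "log_increment (f \<circ> q) e"
    for p q x d e
  proof -
    have "log_increment (f \<circ> reversepath q) (- e)"
      using log_increment_reversepath[OF that(4)] by (simp add: path_compose_reversepath)
    then have "0 = d + - e"
      by (rule add[OF that(1) rev[OF that(2)] loop[OF join[OF that(1) rev[OF that(2)]]] that(3)])
    then show ?thesis by simp
  qed
  define g where "g = (\<lambda>x. Ln (f a) + (THE d. \<exists>p. joins p a x \<and> log_increment (f \<circ> p) d))"
  have g: "g x = Ln (f a) + d" if "joins p a x" "log_increment (f \<circ> p) d" for p x d
    unfolding g_def by (rule arg_cong[of _ _ "\<lambda>z. Ln (f a) + z"], rule the_equality) (use that unique in blast)+
  have path_ex: "\<exists>p d. joins p a x \<and> log_increment (f \<circ> p) d" if "x \<in> S" for x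
    using simply_connected_path_between[OF S a that] inc_ex unfolding joins_def by metis
  have "f x = exp (g x)" if x: "x \<in> S" for x
  proof -
    obtain p d where p: "joins p a x" "log_increment (f \<circ> p) d" using path_ex[OF x] by blast
    then have "f x = f a * exp d"
      using log_increment_exp[OF p(2)] by (auto simp: joins_def pathstart_def pathfinish_def)
    then show ?thesis using f(2)[OF a] by (simp add: g[OF p] exp_add)
  qed
  moreover have "continuous_on S g"
    unfolding continuous_on_def
  proof
    fix x assume x: "x \<in> S"
    \<comment> \<open>On \<open>U\<close> the quotient \<open>f y / f x\<close> stays in the right
      half-plane, where the principal logarithm is continuous; a path inside \<open>U\<close>
      therefore has increment \<open>Ln (f y / f x)\<close>, whatever its shape.\<close>
    define U where "U = S \<inter> (\<lambda>y. f y / f x) -` {z. 0 < Re z}"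
    have "openin (top_of_set S) U"
      unfolding U_def using f x by (intro continuous_openin_preimage_gen continuous_intros) (auto simp: open_halfspace_Re_gt)
    moreover have "x \<in> U" using x f(2)[OF x] by (simp add: U_def)
    ultimately obtain V where V: "openin (top_of_set S) V" "x \<in> V"
        "\<And>y. y \<in> V \<Longrightarrow> \<exists>p. path p \<and> path_image p \<subseteq> U \<and> pathstart p = x \<and> pathfinish p = y"
      using local by meson
    have Ln_cont: "continuous_on U (\<lambda>y. Ln (f y / f x))"
      using f x by (intro continuous_intros continuous_on_subset[OF f(1)])
        (auto simp: U_def complex_nonpos_Reals_iff)
    have VU: "V \<subseteq> U"
      using V(3) by (metis pathfinish_in_path_image subsetD subsetI)
    have eq: "g y = g x + Ln (f y / f x)" if y: "y \<in> V" for y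
    proof -
      obtain q where q: "path q" "path_image q \<subseteq> U" "pathstart q = x" "pathfinish q = y"
        using V(3)[OF y] by blast
      have jq: "joins q x y" using q by (auto simp: joins_def U_def)
      have "log_increment (f \<circ> q) (Ln (f y / f x))"
        unfolding log_increment_def
      proof (intro exI[of _ "\<lambda>t. Ln (f x) + Ln (f (q t) / f x)"] conjI ballI)
        show "continuous_on {0..1} (\<lambda>t. Ln (f x) + Ln (f (q t) / f x))"
          using q(1,2) by (intro continuous_intros continuous_on_compose2[OF Ln_cont])
            (auto simp: path_def path_image_def)
        fix t :: real assume "t \<in> {0..1}"
        then have "q t \<in> U" using q(2) by (auto simp: path_image_def)
        then have "f (q t) \<noteq> 0" using f(2) by (simp add: U_def)
        then show "(f \<circ> q) t = exp (Ln (f x) + Ln (f (q t) / f x))"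
          using f(2)[OF x] by (simp add: exp_add)
      next
        show "Ln (f y / f x) = Ln (f x) + Ln (f (q 1) / f x) - (Ln (f x) + Ln (f (q 0) / f x))"
          using q(3,4) f(2)[OF x] by (simp add: pathstart_def pathfinish_def)
      qed
      moreover obtain p d where p: "joins p a x" "log_increment (f \<circ> p) d" using path_ex[OF x] by blast
      moreover obtain e where e: "log_increment (f \<circ> (p +++ q)) e" using inc_ex join p(1) jq by blast
      ultimately have "e = d + Ln (f y / f x)" using add[OF p(1) jq] by blast
      then show ?thesis using g[OF p] g[OF join[OF p(1) jq] e] by simp
    qed
    have "continuous_on V g"
      using continuous_on_subset[OF Ln_cont VU] eq
      by (subst continuous_on_cong[OF refl eq]) (auto intro!: continuous_intros)
    moreover obtain W where "open W" "V = S \<inter> W" using V(1) by (auto simp: openin_open)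
    ultimately show "(g \<longlongrightarrow> g x) (at x within S)"
      using V(2) at_within_nhd[of x W "S \<inter> W" S] unfolding continuous_on_def by force
  qed
  ultimately show ?thesis using that by blast
qed

section \<open>Covering groups of the symplectic group\<close>

locale symplectic_cover =
  fixes G :: "'g::topological_space monoid" (structure) and \<pi> :: "'g \<Rightarrow> ('n::finite) real_2n_matrix"
  assumes universal: "universal_covering_group G Sp \<pi>"
begin

sublocale group G
  using universal by (simp add: universal_covering_group_def topological_group_def)

lemma cover_hom: "\<pi> \<in> hom G Sp" and cover: "covering_space (carrier G) \<pi> (carrier Sp)"
  and simply_connected_G: "simply_connected (carrier G)"
  using universal by (auto simp: universal_covering_group_def)

lemma connected_G: "connected (carrier G)"
  by (rule simply_connected_connected[OF simply_connected_G])

lemma cover_mult [simp]: "g \<in> carrier G \<Longrightarrow> h \<in> carrier G \<Longrightarrow> \<pi> (g \<otimes> h) = \<pi> g ** \<pi> h"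
  and cover_in [simp, intro]: "g \<in> carrier G \<Longrightarrow> \<pi> g \<in> carrier Sp"
  using cover_hom by (auto simp: hom_def Pi_iff)

lemma cover_one [simp]: "\<pi> \<one> = mat 1"
  using hom_one[OF cover_hom group_axioms group_Sp] by simp

lemma cover_inv [simp]: "g \<in> carrier G \<Longrightarrow> \<pi> (inv g) = Sp_inv (\<pi> g)"
  using group_hom.hom_inv[of G Sp \<pi>] group_axioms group_Sp cover_hom inv_Sp cover_in
  by (metis group_hom.intro group_hom_axioms.intro)

lemma cover_surj: "\<pi> ` carrier G = carrier Sp"
  using cover by (rule covering_space_imp_surjective)

lemma continuous_on_cover: "continuous_on (carrier G) \<pi>"
  using cover by (rule covering_space_imp_continuous)

lemma continuous_on_G_mult:
  fixes f h :: "'c::topological_space \<Rightarrow> 'g"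
  assumes "continuous_on X f" "continuous_on X h" "f ` X \<subseteq> carrier G" "h ` X \<subseteq> carrier G"
  shows "continuous_on X (\<lambda>x. f x \<otimes> h x)"
proof -
  let ?T = "top_of_set (carrier G)"
  have "continuous_map (prod_topology ?T ?T) ?T (\<lambda>(x, y). x \<otimes> y)"
    using universal by (simp add: universal_covering_group_def topological_group_def)
  moreover have "continuous_map (top_of_set X) (prod_topology ?T ?T) (\<lambda>x. (f x, h x))"
    using assms by (intro continuous_map_pairedI) (auto simp: continuous_map_in_subtopology)
  ultimately have "continuous_map (top_of_set X) ?T ((\<lambda>(x, y). x \<otimes> y) \<circ> (\<lambda>x. (f x, h x)))"
    by (rule continuous_map_compose[rotated])
  then show ?thesis by (simp add: continuous_map_in_subtopology o_def)
qed

lemma continuous_on_G_inv: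
  fixes f :: "'c::topological_space \<Rightarrow> 'g"
  assumes "continuous_on X f" "f ` X \<subseteq> carrier G"
  shows "continuous_on X (\<lambda>x. inv (f x))"
proof -
  have "continuous_on (carrier G) (\<lambda>x. inv x)"
    using universal by (auto simp: universal_covering_group_def topological_group_def
        continuous_map_in_subtopology)
  then show ?thesis by (rule continuous_on_compose2[OF _ assms])
qed

abbreviation "open_G \<equiv> openin (top_of_set (carrier G))"
abbreviation "open_Sp \<equiv> openin (top_of_set (carrier Sp :: 'n real_2n_matrix set))"

section \<open>Local sections and lifting through the covering\<close>

lemma openin_translate:
  assumes U: "open_G U" and g: "g \<in> carrier G"
  shows "open_G {x \<in> carrier G. g \<otimes> x \<in> U}"
proof -
  have "continuous_on (carrier G) (\<lambda>x. g \<otimes> x)"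
    using g by (intro continuous_on_G_mult) auto
  then have "open_G (carrier G \<inter> (\<lambda>x. g \<otimes> x) -` U)"
    using U g by (intro continuous_openin_preimage[where T = "carrier G"]) auto
  then show ?thesis by (rule back_subst[where P = "openin _"]) auto
qed

lemma eq_of_inv_mult_one:
  assumes "inv a \<otimes> b = \<one>" "a \<in> carrier G" "b \<in> carrier G"
  shows "b = a"
proof -
  have "a \<otimes> (inv a \<otimes> b) = b" using assms(2,3) by (simp add: m_assoc[symmetric])
  then show ?thesis using assms by simp
qed

text \<open>The inverse of the covering on the sheet through the identity. Openness of the sheet in
  \<open>G\<close> is recorded because it isolates the identity within the kernel of
  \<open>\<pi>\<close>.\<close>

lemma local_section:
  obtains T q where "open_Sp T" "mat 1 \<in> T" "continuous_on T q"
    "q ` T \<subseteq> carrier G" "open_G (q ` T)" "q (mat 1) = \<one>"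
    "\<And>M. M \<in> T \<Longrightarrow> \<pi> (q M) = M" "\<And>g. g \<in> q ` T \<Longrightarrow> \<pi> g \<in> T \<and> q (\<pi> g) = g"
proof -
  obtain u T q where *: "\<one> \<in> u" "open_G u" "\<pi> \<one> \<in> T"
      "open_Sp T" "homeomorphism u T \<pi> q"
    using covering_space_local_homeomorphism[OF cover one_closed] by metis
  have u: "q ` T = u" "\<pi> ` u = T" using *(5) by (auto simp: homeomorphism_def)
  show ?thesis
  proof (rule that[of T q])
    show "q ` T \<subseteq> carrier G" using u *(2) openin_imp_subset by blast
    show "q (mat 1) = \<one>" using *(1,5) by (metis cover_one homeomorphism_apply1)
  qed (use * u in \<open>auto simp: homeomorphism_def\<close>)
qed

text \<open>The quotient of two lifts takes values in the kernel of \<open>\<pi>\<close>. Near any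
  of its values, the translated identity sheet contains no other element over the same point, so the
  quotient is locally constant.\<close>

lemma lift_unique:
  fixes f h :: "'c::topological_space \<Rightarrow> 'g"
  assumes S: "connected S" and f: "continuous_on S f" "f ` S \<subseteq> carrier G"
    and h: "continuous_on S h" "h ` S \<subseteq> carrier G"
    and eq: "\<And>x. x \<in> S \<Longrightarrow> \<pi> (f x) = \<pi> (h x)" and x: "x \<in> S" "f x = h x" and y: "y \<in> S"
  shows "f y = h y"
proof -
  obtain T q where T: "q ` T \<subseteq> carrier G" "open_G (q ` T)" "q (mat 1) = \<one>"
    "\<And>g. g \<in> q ` T \<Longrightarrow> \<pi> g \<in> T \<and> q (\<pi> g) = g" "mat 1 \<in> T"
    using local_section by metis
  define k where "k = (\<lambda>x. inv (h x) \<otimes> f x)"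
  have k_in: "k x \<in> carrier G" if "x \<in> S" for x
    using that f(2) h(2) by (simp add: k_def image_subset_iff)
  have k_cont: "continuous_on S k"
    unfolding k_def using f h by (intro continuous_on_G_mult continuous_on_G_inv) auto
  have cover_k: "\<pi> (k x) = mat 1" if "x \<in> S" for x
    using that f(2) h(2) eq[OF that] by (simp add: k_def image_subset_iff Sp_inv)
  have "k constant_on S"
  proof (rule locally_constant_imp_constant[OF S])
    fix a assume a: "a \<in> S"
    let ?U = "{x \<in> carrier G. inv (k a) \<otimes> x \<in> q ` T}"
    have "openin (top_of_set S) (S \<inter> k -` ?U)"
      using k_cont k_in a by (intro continuous_openin_preimage[where T = "carrier G"] openin_translate T) auto
    moreover have "k a \<in> ?U" using a k_in T(3,5) by (auto intro: rev_image_eqI)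
    moreover have "k x = k a" if "x \<in> S" "k x \<in> ?U" for x
    proof -
      have "\<pi> (inv (k a) \<otimes> k x) = mat 1"
        using k_in a that cover_k by (simp add: Sp_inv_def transpose_mat)
      then have "inv (k a) \<otimes> k x = \<one>" using T(3,4) that by fastforce
      then show ?thesis by (rule eq_of_inv_mult_one[OF _ k_in[OF a] k_in[OF that(1)]])
    qed
    ultimately show "\<exists>T. openin (top_of_set S) T \<and> a \<in> T \<and> (\<forall>x\<in>T. k x = k a)"
      using a by (metis (no_types, lifting) IntE IntI vimage_eq)
  qed
  then have "k y = k x" using x y unfolding constant_on_def by metis
  then have "inv (h y) \<otimes> f y = \<one>" using x f(2) h(2) by (simp add: k_def image_subset_iff)
  then show ?thesis by (rule eq_of_inv_mult_one) (use y f(2) h(2) in auto)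
qed

text \<open>Openness of a set downstairs is tested with the local inverses of \<open>\<pi>\<close>.
  Composed with the projection of \<open>Sp\<close> onto \<open>PSp\<close>, this presents
  \<open>PSp\<close> as a topological quotient of \<open>G\<close>.\<close>

lemma quotient_map_cover: "quotient_map (top_of_set (carrier G)) (top_of_set (carrier Sp)) \<pi>"
  unfolding quotient_map_def
proof (intro conjI allI impI)
  show "\<pi> ` topspace (top_of_set (carrier G)) = topspace (top_of_set (carrier Sp))"
    using cover_surj by simp
  fix U :: "'n real_2n_matrix set" assume "U \<subseteq> topspace (top_of_set (carrier Sp))"
  then have U: "U \<subseteq> carrier Sp" by simp
  let ?V = "{x \<in> topspace (top_of_set (carrier G)). \<pi> x \<in> U}"
  have V: "?V = carrier G \<inter> \<pi> -` U" by auto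
  show "open_G ?V = open_Sp U"
  proof
    assume "open_Sp U"
    then show "open_G ?V"
      unfolding V using continuous_on_cover cover_surj
      by (intro continuous_openin_preimage[where T = "carrier Sp"]) auto
  next
    assume openV: "open_G ?V"
    show "open_Sp U"
    proof (subst openin_subopen, intro ballI)
      fix M assume "M \<in> U"
      then have "M \<in> \<pi> ` carrier G" using U by (auto simp: cover_surj)
      then obtain g where g: "g \<in> carrier G" "\<pi> g = M" by auto
      obtain u T q where *: "g \<in> u" "open_G u" "\<pi> g \<in> T"
        "open_Sp T" "homeomorphism u T \<pi> q"
        using covering_space_local_homeomorphism[OF cover g(1)] by metis
      have q: "q ` T = u" "continuous_on T q" "\<And>M. M \<in> T \<Longrightarrow> \<pi> (q M) = M"
        using *(5) by (auto simp: homeomorphism_def)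
      have "openin (top_of_set T) (T \<inter> q -` ?V)"
        using q(1) *(2) openV openin_imp_subset[OF *(2)]
        by (intro continuous_openin_preimage[where T = "carrier G"] q(2)) auto
      moreover have "T \<inter> q -` ?V = T \<inter> U"
        using q openin_imp_subset[OF *(2)] by auto
      ultimately have "open_Sp (T \<inter> U)"
        using openin_trans[OF _ *(4)] by simp
      then show "\<exists>T. open_Sp T \<and> M \<in> T \<and> T \<subseteq> U"
        using \<open>M \<in> U\<close> *(3) g(2) by blast
    qed
  qed
qed

text \<open>Short paths near the identity of \<open>Sp\<close> are lifted by a local section; a long path is cut into
  \<open>m\<close> short pieces, whose lifts are multiplied.\<close>

proposition lift_end:
  fixes h :: "'c::euclidean_space \<Rightarrow> real \<Rightarrow> 'n real_2n_matrix"
  assumes K: "closed K" and h: "continuous_on (K \<times> {0..1}) (\<lambda>(x, t). h x t)"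
    and h_in: "\<And>x t. x \<in> K \<Longrightarrow> t \<in> {0..1} \<Longrightarrow> h x t \<in> carrier Sp"
    and h0: "\<And>x. x \<in> K \<Longrightarrow> h x 0 = mat 1"
  obtains \<sigma> where "continuous_on K \<sigma>" "\<sigma> ` K \<subseteq> carrier G" "\<And>x. x \<in> K \<Longrightarrow> \<pi> (\<sigma> x) = h x 1"
    "\<And>x. x \<in> K \<Longrightarrow> (\<And>t. t \<in> {0..1} \<Longrightarrow> h x t = mat 1) \<Longrightarrow> \<sigma> x = \<one>"
proof -
  obtain T q where T: "open_Sp T" "mat 1 \<in> T" "continuous_on T q"
    "q ` T \<subseteq> carrier G" "q (mat 1) = \<one>" "\<And>M. M \<in> T \<Longrightarrow> \<pi> (q M) = M"
    using local_section by metis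
  have h_comp: "continuous_on X (\<lambda>x. h (a x) (b x))"
    if "continuous_on X a" "continuous_on X b" "\<And>x. x \<in> X \<Longrightarrow> a x \<in> K" "\<And>x. x \<in> X \<Longrightarrow> b x \<in> {0..1}"
    for X and a :: "'d::topological_space \<Rightarrow> 'c" and b
    using continuous_on_compose2[OF h, of X "\<lambda>x. (a x, b x)"] that
    by (force intro: continuous_on_Pair)
  define \<Phi> where "\<Phi> = (\<lambda>x s t. Sp_inv (h x s) ** h x t)"
  \<comment> \<open>A mesh 1 / m is fine enough for \<open>x\<close> if every increment of the path
    over that length lies in the domain of the local section.\<close>
  define good where "good = (\<lambda>m x. m > 0 \<and> (\<forall>s\<in>{0..1}. \<forall>t\<in>{0..1}. \<bar>s - t\<bar> \<le> 1 / real m \<longrightarrow> \<Phi> x s t \<in> T))"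
  \<comment> \<open>Clipping at time \<open>t\<close> makes the product of the first i lifted
    increments a lift of the path at time min t (i / m); for i = m it lies over the point at time
    \<open>t\<close>, continuously in \<open>t\<close>.\<close>
  define \<tau> where "\<tau> = (\<lambda>m i t. min t (real i / real m))"
  define k where "k = (\<lambda>m x t i. rec_nat \<one> (\<lambda>i y. y \<otimes> q (\<Phi> x (\<tau> m i t) (\<tau> m (Suc i) t))) i)"
  have k_0: "\<And>m x t. k m x t 0 = \<one>"
    and k_Suc: "\<And>m x t i. k m x t (Suc i) = k m x t i \<otimes> q (\<Phi> x (\<tau> m i t) (\<tau> m (Suc i) t))"
    by (simp_all add: k_def)
  have clip_in: "\<tau> m i t \<in> {0..1}" if "t \<in> {0..1}" for m i t
    using that by (auto simp: \<tau>_def)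
  have clip_close: "\<bar>\<tau> m i t - \<tau> m (Suc i) t\<bar> \<le> 1 / real m" for m i t
  proof -
    obtain r e where "real i / real m = r" "real (Suc i) / real m = r + e" "1 / real m = e" "0 \<le> e"
      by (simp add: add_divide_distrib)
    then show ?thesis unfolding \<tau>_def by (simp add: min_def)
  qed
  have step: "\<Phi> x (\<tau> m i t) (\<tau> m (Suc i) t) \<in> T" if "good m x" "t \<in> {0..1}" for m x t i
    using that clip_in clip_close unfolding good_def by blast
  have k_in: "k m x t i \<in> carrier G" if "good m x" "t \<in> {0..1}" for m x t i
    by (induction i) (use step[OF that] T(4) in \<open>auto simp: k_0 k_Suc\<close>)
  have cover_k: "\<pi> (k m x t i) = h x (\<tau> m i t)" if "good m x" "t \<in> {0..1}" "x \<in> K" for m x t i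
  proof (induction i)
    case 0
    then show ?case using that h0 by (simp add: k_0 \<tau>_def)
  next
    case (Suc i)
    have "\<pi> (k m x t (Suc i)) = h x (\<tau> m i t) ** (Sp_inv (h x (\<tau> m i t)) ** h x (\<tau> m (Suc i) t))"
      using step[OF that(1,2)] T(4,6) k_in[OF that(1,2)] Suc by (auto simp: k_Suc \<Phi>_def image_subset_iff)
    then show ?case
      using Sp_inv(2)[OF h_in[OF that(3) clip_in[OF that(2)]]] by (simp add: matrix_mul_assoc)
  qed
  have k_triv: "k m x t i = \<one>" if "\<And>s. s \<in> {0..t} \<Longrightarrow> h x s = mat 1" "t \<ge> 0" for m x t i
  proof (induction i)
    case (Suc i)
    have "\<tau> m i t \<in> {0..t}" "\<tau> m (Suc i) t \<in> {0..t}" using that(2) by (auto simp: \<tau>_def)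
    then show ?case using Suc that(1) by (simp add: k_Suc \<Phi>_def T(5) Sp_inv_def transpose_mat)
  qed (simp add: k_0)
  have k_cont: "continuous_on (D \<times> {0..1}) (\<lambda>(x, t). k m x t i)" if "D \<subseteq> K" "\<And>x. x \<in> D \<Longrightarrow> good m x" for D m i
  proof (induction i)
    case (Suc i)
    have hc: "continuous_on (D \<times> {0..1}) (\<lambda>z. h (fst z) (\<tau> m j (snd z)))" for j
    proof (rule h_comp)
      show "continuous_on (D \<times> {0..1}) (\<lambda>z. \<tau> m j (snd z))"
        unfolding \<tau>_def by (intro continuous_intros)
    qed (use that(1) clip_in in \<open>auto intro!: continuous_intros\<close>)
    have "continuous_on (D \<times> {0..1}) (\<lambda>z. q (\<Phi> (fst z) (\<tau> m i (snd z)) (\<tau> m (Suc i) (snd z))))"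
    proof (rule continuous_on_compose2[OF T(3)])
      show "continuous_on (D \<times> {0..1}) (\<lambda>z. \<Phi> (fst z) (\<tau> m i (snd z)) (\<tau> m (Suc i) (snd z)))"
        unfolding \<Phi>_def by (intro continuous_intros hc)
    qed (use step that(2) in auto)
    moreover have "continuous_on (D \<times> {0..1}) (\<lambda>z. k m (fst z) (snd z) i)"
      using Suc by (simp add: case_prod_unfold)
    ultimately show ?case
      unfolding k_Suc case_prod_unfold
      using that(2) k_in step T(4) by (intro continuous_on_G_mult) (auto simp: image_subset_iff)
  qed (simp add: k_0 case_prod_unfold)
  \<comment> \<open>The subdivision cannot be fixed for all of \<open>K\<close> at once. Products
    for two meshes are lifts of the same path from the identity, so their end points agree and local
    choices of \<open>m\<close> glue together.\<close>
  have k_unique: "k m x 1 m = k m' x 1 m'" if "good m x" "good m' x" "x \<in> K" for m m' x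
  proof (rule lift_unique[of "{0..1::real}" "\<lambda>t. k m x t m" "\<lambda>t. k m' x t m'" 0])
    have sl: "continuous_on {0..1} (\<lambda>t. k m x t m)" if "good m x" for m
    proof -
      have "continuous_on ({x} \<times> {0..1}) (\<lambda>(y, t). k m y t m)"
        using that \<open>x \<in> K\<close> by (intro k_cont) auto
      moreover have "continuous_on {0..1} (\<lambda>t::real. (x, t))" by (intro continuous_intros)
      ultimately have "continuous_on {0..1} (\<lambda>t. (\<lambda>(y, t). k m y t m) (x, t))"
        by (rule continuous_on_compose2) auto
      then show ?thesis by simp
    qed
    show "continuous_on {0..1} (\<lambda>t. k m x t m)" "continuous_on {0..1} (\<lambda>t. k m' x t m')"
      using sl that by auto
    show "k m x 0 m = k m' x 0 m'" using h0[OF that(3)] k_triv[of 0] by auto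
    fix t :: real assume t: "t \<in> {0..1}"
    then have "\<tau> m m t = t" "\<tau> m' m' t = t" using that by (auto simp: \<tau>_def good_def)
    then show "\<pi> (k m x t m) = \<pi> (k m' x t m')" using cover_k that t by simp
  qed (use k_in that in auto)
  \<comment> \<open>\<open>K\<close> is closed in a Euclidean space, so its part in a closed ball is
    compact and the increments are uniformly continuous there. As the increment from s to s is the
    identity, one mesh serves the whole ball.\<close>
  have local_good: "\<exists>m. \<forall>y \<in> K \<inter> ball x 1. good m y" if x: "x \<in> K" for x
  proof -
    let ?D = "(K \<inter> cball x 1) \<times> {0..1::real} \<times> {0..1::real}"
    have "compact ?D" by (intro compact_Times closed_Int_compact K) auto
    have c1: "continuous_on ?D (\<lambda>z. h (fst z) (fst (snd z)))"
      by (rule h_comp) (auto intro!: continuous_intros)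
    have c2: "continuous_on ?D (\<lambda>z. h (fst z) (snd (snd z)))"
      by (rule h_comp) (auto intro!: continuous_intros)
    have "continuous_on ?D (\<lambda>z. \<Phi> (fst z) (fst (snd z)) (snd (snd z)))"
      unfolding \<Phi>_def by (intro continuous_intros c1 c2)
    then have uc: "uniformly_continuous_on ?D (\<lambda>z. \<Phi> (fst z) (fst (snd z)) (snd (snd z)))"
      using \<open>compact ?D\<close> by (rule compact_uniformly_continuous)
    obtain e where e: "e > 0" "ball (mat 1) e \<inter> carrier Sp \<subseteq> T"
      using T(1,2) by (meson openin_contains_ball)
    obtain d where d: "d > 0" "\<And>z z'. z \<in> ?D \<Longrightarrow> z' \<in> ?D \<Longrightarrow> dist z' z < d \<Longrightarrow>
        dist (\<Phi> (fst z') (fst (snd z')) (snd (snd z'))) (\<Phi> (fst z) (fst (snd z)) (snd (snd z))) < e"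
      using uc e(1) unfolding uniformly_continuous_on_def by metis
    obtain m :: nat where m: "m > 0" "1 / real m < d"
      using d(1) by (metis nat_approx_posE of_nat_Suc zero_less_Suc)
    have "good m y" if y: "y \<in> K \<inter> ball x 1" for y
      unfolding good_def
    proof (intro conjI ballI impI m(1))
      fix s t :: real assume st: "s \<in> {0..1}" "t \<in> {0..1}" "\<bar>s - t\<bar> \<le> 1 / real m"
      have "dist (\<Phi> y s t) (\<Phi> y s s) < e"
        using d(2)[of "(y, s, s)" "(y, s, t)"] y st m(2)
        by (auto simp: dist_Pair_Pair dist_real_def abs_minus_commute)
      moreover have "\<Phi> y s s = mat 1" using y st h_in by (simp add: \<Phi>_def Sp_inv)
      moreover have "\<Phi> y s t \<in> carrier Sp" unfolding \<Phi>_def using y st h_in by (intro Sp_mult Sp_inv_in) auto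
      ultimately show "\<Phi> y s t \<in> T" using e(2) by (auto simp: dist_commute)
    qed
    then show ?thesis by blast
  qed
  define \<sigma> where "\<sigma> = (\<lambda>x. let m = (SOME m. good m x) in k m x 1 m)"
  have \<sigma>: "\<sigma> x = k m x 1 m" if "x \<in> K" "good m x" for m x
    unfolding \<sigma>_def Let_def using someI[of "\<lambda>m. good m x", OF that(2)] that k_unique by blast
  show ?thesis
  proof (rule that[of \<sigma>])
    show "continuous_on K \<sigma>"
    proof (rule continuous_on_eq_continuous_within[THEN iffD2], intro ballI)
      fix x assume x: "x \<in> K"
      then obtain m where m: "\<And>y. y \<in> K \<inter> ball x 1 \<Longrightarrow> good m y" using local_good by blast
      have "continuous_on (K \<inter> ball x 1) (\<lambda>y. k m y 1 m)"
      proof -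
        have "continuous_on ((K \<inter> ball x 1) \<times> {0..1}) (\<lambda>(y, t). k m y t m)"
          using m by (intro k_cont) auto
        moreover have "continuous_on (K \<inter> ball x 1) (\<lambda>y. (y, 1::real))" by (intro continuous_intros)
        ultimately have "continuous_on (K \<inter> ball x 1) (\<lambda>y. (\<lambda>(y, t). k m y t m) (y, 1))"
          by (rule continuous_on_compose2) auto
        then show ?thesis by simp
      qed
      then have "continuous_on (K \<inter> ball x 1) \<sigma>"
        by (rule continuous_on_eq) (use \<sigma>[symmetric] m in blast)
      then show "continuous (at x within K) \<sigma>"
        using x at_within_nhd[of x "ball x 1" "K \<inter> ball x 1" K]
        unfolding continuous_on_eq_continuous_within by force
    qed
    have ex: "\<exists>m. good m x" if "x \<in> K" for x
      using local_good[OF that] that by (metis IntI centre_in_ball zero_less_one)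
    show "\<sigma> ` K \<subseteq> carrier G"
    proof (rule image_subsetI)
      fix x assume x: "x \<in> K"
      then obtain m where "good m x" using ex by blast
      then show "\<sigma> x \<in> carrier G" using \<sigma>[OF x] k_in[of m x 1] by simp
    qed
    show "\<pi> (\<sigma> x) = h x 1" if x: "x \<in> K" for x
    proof -
      obtain m where m: "good m x" using ex[OF x] by blast
      then have "\<tau> m m 1 = 1" by (auto simp: \<tau>_def good_def)
      then show ?thesis using cover_k[OF m, of 1 m] x \<sigma>[OF x m] by simp
    qed
    show "\<sigma> x = \<one>" if "x \<in> K" "\<And>t. t \<in> {0..1} \<Longrightarrow> h x t = mat 1" for x
    proof -
      have "\<exists>m. good m x" using ex that(1) .
      then obtain m where "good m x" ..
      then show ?thesis using \<sigma>[OF that(1)] k_triv[of 1 x] that(2) by simp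
    qed
  qed
qed

text \<open>Translation by \<open>g\<close> reduces the question to the identity. There Cayley paths
  start at 1, stay inside the chart for end points near 1, and are transported to \<open>G\<close>
  by the local section.\<close>

lemma locally_path_connected_G:
  assumes U: "open_G U" and g: "g \<in> U"
  shows "\<exists>V. open_G V \<and> g \<in> V \<and>
        (\<forall>y\<in>V. \<exists>p. path p \<and> path_image p \<subseteq> U \<and> pathstart p = g \<and> pathfinish p = y)"
proof -
  have gG: "g \<in> carrier G" using U g openin_imp_subset by blast
  obtain T q where T: "open_Sp T" "mat 1 \<in> T" "continuous_on T q"
    "q ` T \<subseteq> carrier G" "open_G (q ` T)" "q (mat 1) = \<one>"
    "\<And>M. M \<in> T \<Longrightarrow> \<pi> (q M) = M" "\<And>g. g \<in> q ` T \<Longrightarrow> \<pi> g \<in> T \<and> q (\<pi> g) = g"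
    using local_section by metis
  define T' where "T' = T \<inter> q -` {x \<in> carrier G. g \<otimes> x \<in> U}"
  have "openin (top_of_set T) T'"
    unfolding T'_def using T(3,4) U gG
    by (intro continuous_openin_preimage[where T = "carrier G"] openin_translate) auto
  then have T': "open_Sp T'" using T(1) openin_trans by metis
  have one_T': "mat 1 \<in> T'" using T g gG by (simp add: T'_def)
  define P where "P = ball (mat 1) 1 \<inter> (carrier Sp :: 'n real_2n_matrix set)"
  \<comment> \<open>At distance less than 1 from the identity, |x . (M - 1) x| < x . x, so the form
    of \<open>M\<close> is positive and the Cayley path exists.\<close>
  have pos: "form_positive M" if "M \<in> P" for M :: "'n real_2n_matrix"
    unfolding form_positive_def
  proof (intro allI impI)
    fix x :: "real^('n+'n)" assume "x \<noteq> 0"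
    have "norm ((M - mat 1) *v x) \<le> norm (M - mat 1) * norm x" by (rule norm_matrix_vector_mult_le)
    also have "\<dots> < 1 * norm x" using that \<open>x \<noteq> 0\<close>
      by (intro mult_strict_right_mono) (auto simp: P_def dist_norm norm_minus_commute)
    finally have "norm x * norm ((M - mat 1) *v x) < norm x * norm x" using \<open>x \<noteq> 0\<close> by simp
    then have "\<bar>x \<bullet> ((M - mat 1) *v x)\<bar> < x \<bullet> x"
      using Cauchy_Schwarz_ineq2[of x "(M - mat 1) *v x"]
      by (simp add: power2_norm_eq_inner[symmetric] power2_eq_square)
    then show "0 < x \<bullet> (M *v x)"
      by (simp add: matrix_vector_mult_diff_rdistrib inner_diff_right)
  qed
  let ?\<gamma> = "\<lambda>(M, t). cayley_path M t :: 'n real_2n_matrix"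
  have \<gamma>_cont: "continuous_on (P \<times> {0..1}) ?\<gamma>"
    unfolding case_prod_unfold using pos by (intro continuous_on_cayley_path continuous_intros) auto
  have \<gamma>_Sp: "?\<gamma> ` (P \<times> {0..1}) \<subseteq> carrier Sp"
    using pos by (auto simp: P_def intro!: cayley_path_Sp)
  have "openin (top_of_set (P \<times> {0..1})) ((P \<times> {0..1}) \<inter> ?\<gamma> -` T')"
    using \<gamma>_Sp by (intro continuous_openin_preimage[where T = "carrier Sp"] T' \<gamma>_cont) auto
  then obtain W where W: "open W" "(P \<times> {0..1}) \<inter> ?\<gamma> -` T' = (P \<times> {0..1}) \<inter> W"
    by (auto simp: openin_open)
  \<comment> \<open>The whole path of the identity is the identity; the tube lemma extends this to a
    neighbourhood of end points whose entire paths stay in the chart.\<close>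
  have "{mat 1} \<times> {0..1} \<subseteq> (P \<times> {0..1}) \<inter> ?\<gamma> -` T'"
    using one_T' by (auto simp: cayley_path_one P_def Sp_one)
  then have "{mat 1} \<times> {0..1} \<subseteq> W" using W(2) by auto
  then obtain N where N: "open N" "mat 1 \<in> N" "N \<times> {0..1} \<subseteq> W"
    using Elementary_Topology.tube_lemma[OF compact_Icc W(1)] by metis
  let ?V = "{x \<in> carrier G. inv g \<otimes> x \<in> carrier G \<inter> \<pi> -` (N \<inter> P) \<inter> q ` T}"
  have "open_G (carrier G \<inter> \<pi> -` (N \<inter> P))"
  proof (rule continuous_openin_preimage[where T = "carrier Sp"])
    have "N \<inter> P = carrier Sp \<inter> (N \<inter> ball (mat 1) 1)" by (auto simp: P_def)
    then show "open_Sp (N \<inter> P)"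
      using N(1) by (metis openin_open_Int open_Int open_ball)
  qed (use continuous_on_cover in auto)
  then have "open_G ?V"
    using T(5) gG by (intro openin_translate openin_Int[of _ "carrier G \<inter> _"]) auto
  moreover have "g \<in> ?V" using gG T(2,6) N(2) by (auto simp: P_def Sp_one intro: rev_image_eqI)
  moreover have "\<exists>p. path p \<and> path_image p \<subseteq> U \<and> pathstart p = g \<and> pathfinish p = y" if y: "y \<in> ?V" for y
  proof -
    define M where "M = \<pi> (inv g \<otimes> y)"
    have M: "M \<in> N" "M \<in> P" "q M = inv g \<otimes> y" "y \<in> carrier G" using y T(8) by (auto simp: M_def)
    have in_T': "cayley_path M t \<in> T'" if "t \<in> {0..1}" for t
    proof -
      have "(M, t) \<in> (P \<times> {0..1}) \<inter> W" using N(3) M that by blast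
      then have "(M, t) \<in> (P \<times> {0..1}) \<inter> ?\<gamma> -` T'" using W(2) by blast
      then show ?thesis by simp
    qed
    have c: "continuous_on {0..1} (\<lambda>t. q (cayley_path M t))"
      using in_T' pos[OF M(2)] by (intro continuous_on_compose2[OF T(3)] continuous_on_cayley_path)
        (auto simp: T'_def intro!: continuous_intros)
    have "path (\<lambda>t. g \<otimes> q (cayley_path M t))"
      unfolding path_def using c gG in_T' T(4)
      by (intro continuous_on_G_mult) (auto simp: T'_def)
    moreover have "path_image (\<lambda>t. g \<otimes> q (cayley_path M t)) \<subseteq> U"
      using in_T' by (auto simp: path_image_def T'_def)
    ultimately show ?thesis
      using M gG cayley_path_endpoints[OF pos[OF M(2)]] T(6)
      by (intro exI[of _ "\<lambda>t. g \<otimes> q (cayley_path M t)"])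
        (auto simp: pathstart_def pathfinish_def m_assoc[symmetric])
  qed
  ultimately show ?thesis by blast
qed

section \<open>The angle function\<close>

abbreviation "Z \<equiv> group_center G"
abbreviation "H \<equiv> H_subgroup G \<pi>"
abbreviation "U \<equiv> U_tilde G \<pi>"

definition log_lift :: "'g \<Rightarrow> complex" where
  "log_lift = (SOME l. continuous_on (carrier G) l \<and> (\<forall>g\<in>carrier G. cdet (\<pi> g) = exp (l g)) \<and> l \<one> = 0)"

definition angle :: "'g \<Rightarrow> real" where
  "angle g = Im (log_lift g)"

lemma cdet_one [simp]: "cdet (mat 1) = 1"
  using cdet_scalar_rotation[of 0] by (simp add: scalar_rotation_values)

lemma log_lift:
  shows continuous_on_log_lift: "continuous_on (carrier G) log_lift"
    and exp_log_lift: "g \<in> carrier G \<Longrightarrow> exp (log_lift g) = cdet (\<pi> g)"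
    and log_lift_one: "log_lift \<one> = 0"
proof -
  have "continuous_on (carrier G) (\<lambda>g. cdet (\<pi> g))"
    by (rule continuous_on_compose2[OF continuous_on_cdet[of UNIV] continuous_on_cover]) simp
  then obtain l where l: "continuous_on (carrier G) l" "\<And>g. g \<in> carrier G \<Longrightarrow> cdet (\<pi> g) = exp (l g)"
    using simply_connected_continuous_log[OF simply_connected_G locally_path_connected_G]
      cdet_nonzero cover_in by metis
  have "exp (l \<one>) = 1" using l(2)[of \<one>] by simp
  then have "\<exists>l. continuous_on (carrier G) l \<and> (\<forall>g\<in>carrier G. cdet (\<pi> g) = exp (l g)) \<and> l \<one> = 0"
    using l by (intro exI[of _ "\<lambda>g. l g - l \<one>"]) (auto intro!: continuous_intros simp: exp_diff)
  from someI_ex[OF this, folded log_lift_def]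
  show "continuous_on (carrier G) log_lift" "g \<in> carrier G \<Longrightarrow> exp (log_lift g) = cdet (\<pi> g)"
    "log_lift \<one> = 0" by auto
qed

lemma mem_U_tilde: "u \<in> U \<longleftrightarrow> u \<in> carrier G \<and> \<pi> u \<in> U_subgroup"
  by (simp add: U_tilde_def preimage_in_def)

lemma U_subgroup_closed:
  "mat 1 \<in> U_subgroup" "M \<in> U_subgroup \<Longrightarrow> N \<in> U_subgroup \<Longrightarrow> M ** N \<in> U_subgroup"
  "M \<in> U_subgroup \<Longrightarrow> Sp_inv M \<in> U_subgroup"
proof -
  show "mat 1 \<in> U_subgroup" using scalar_rotation_mem(2)[of 0] by (simp add: scalar_rotation_values)
  show "M ** N \<in> U_subgroup" if "M \<in> U_subgroup" "N \<in> U_subgroup"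
  proof -
    have "transpose (M ** N) ** (M ** N) = transpose N ** (transpose M ** M) ** N"
      by (simp add: matrix_transpose_mul matrix_mul_assoc)
    then show ?thesis using that by (simp add: mem_U_subgroup Sp_mult)
  qed
  show "Sp_inv M \<in> U_subgroup" if "M \<in> U_subgroup"
  proof -
    have M: "M \<in> carrier Sp" "transpose M ** M = mat 1" using that by (auto simp: mem_U_subgroup)
    have "transpose M ** (M ** Sp_inv M) = Sp_inv M" by (simp add: matrix_mul_assoc M(2))
    then have "Sp_inv M = transpose M" by (simp add: Sp_inv[OF M(1)])
    then show ?thesis using M by (simp add: mem_U_subgroup Sp_transpose matrix_left_right_inverse)
  qed
qed

lemma subgroup_U_tilde: "subgroup (U) G"
proof (rule subgroupI)
  have "\<one> \<in> U" by (simp add: mem_U_tilde U_subgroup_closed)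
  then show "U \<noteq> {}" by blast
qed (auto simp: mem_U_tilde U_subgroup_closed)

lemma U_tilde_carrier: "u \<in> U \<Longrightarrow> u \<in> carrier G"
  by (simp add: mem_U_tilde)

text \<open>For fixed \<open>u\<close> both sides are continuous logarithms of the same function of
  \<open>g\<close>, by \<open>cdet_mult_U\<close>. They differ by a constant on the connected group,
  and at the identity the difference is 0.\<close>

lemma log_lift_mult_U:
  assumes g: "g \<in> carrier G" and u: "u \<in> U"
  shows "log_lift (g \<otimes> u) = log_lift g + log_lift u"
proof -
  have uG: "u \<in> carrier G" and uU: "\<pi> u \<in> U_subgroup" using u by (auto simp: mem_U_tilde)
  have "log_lift (g \<otimes> u) - (log_lift g + log_lift u) = log_lift (\<one> \<otimes> u) - (log_lift \<one> + log_lift u)"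
  proof (rule exp_eq_imp_diff_constant[OF connected_G])
    show "continuous_on (carrier G) (\<lambda>x. log_lift (x \<otimes> u))"
      by (rule continuous_on_compose2[OF continuous_on_log_lift continuous_on_G_mult])
        (use uG in auto)
    show "continuous_on (carrier G) (\<lambda>x. log_lift x + log_lift u)"
      by (intro continuous_intros continuous_on_log_lift)
    show "exp (log_lift (x \<otimes> u)) = exp (log_lift x + log_lift u)" if "x \<in> carrier G" for x
      using that uG by (simp add: exp_log_lift exp_add cdet_mult_U[OF uU])
  qed (use g in auto)
  then show ?thesis using uG by (simp add: log_lift_one)
qed

lemma angle_one [simp]: "angle \<one> = 0"
  by (simp add: angle_def log_lift_one)

lemma angle_mult_U: "g \<in> carrier G \<Longrightarrow> u \<in> U \<Longrightarrow> angle (g \<otimes> u) = angle g + angle u"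
  by (simp add: angle_def log_lift_mult_U)

lemma angle_inv_U:
  assumes "u \<in> U"
  shows "angle (inv u) = - angle u"
  using angle_mult_U[of "inv u" u] assms by (simp add: U_tilde_carrier)

lemma continuous_on_angle: "continuous_on (carrier G) angle"
  unfolding angle_def by (intro continuous_intros continuous_on_log_lift)

lemma cdet_eq_cis_angle:
  assumes "u \<in> U"
  shows "cdet (\<pi> u) = cis (angle u)"
proof -
  have u: "u \<in> carrier G" "\<pi> u \<in> U_subgroup" using assms by (auto simp: mem_U_tilde)
  have "norm (exp (log_lift u)) = 1" using u by (simp add: exp_log_lift norm_cdet_U)
  then have "Re (log_lift u) = 0" by simp
  then show ?thesis using exp_log_lift[OF u(1)] by (simp add: angle_def exp_eq_polar)
qed

section \<open>The center and the subgroups \<open>H\<close> and \<open>HR\<close>\<close>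

text \<open>One inclusion is \<open>Sp_center\<close>, carried over by surjectivity of
  \<open>\<pi>\<close>. For the other, g -> z g and g -> g z lift the same map when
  \<open>\<pi> z\<close> is 1 or -1, and they agree at the identity.\<close>

lemma group_center_eq: "Z = {z \<in> carrier G. \<pi> z = mat 1 \<or> \<pi> z = - mat 1}"
proof (intro subset_antisym subsetI)
  fix z assume z: "z \<in> Z"
  then have zG: "z \<in> carrier G" by (simp add: group_center_def)
  have "\<pi> z = mat 1 \<or> \<pi> z = - mat 1"
  proof (rule Sp_center)
    fix T :: "'n real_2n_matrix" assume "T \<in> carrier Sp"
    then have "T \<in> \<pi> ` carrier G" by (simp only: cover_surj)
    then obtain g where g: "g \<in> carrier G" "T = \<pi> g" by blast
    then have "z \<otimes> g = g \<otimes> z" using z by (simp add: group_center_def)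
    then show "\<pi> z ** T = T ** \<pi> z" using g zG by (metis cover_mult)
  qed (use zG in auto)
  then show "z \<in> {z \<in> carrier G. \<pi> z = mat 1 \<or> \<pi> z = - mat 1}" using zG by simp
next
  fix z assume z: "z \<in> {z \<in> carrier G. \<pi> z = mat 1 \<or> \<pi> z = - mat 1}"
  have "z \<otimes> g = g \<otimes> z" if "g \<in> carrier G" for g
    by (rule lift_unique[OF connected_G, of "\<lambda>g. z \<otimes> g" "\<lambda>g. g \<otimes> z" \<one>])
      (use z that in \<open>auto intro!: continuous_on_G_mult\<close>)
  then show "z \<in> Z" using z by (simp add: group_center_def)
qed

lemma center_carrier: "z \<in> Z \<Longrightarrow> z \<in> carrier G"
  and center_commute: "z \<in> Z \<Longrightarrow> g \<in> carrier G \<Longrightarrow> z \<otimes> g = g \<otimes> z"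
  by (auto simp: group_center_def)

lemma uminus_one_U: "- mat 1 \<in> U_subgroup"
  using scalar_rotation_mem(2)[of pi] by (simp add: scalar_rotation_values)

lemma center_U: "z \<in> Z \<Longrightarrow> z \<in> U"
  using U_subgroup_closed(1) uminus_one_U by (auto simp: group_center_eq mem_U_tilde)

lemma subgroup_center: "subgroup (Z) G"
proof (rule subgroupI)
  have "Sp_inv (mat 1) = (mat 1 :: 'n real_2n_matrix)" "Sp_inv (- mat 1) = (- mat 1 :: 'n real_2n_matrix)"
    by (simp_all add: Sp_inv_def transpose_mat)
  then show "inv a \<in> Z" if "a \<in> Z" for a
    using that by (auto simp: group_center_eq)
qed (auto simp: group_center_eq intro: exI[of _ \<one>])

text \<open>The square of a central element lies over the identity matrix, whose determinant is 1;
  hence twice the angle is a multiple of 2 pi.\<close>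

lemma angle_center:
  assumes z: "z \<in> Z"
  obtains k :: int where "angle z = of_int k * pi"
proof -
  have zz: "z \<otimes> z \<in> U" "\<pi> (z \<otimes> z) = mat 1"
    using z center_U[OF z] subgroup.m_closed[OF subgroup_U_tilde] by (auto simp: group_center_eq)
  have "cis (angle (z \<otimes> z)) = 1" using cdet_eq_cis_angle[OF zz(1)] zz(2) by simp
  then have "cos (2 * angle z) = 1"
    using angle_mult_U[OF center_carrier[OF z] center_U[OF z]]
    by (metis cis.sel(1) mult_2 one_complex.sel(1))
  then obtain k :: int where "2 * angle z = of_int k * 2 * pi"
    using cos_one_2pi_int by blast
  then show ?thesis using that[of k] by simp
qed

text \<open>Provides elements of \<open>R_subgroup G \<pi>\<close> of every prescribed angle, by
  lifting the paths t -> e^(iat). The factor n appears because the scalar e^(ia) has determinant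
  e^(ina).\<close>

lemma rotation_lift:
  obtains r where "\<And>a. r a \<in> R_subgroup G \<pi>" "\<And>a. r a \<in> U" "continuous_on UNIV r"
    "\<And>a. \<pi> (r a) = scalar_rotation a" "\<And>a. angle (r a) = real CARD('n) * a"
proof -
  have 1: "continuous_on (UNIV \<times> {0..1}) (\<lambda>(a, t). scalar_rotation (a * t) :: 'n real_2n_matrix)"
    unfolding case_prod_unfold by (intro continuous_intros)
  obtain r :: "real \<Rightarrow> 'g" where r: "continuous_on UNIV r" "r ` UNIV \<subseteq> carrier G"
    "\<And>a. \<pi> (r a) = scalar_rotation (a * 1)"
    "\<And>a. (\<And>t. t \<in> {0..1} \<Longrightarrow> scalar_rotation (a * t) = (mat 1 :: 'n real_2n_matrix)) \<Longrightarrow> r a = \<one>"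
  proof (rule lift_end[OF closed_UNIV 1])
    show "(scalar_rotation (a * t) :: 'n real_2n_matrix) \<in> carrier Sp" for a t
      by (rule U_subgroup_Sp[OF scalar_rotation_mem(2)])
  qed (simp_all add: scalar_rotation_values)
  have r0: "r 0 = \<one>" by (rule r(4)) (simp add: scalar_rotation_values)
  have r3: "\<pi> (r a) = scalar_rotation a" for a using r(3)[of a] by simp
  have rG: "r a \<in> carrier G" for a using r(2) by auto
  have U: "r a \<in> U" for a using rG r3 scalar_rotation_mem(2) by (simp add: mem_U_tilde)
  have "range r \<subseteq> connected_component_set (preimage_in G \<pi> scalar_U_subgroup) \<one>"
  proof (rule connected_component_maximal)
    show "\<one> \<in> range r" using r0 by (metis rangeI)
    show "connected (range r)" by (rule connected_continuous_image[OF r(1) connected_UNIV])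
    show "range r \<subseteq> preimage_in G \<pi> scalar_U_subgroup"
      using rG r3 scalar_rotation_mem(1) by (auto simp: preimage_in_def)
  qed
  then have R: "r a \<in> R_subgroup G \<pi>" for a by (auto simp: R_subgroup_def)
  have "log_lift (r a) - \<i> * of_real (real CARD('n) * a) =
      log_lift (r 0) - \<i> * of_real (real CARD('n) * 0)" for a
  proof (rule exp_eq_imp_diff_constant[OF connected_UNIV])
    show "continuous_on UNIV (\<lambda>a. log_lift (r a))"
      by (rule continuous_on_compose2[OF continuous_on_log_lift r(1,2)])
    show "exp (log_lift (r a)) = exp (\<i> * of_real (real CARD('n) * a))" for a
      unfolding exp_log_lift[OF rG] r3 cdet_scalar_rotation by (simp only: cis_conv_exp)
  qed (auto intro!: continuous_intros)
  then have "log_lift (r a) = \<i> * of_real (real CARD('n) * a)" for a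
    by (simp add: r0 log_lift_one)
  then have "angle (r a) = real CARD('n) * a" for a by (simp add: angle_def)
  then show ?thesis using that[of r] R U r(1) r3 by blast
qed

text \<open>The polar decomposition retracts \<open>Sp\<close> onto the unitary group through the contractible set of
  positive parts, so the retraction lifts to \<open>G\<close>.\<close>

lemma unitary_retraction:
  obtains \<kappa> where "continuous_on (carrier G) \<kappa>" "\<kappa> ` carrier G \<subseteq> U"
    "\<And>u. u \<in> U \<Longrightarrow> \<kappa> u = u"
proof -
  let ?P = "positive_part :: 'n real_2n_matrix \<Rightarrow> 'n real_2n_matrix"
  have pos: "form_positive (?P M)" if "M \<in> carrier Sp" for M
    using positive_part_Sp(1)[OF that] by (simp add: pos_def_def form_positive_def)
  have 1: "continuous_on (carrier Sp \<times> {0..1}) (\<lambda>(M, t). cayley_path (?P M) t)"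
    unfolding case_prod_unfold
    by (intro continuous_on_cayley_path continuous_intros continuous_on_compose2[OF continuous_on_positive_part])
      (use pos in auto)
  obtain \<sigma> where \<sigma>: "continuous_on (carrier Sp) \<sigma>" "\<sigma> ` carrier Sp \<subseteq> carrier G"
    "\<And>M. M \<in> carrier Sp \<Longrightarrow> \<pi> (\<sigma> M) = cayley_path (?P M) 1"
    "\<And>M. M \<in> carrier Sp \<Longrightarrow> (\<And>t. t \<in> {0..1} \<Longrightarrow> cayley_path (?P M) t = mat 1) \<Longrightarrow> \<sigma> M = \<one>"
  proof (rule lift_end[OF closed_Sp 1])
    show "cayley_path (?P M) t \<in> carrier Sp" if "M \<in> carrier Sp" "t \<in> {0..1}" for M t
      by (rule cayley_path_Sp[OF positive_part_Sp(2)[OF that(1)] pos[OF that(1)] that(2)])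
    show "cayley_path (?P M) 0 = mat 1" if "M \<in> carrier Sp" for M
      by (rule cayley_path_endpoints(1)[OF pos[OF that]])
  qed (blast intro: that)
  have \<pi>\<sigma>: "\<pi> (\<sigma> M) = ?P M" if "M \<in> carrier Sp" for M
    using \<sigma>(3)[OF that] cayley_path_endpoints(2)[OF pos[OF that]] by simp
  define \<kappa> where "\<kappa> = (\<lambda>g. inv (\<sigma> (\<pi> g)) \<otimes> g)"
  have \<sigma>_in: "\<sigma> (\<pi> g) \<in> carrier G" if "g \<in> carrier G" for g using \<sigma>(2) that by auto
  show ?thesis
  proof (rule that[of \<kappa>])
    have "continuous_on (carrier G) (\<lambda>g. \<sigma> (\<pi> g))"
      by (rule continuous_on_compose2[OF \<sigma>(1) continuous_on_cover]) auto
    then show "continuous_on (carrier G) \<kappa>"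
      unfolding \<kappa>_def using \<sigma>_in by (intro continuous_on_G_mult continuous_on_G_inv) auto
    show "\<kappa> ` carrier G \<subseteq> U"
    proof (rule image_subsetI)
      fix g assume g: "g \<in> carrier G"
      then have "\<pi> (\<kappa> g) = Sp_inv (?P (\<pi> g)) ** \<pi> g"
        using \<sigma>_in by (simp add: \<kappa>_def \<pi>\<sigma>)
      then show "\<kappa> g \<in> U"
        using g \<sigma>_in polar_orthogonal[OF cover_in[OF g]] positive_part_Sp(2)[OF cover_in[OF g]]
        by (auto simp: mem_U_tilde mem_U_subgroup \<kappa>_def intro: Sp_mult Sp_inv_in)
    qed
    fix u assume u: "u \<in> U"
    then have "transpose (\<pi> u) ** \<pi> u = mat 1" by (simp add: mem_U_tilde mem_U_subgroup)
    then have "?P (\<pi> u) = mat 1" by (intro positive_part_orthogonal) (simp add: matrix_left_right_inverse)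
    \<comment> \<open>Over a unitary matrix the Cayley path is constant, and the last clause of
      \<open>lift_end\<close> selects the lift 1 rather than another element of the kernel.\<close>
    then have "\<sigma> (\<pi> u) = \<one>" using u by (intro \<sigma>(4)) (auto simp: cayley_path_one mem_U_tilde)
    then show "\<kappa> u = u" using u by (simp add: \<kappa>_def mem_U_tilde)
  qed
qed

text \<open>On the preimage of SU(n) the logarithm takes values in the multiples of 2 pi i, so it
  vanishes on the component of the identity. Conversely, the retraction onto the preimage of U(n),
  followed by division by a rotation of equal angle, maps the connected group \<open>G\<close> onto
  the set of angle 0.\<close>

lemma H_subgroup_eq: "H = {u \<in> U. angle u = 0}"
proof (intro subset_antisym subsetI)
  let ?S = "preimage_in G \<pi> SU_subgroup"
  have S: "?S = {u \<in> U. cdet (\<pi> u) = 1}"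
    by (auto simp: preimage_in_def SU_subgroup_eq mem_U_tilde)
  have H_sub: "H \<subseteq> ?S" by (simp add: H_subgroup_def connected_component_subset)
  have one_S: "\<one> \<in> ?S" using subgroup.one_closed[OF subgroup_U_tilde] by (simp add: S)
  fix u assume u: "u \<in> H"
  have "log_lift u - 0 = log_lift \<one> - 0"
  proof (rule exp_eq_imp_diff_constant[of "H" log_lift "\<lambda>_. 0"])
    show "connected (H)" by (simp add: H_subgroup_def connected_connected_component)
    show "continuous_on (H) log_lift"
      using H_sub by (intro continuous_on_subset[OF continuous_on_log_lift]) (auto simp: preimage_in_def)
    show "exp (log_lift x) = exp 0" if "x \<in> H" for x
      using that H_sub by (auto simp: exp_log_lift S mem_U_tilde)
    show "\<one> \<in> H" using one_S by (simp add: H_subgroup_def connected_component_refl)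
  qed (use u in auto)
  then show "u \<in> {u \<in> U. angle u = 0}"
    using u H_sub S by (auto simp: angle_def log_lift_one)
next
  let ?S = "preimage_in G \<pi> SU_subgroup" and ?n = "real CARD('n)"
  fix u assume u: "u \<in> {u \<in> U. angle u = 0}"
  obtain \<kappa> where \<kappa>: "continuous_on (carrier G) \<kappa>" "\<kappa> ` carrier G \<subseteq> U"
    "\<And>u. u \<in> U \<Longrightarrow> \<kappa> u = u" using unitary_retraction by blast
  obtain r where r: "\<And>a. r a \<in> U" "continuous_on UNIV r" "\<And>a. angle (r a) = ?n * a"
    using rotation_lift by metis
  have r0: "r 0 \<in> {u \<in> U. angle u = 0}" using r by simp
  \<comment> \<open>The last factor \<open>r 0\<close> cancels the inverse of \<open>r 0\<close>
    that occurs when the angle is 0, so \<open>f\<close> fixes those elements even though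
    \<open>r 0\<close> is known here only by its angle and its membership in the preimage of
    U(n).\<close>
  define f where "f = (\<lambda>g. \<kappa> g \<otimes> inv (r (angle (\<kappa> g) / ?n)) \<otimes> r 0)"
  have \<kappa>G: "\<kappa> ` carrier G \<subseteq> carrier G" using \<kappa>(2) U_tilde_carrier by blast
  have rG: "r a \<in> carrier G" for a using r(1) U_tilde_carrier by blast
  have ang: "continuous_on (carrier G) (\<lambda>g. angle (\<kappa> g) / ?n)"
    by (intro continuous_intros continuous_on_compose2[OF continuous_on_angle \<kappa>(1) \<kappa>G]) simp
  have "continuous_on (carrier G) (\<lambda>g. r (angle (\<kappa> g) / ?n))"
    by (rule continuous_on_compose2[OF r(2) ang]) simp
  then have f_cont: "continuous_on (carrier G) f"
    unfolding f_def using \<kappa>(1) \<kappa>G rG by (intro continuous_on_G_mult continuous_on_G_inv) auto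
  have f_in: "f g \<in> U \<and> angle (f g) = 0" if g: "g \<in> carrier G" for g
  proof -
    have U: "\<kappa> g \<in> U" using \<kappa>(2) g by blast
    note closed = subgroup.m_closed[OF subgroup_U_tilde] subgroup.m_inv_closed[OF subgroup_U_tilde]
    show ?thesis unfolding f_def
      using U r closed by (simp add: angle_mult_U U_tilde_carrier angle_inv_U)
  qed
  have "f ` carrier G \<subseteq> connected_component_set ?S \<one>"
  proof (rule connected_component_maximal)
    show "connected (f ` carrier G)" by (rule connected_continuous_image[OF f_cont connected_G])
    show "f ` carrier G \<subseteq> ?S"
    proof (rule image_subsetI)
      fix g assume "g \<in> carrier G"
      from f_in[OF this] have "f g \<in> U" "cdet (\<pi> (f g)) = 1"
        by (auto simp: cdet_eq_cis_angle)
      then show "f g \<in> ?S" by (simp add: preimage_in_def SU_subgroup_eq mem_U_tilde)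
    qed
    have "\<kappa> \<one> = \<one>" by (rule \<kappa>(3)) (rule subgroup.one_closed[OF subgroup_U_tilde])
    then show "\<one> \<in> f ` carrier G"
      using rG by (intro image_eqI[of _ _ \<one>]) (simp_all add: f_def)
  qed
  moreover have "f u = u"
    using u \<kappa>(3)[of u] rG by (simp add: f_def m_assoc U_tilde_carrier)
  ultimately show "u \<in> H" using u U_tilde_carrier by (force simp: H_subgroup_def)
qed

lemma subgroup_H: "subgroup (H) G"
proof (rule subgroupI)
  note closed = subgroup.m_closed[OF subgroup_U_tilde] subgroup.m_inv_closed[OF subgroup_U_tilde]
  show "H \<noteq> {}" 
    using subgroup.one_closed[OF subgroup_U_tilde] by (auto simp: H_subgroup_eq intro: exI[of _ \<one>])
  show "inv a \<in> H" if "a \<in> H" for a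
    using that closed by (simp add: H_subgroup_eq angle_inv_U)
  show "a \<otimes> b \<in> H" if "a \<in> H" "b \<in> H" for a b
    using that closed by (simp add: H_subgroup_eq angle_mult_U U_tilde_carrier)
qed (auto simp: H_subgroup_eq mem_U_tilde)

lemma R_subgroup_U: "R_subgroup G \<pi> \<subseteq> U"
  using connected_component_subset[of "preimage_in G \<pi> scalar_U_subgroup"] scalar_U_subgroup_subset
  by (fastforce simp: R_subgroup_def preimage_in_def mem_U_tilde)

lemma one_R_subgroup: "\<one> \<in> R_subgroup G \<pi>"
  using scalar_rotation_mem(1)[of 0]
  by (simp add: R_subgroup_def preimage_in_def connected_component_refl scalar_rotation_values)

text \<open>Dividing \<open>u\<close> by an element of \<open>R_subgroup G \<pi>\<close> of the same
  angle leaves an element of angle 0, that is, of \<open>H\<close>.\<close>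

lemma HR_subgroup_eq: "HR_subgroup G \<pi> = U"
proof (intro subset_antisym subsetI)
  fix x assume "x \<in> HR_subgroup G \<pi>"
  then show "x \<in> U"
    using R_subgroup_U subgroup.m_closed[OF subgroup_U_tilde]
    by (auto simp: HR_subgroup_def set_mult_def H_subgroup_eq)
next
  fix u assume u: "u \<in> U"
  obtain r where r: "\<And>a. r a \<in> R_subgroup G \<pi>" "\<And>a. r a \<in> U"
      "\<And>a. angle (r a) = real CARD('n) * a"
    using rotation_lift by metis
  let ?r = "r (angle u / real CARD('n))"
  have ir: "inv ?r \<in> U" using subgroup.m_inv_closed[OF subgroup_U_tilde r(2)] .
  have "u \<otimes> inv ?r \<in> H"
    unfolding H_subgroup_eq
    using u ir r(2,3) subgroup.m_closed[OF subgroup_U_tilde u ir]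
    by (simp add: angle_mult_U angle_inv_U U_tilde_carrier)
  moreover have "u = u \<otimes> inv ?r \<otimes> ?r"
    using u r(2) U_tilde_carrier by (simp add: m_assoc)
  ultimately show "u \<in> HR_subgroup G \<pi>"
    unfolding HR_subgroup_def set_mult_def using r(1) by blast
qed

text \<open>The lift of the half turn e^(i pi) = -1 is central and has angle n pi.\<close>

lemma center_infinite_order: "\<exists>z\<in>Z. angle z \<noteq> 0"
proof -
  obtain r where r: "\<And>a. r a \<in> U" "\<And>a. \<pi> (r a) = scalar_rotation a"
      "\<And>a. angle (r a) = real CARD('n) * a"
    using rotation_lift by metis
  show ?thesis
    using r by (intro bexI[of _ "r pi"]) (auto simp: group_center_eq scalar_rotation_values U_tilde_carrier)
qed

end

section \<open>The group \<open>\<E>\<close>\<close>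

lemma (in group) central_subgroup_normal:
  assumes N: "subgroup N G" and central: "\<And>n g. n \<in> N \<Longrightarrow> g \<in> carrier G \<Longrightarrow> n \<otimes> g = g \<otimes> n"
  shows "N \<lhd> G"
proof (unfold normal_inv_iff, intro conjI ballI N)
  fix x h assume x: "x \<in> carrier G" and h: "h \<in> N"
  then have "x \<otimes> h \<otimes> inv x = h"
    using central[OF h x] subgroup.mem_carrier[OF N h] by (metis inv_solve_right m_closed)
  then show "x \<otimes> h \<otimes> inv x \<in> N" using h by simp
qed

context symplectic_cover
begin

abbreviation "GQ \<equiv> G \<times>\<times> HR_mod_H G \<pi>"
abbreviation "E \<equiv> E_group G \<pi>"

lemma U_closed:
  "u \<in> U \<Longrightarrow> v \<in> U \<Longrightarrow> u \<otimes> v \<in> U" "u \<in> U \<Longrightarrow> inv u \<in> U" "\<one> \<in> U"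
  using subgroup.m_closed[OF subgroup_U_tilde] subgroup.m_inv_closed[OF subgroup_U_tilde]
    subgroup.one_closed[OF subgroup_U_tilde] by blast+

lemma Z_closed:
  "u \<in> Z \<Longrightarrow> v \<in> Z \<Longrightarrow> u \<otimes> v \<in> Z" "u \<in> Z \<Longrightarrow> inv u \<in> Z" "\<one> \<in> Z"
  using subgroup.m_closed[OF subgroup_center] subgroup.m_inv_closed[OF subgroup_center]
    subgroup.one_closed[OF subgroup_center] by blast+

text \<open>\<open>H\<close> is the kernel of the homomorphism \<open>angle\<close> on
  \<open>U\<close>; this is the identification of HR/H with the real line.\<close>

lemma H_coset_eq_iff:
  assumes u: "u \<in> U" and v: "v \<in> U"
  shows "H #> u = H #> v \<longleftrightarrow> angle u = angle v"
proof
  assume "H #> u = H #> v"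
  then have "u \<in> H #> v" using rcos_self[OF U_tilde_carrier[OF u] subgroup_H] by simp
  then obtain h where "h \<in> H" "u = h \<otimes> v" by (auto simp: r_coset_def)
  then show "angle u = angle v" using v by (simp add: H_subgroup_eq angle_mult_U U_tilde_carrier)
next
  assume eq: "angle u = angle v"
  have "u \<otimes> inv v \<in> H"
    using u v eq U_closed by (simp add: H_subgroup_eq angle_mult_U angle_inv_U U_tilde_carrier)
  moreover have "u = (u \<otimes> inv v) \<otimes> v" using u v by (simp add: m_assoc U_tilde_carrier)
  ultimately have "u \<in> H #> v" unfolding r_coset_def by blast
  then show "H #> u = H #> v"
    using repr_independence[OF _ U_tilde_carrier[OF v] subgroup_H] by simp
qed

lemma normal_H: "H \<lhd> (G\<lparr>carrier := U\<rparr>)"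
proof (unfold group.normal_inv_iff[OF subgroup_imp_group[OF subgroup_U_tilde]], intro conjI ballI)
  show "subgroup H (G\<lparr>carrier := U\<rparr>)"
    by (rule subgroup_incl[OF subgroup_H subgroup_U_tilde]) (auto simp: H_subgroup_eq)
  fix x h assume x: "x \<in> carrier (G\<lparr>carrier := U\<rparr>)" and h: "h \<in> H"
  then have U: "x \<in> U" "h \<in> U" "angle h = 0" by (auto simp: H_subgroup_eq)
  then have "x \<otimes> h \<otimes> inv x \<in> H"
    using U_closed by (simp add: H_subgroup_eq angle_mult_U angle_inv_U U_tilde_carrier)
  then show "x \<otimes>\<^bsub>G\<lparr>carrier := U\<rparr>\<^esub> h \<otimes>\<^bsub>G\<lparr>carrier := U\<rparr>\<^esub> inv\<^bsub>G\<lparr>carrier := U\<rparr>\<^esub> x \<in> H"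
    using U(1) subgroup_U_tilde by simp
qed

lemma HR_mod_H_eq: "HR_mod_H G \<pi> = (G\<lparr>carrier := U\<rparr>) Mod H"
  by (simp add: HR_mod_H_def HR_subgroup_eq)

lemma group_HR_mod_H: "group (HR_mod_H G \<pi>)"
  unfolding HR_mod_H_eq by (rule normal.factorgroup_is_group[OF normal_H])

lemma HR_mod_H_carrier: "carrier (HR_mod_H G \<pi>) = (\<lambda>u. H #> u) ` U"
  by (auto simp: HR_mod_H_eq FactGroup_def RCOSETS_def r_coset_def)

lemma HR_mod_H_one: "\<one>\<^bsub>HR_mod_H G \<pi>\<^esub> = H #> \<one>"
  using coset_join2[OF one_closed subgroup_H subgroup.one_closed[OF subgroup_H]]
  by (simp add: HR_mod_H_eq)

lemma HR_mod_H_mult: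
  assumes "u \<in> U" "v \<in> U"
  shows "(H #> u) \<otimes>\<^bsub>HR_mod_H G \<pi>\<^esub> (H #> v) = H #> (u \<otimes> v)"
  using normal.rcos_sum[OF normal_H, of u v] assms
  by (simp add: HR_mod_H_eq r_coset_def set_mult_def)

lemma HR_mod_H_inv:
  assumes "u \<in> U"
  shows "inv\<^bsub>HR_mod_H G \<pi>\<^esub> (H #> u) = H #> inv u"
  by (rule group.inv_equality[OF group_HR_mod_H])
    (use assms U_closed U_tilde_carrier in \<open>auto simp: HR_mod_H_mult HR_mod_H_one HR_mod_H_carrier\<close>)

section \<open>The amalgamated product as a central quotient\<close>

lemma group_GQ: "group GQ"
  by (rule DirProd_group[OF group_axioms group_HR_mod_H])

lemma carrier_GQ: "carrier GQ = {(g, H #> u) | g u. g \<in> carrier G \<and> u \<in> U}"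
  by (auto simp: HR_mod_H_carrier DirProd_def)

lemma amalgam_eq: "amalgam G \<pi> = {(z, H #> inv z) | z. z \<in> Z}"
  unfolding amalgam_def iota_def Setcompr_eq_image
  by (intro image_cong refl) (simp add: HR_mod_H_inv center_U)

text \<open>Normality comes from centrality: \<open>z\<close> commutes with \<open>G\<close>, and
  its inverse commutes with all of \<open>U\<close>, so its class in HR/H is central too.\<close>

lemma normal_amalgam: "amalgam G \<pi> \<lhd> GQ"
proof (rule group.central_subgroup_normal[OF group_GQ])
  show "subgroup (amalgam G \<pi>) GQ"
  proof (rule group.subgroupI[OF group_GQ])
    show "amalgam G \<pi> \<subseteq> carrier GQ"
      unfolding amalgam_eq carrier_GQ using center_carrier center_U U_closed(2) by blast
    show "amalgam G \<pi> \<noteq> {}" using Z_closed(3) by (auto simp: amalgam_eq)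
    fix a assume "a \<in> amalgam G \<pi>"
    then obtain z where z: "z \<in> Z" "a = (z, H #> inv z)" by (auto simp: amalgam_eq)
    have Hz: "H #> inv z \<in> carrier (HR_mod_H G \<pi>)"
      using center_U[OF z(1)] U_closed(2) by (auto simp: HR_mod_H_carrier)
    have "inv\<^bsub>GQ\<^esub> a = (inv z, H #> inv (inv z))"
      unfolding z(2)
      using inv_DirProd[OF group_axioms group_HR_mod_H center_carrier[OF z(1)] Hz]
        HR_mod_H_inv[OF U_closed(2)[OF center_U[OF z(1)]]] by simp
    then show "inv\<^bsub>GQ\<^esub> a \<in> amalgam G \<pi>" using z Z_closed(2) by (auto simp: amalgam_eq)
    fix b assume "b \<in> amalgam G \<pi>"
    then obtain y where y: "y \<in> Z" "b = (y, H #> inv y)" by (auto simp: amalgam_eq)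
    have "inv z \<otimes> inv y = inv (z \<otimes> y)"
      using center_commute[OF y(1) center_carrier[OF z(1)]] y(1) z(1) by (metis center_carrier inv_mult_group)
    then have "a \<otimes>\<^bsub>GQ\<^esub> b = (z \<otimes> y, H #> inv (z \<otimes> y))"
      using y z center_U U_closed(2) by (simp add: HR_mod_H_mult)
    then show "a \<otimes>\<^bsub>GQ\<^esub> b \<in> amalgam G \<pi>" using y z Z_closed(1) by (auto simp: amalgam_eq)
  qed
  fix a p assume "a \<in> amalgam G \<pi>" "p \<in> carrier GQ"
  then obtain z g u where *: "z \<in> Z" "a = (z, H #> inv z)" "g \<in> carrier G" "u \<in> U" "p = (g, H #> u)"
    unfolding amalgam_eq carrier_GQ by blast
  then show "a \<otimes>\<^bsub>GQ\<^esub> p = p \<otimes>\<^bsub>GQ\<^esub> a"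
    using center_commute[of z g] center_commute[of "inv z" u] Z_closed(2) center_U U_closed(2) U_tilde_carrier
    by (simp add: HR_mod_H_mult)
qed

lemma group_E: "group E"
  unfolding E_group_def by (rule normal.factorgroup_is_group[OF normal_amalgam])

lemma theta_eq:
  assumes "g \<in> carrier G" "u \<in> U"
  shows "theta G \<pi> (g, H #> u) = {(z \<otimes> g, H #> (inv z \<otimes> u)) | z. z \<in> Z}"
proof -
  have "theta G \<pi> (g, H #> u) = (\<lambda>z. (z, H #> inv z) \<otimes>\<^bsub>GQ\<^esub> (g, H #> u)) ` Z"
    unfolding theta_def amalgam_eq r_coset_def[of GQ] by blast
  also have "\<dots> = (\<lambda>z. (z \<otimes> g, H #> (inv z \<otimes> u))) ` Z"
    by (intro image_cong refl) (simp add: HR_mod_H_mult center_U U_closed(2) assms(2))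
  finally show ?thesis by (simp only: Setcompr_eq_image)
qed

lemma carrier_E: "carrier E = theta G \<pi> ` carrier GQ"
  by (auto simp: E_group_def FactGroup_def RCOSETS_def theta_def)

lemma theta_hom: "theta G \<pi> \<in> hom GQ E"
  using normal.r_coset_hom_Mod[OF normal_amalgam] by (simp add: E_group_def theta_def[abs_def])

text \<open>The homomorphism from \<open>G\<close> to \<E> whose image of the preimage of
  \<open>L\<close> is the arising group. Its kernel consists of the central elements of angle 0, by
  \<open>tau_eq_iff\<close>.\<close>

definition tau :: "'g \<Rightarrow> ('g \<times> 'g set) set" where
  "tau g = theta G \<pi> (g, \<one>\<^bsub>HR_mod_H G \<pi>\<^esub>)"

lemma tau_hom: "tau \<in> hom G E"
proof (rule homI)
  have one: "\<one>\<^bsub>HR_mod_H G \<pi>\<^esub> \<in> carrier (HR_mod_H G \<pi>)"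
    using group_HR_mod_H by (simp add: group.is_monoid monoid.one_closed)
  show "tau g \<in> carrier E" if "g \<in> carrier G" for g
    using that one by (simp add: tau_def carrier_E)
  show "tau (g \<otimes> h) = tau g \<otimes>\<^bsub>E\<^esub> tau h" if "g \<in> carrier G" "h \<in> carrier G" for g h
    using hom_mult[OF theta_hom, of "(g, \<one>\<^bsub>HR_mod_H G \<pi>\<^esub>)" "(h, \<one>\<^bsub>HR_mod_H G \<pi>\<^esub>)"] that one
      group_HR_mod_H by (simp add: tau_def group.is_monoid monoid.l_one)
qed

sublocale tau: group_hom G E tau
  by (rule group_hom.intro[OF group_axioms group_E group_hom_axioms.intro[OF tau_hom]])

lemma tau_eq: "g \<in> carrier G \<Longrightarrow> tau g = {(z \<otimes> g, H #> inv z) | z. z \<in> Z}"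
  unfolding tau_def HR_mod_H_one theta_eq[OF _ U_closed(3)] Setcompr_eq_image
  by (intro image_cong refl) (simp add: center_carrier)

section \<open>Image in G/Z and angle as coordinates on \<E>\<close>

lemma normal_center: "Z \<lhd> G"
  by (rule central_subgroup_normal[OF subgroup_center center_commute])

lemma Z_coset_eq_iff:
  assumes "g \<in> carrier G" "h \<in> carrier G"
  shows "Z #> g = Z #> h \<longleftrightarrow> (\<exists>z\<in>Z. g = z \<otimes> h)"
proof
  assume "Z #> g = Z #> h"
  then have "g \<in> Z #> h" using rcos_self[OF assms(1) subgroup_center] by simp
  then show "\<exists>z\<in>Z. g = z \<otimes> h" by (auto simp: r_coset_def)
next
  assume "\<exists>z\<in>Z. g = z \<otimes> h"
  then have "g \<in> Z #> h" by (auto simp: r_coset_def)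
  then show "Z #> g = Z #> h" using repr_independence[OF _ assms(2) subgroup_center] by simp
qed

lemma angle_center_mult:
  assumes "z \<in> Z" "g \<in> carrier G"
  shows "angle (z \<otimes> g) = angle z + angle g"
  using angle_mult_U[OF assms(2) center_U[OF assms(1)]] center_commute[OF assms] by simp

lemma eta_theta:
  assumes "g \<in> carrier G" "u \<in> U"
  shows "eta G (theta G \<pi> (g, H #> u)) = Z #> g"
proof -
  have "Z #> (z \<otimes> g) = Z #> g" if "z \<in> Z" for z
    using that assms center_carrier[OF that] by (subst Z_coset_eq_iff) auto
  then have "(\<lambda>z. Z #> (z \<otimes> g)) ` Z = (\<lambda>z. Z #> g) ` Z" by (intro image_cong) auto
  then have "(\<lambda>(g, s). Z #> g) ` theta G \<pi> (g, H #> u) = {Z #> g}"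
    unfolding theta_eq[OF assms] using Z_closed(3) by (auto simp: Setcompr_eq_image image_image)
  then show ?thesis by (simp add: eta_def)
qed

lemma eta_tau: "g \<in> carrier G \<Longrightarrow> eta G (tau g) = Z #> g"
  unfolding tau_def HR_mod_H_one by (rule eta_theta[OF _ U_closed(3)])

text \<open>Serves both the right cosets \<open>Hu\<close> in HR/H, with \<open>u\<close> in
  \<open>U\<close>, and the left cosets \<open>gH\<close> in the space \<X>. The angle is constant
  on each, because the right factor is unitary and \<open>H\<close> has angle 0.\<close>

definition coset_angle :: "'g set \<Rightarrow> real" where
  "coset_angle s = the_elem (angle ` s)"

text \<open>Passing to another representative replaces \<open>g\<close> by \<open>z g\<close> and
  \<open>u\<close> by the inverse of \<open>z\<close> times \<open>u\<close>, which adds and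
  subtracts the same angle.\<close>

definition E_angle :: "('g \<times> 'g set) set \<Rightarrow> real" where
  "E_angle e = the_elem ((\<lambda>(g, s). angle g + coset_angle s) ` e)"

lemma angle_r_coset:
  assumes "u \<in> U"
  shows "coset_angle (H #> u) = angle u"
proof -
  have "angle ` (H #> u) = {angle u}"
    using assms subgroup.one_closed[OF subgroup_H]
    by (force simp: r_coset_def H_subgroup_eq angle_mult_U U_tilde_carrier)
  then show ?thesis by (simp add: coset_angle_def)
qed

lemma angle_l_coset:
  assumes "g \<in> carrier G"
  shows "coset_angle (g <# H) = angle g"
proof -
  have "angle ` (g <# H) = {angle g}"
    using assms subgroup.one_closed[OF subgroup_H]
    by (force simp: l_coset_def H_subgroup_eq angle_mult_U)
  then show ?thesis by (simp add: coset_angle_def)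
qed

lemma E_angle_theta:
  assumes "g \<in> carrier G" "u \<in> U"
  shows "E_angle (theta G \<pi> (g, H #> u)) = angle g + angle u"
proof -
  have "angle (z \<otimes> g) + coset_angle (H #> (inv z \<otimes> u)) = angle g + angle u" if "z \<in> Z" for z
    using that assms center_U[OF that] U_closed U_tilde_carrier
    by (simp add: angle_r_coset angle_center_mult angle_mult_U angle_inv_U)
  then have "(\<lambda>z. angle (z \<otimes> g) + coset_angle (H #> (inv z \<otimes> u))) ` Z = (\<lambda>z. angle g + angle u) ` Z"
    by (intro image_cong) auto
  then have "(\<lambda>(g, s). angle g + coset_angle s) ` theta G \<pi> (g, H #> u) = {angle g + angle u}"
    unfolding theta_eq[OF assms] using Z_closed(3) by (auto simp: Setcompr_eq_image image_image)
  then show ?thesis by (simp add: E_angle_def)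
qed

lemma E_angle_tau: "g \<in> carrier G \<Longrightarrow> E_angle (tau g) = angle g"
  unfolding tau_def HR_mod_H_one by (simp add: E_angle_theta U_closed(3))

text \<open>If g = z h with \<open>angle z = 0\<close>, then the inverse of \<open>z\<close> lies in
  \<open>H\<close>, so the amalgam element of \<open>z\<close> has trivial second component and
  moves (h, H) to (g, H).\<close>

lemma tau_eq_iff:
  assumes g: "g \<in> carrier G" and h: "h \<in> carrier G"
  shows "tau g = tau h \<longleftrightarrow> Z #> g = Z #> h \<and> angle g = angle h"
proof
  assume "tau g = tau h"
  then show "Z #> g = Z #> h \<and> angle g = angle h" using g h by (metis eta_tau E_angle_tau)
next
  assume *: "Z #> g = Z #> h \<and> angle g = angle h"
  then obtain z where z: "z \<in> Z" "g = z \<otimes> h" using g h Z_coset_eq_iff by blast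
  then have "angle z = 0" using * h by (simp add: angle_center_mult)
  have "H #> inv z = H #> \<one>"
    using z(1) \<open>angle z = 0\<close> by (subst H_coset_eq_iff) (auto simp: center_U U_closed angle_inv_U)
  then have "(g, H #> \<one>) \<in> tau h" unfolding tau_eq[OF h] using z by force
  then show "tau g = tau h"
    using group.repr_independence[OF group_GQ, of "(g, H #> \<one>)" "amalgam G \<pi>" "(h, H #> \<one>)"]
      normal.axioms(1)[OF normal_amalgam] h U_closed(3)
    unfolding tau_def theta_def HR_mod_H_one carrier_GQ by blast
qed

text \<open>Any other representative of \<open>tau g\<close> is (z g, H r) where \<open>r\<close>
  has the angle of the inverse of \<open>z\<close>. Moving the central \<open>z\<close> to the right
  gives z g x h r = g x (z h r), and z h r has angle 0, hence lies in \<open>H\<close>: the set in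
  \<open>E_action\<close> is a singleton.\<close>

lemma E_action_tau:
  assumes g: "g \<in> carrier G" and x: "x \<in> carrier G"
  shows "E_action G \<pi> (tau g) (x <# H) = (g \<otimes> x) <# H"
proof -
  have elt: "(a \<otimes> y \<otimes> r) <# H = (g \<otimes> x) <# H"
    if r: "r \<in> R_subgroup G \<pi>" and ar: "(a, H #> r) \<in> tau g" and y: "y \<in> x <# H" for a r y
  proof -
    obtain z where z: "z \<in> Z" "a = z \<otimes> g" "H #> r = H #> inv z"
      using ar unfolding tau_eq[OF g] by auto
    obtain h where h: "h \<in> H" "y = x \<otimes> h" using y by (auto simp: l_coset_def)
    have rU: "r \<in> U" using r R_subgroup_U by blast
    have zU: "z \<in> U" "inv z \<in> U" using center_U[OF z(1)] U_closed(2) by auto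
    have hU: "h \<in> U" "angle h = 0" using h(1) by (auto simp: H_subgroup_eq)
    note in_G = U_tilde_carrier[OF rU] U_tilde_carrier[OF zU(1)] U_tilde_carrier[OF hU(1)] g x
    have "angle r = - angle z" using z(3) rU zU by (simp add: H_coset_eq_iff angle_inv_U)
    then have k: "z \<otimes> h \<otimes> r \<in> H"
      using rU zU hU U_closed in_G by (simp add: H_subgroup_eq angle_mult_U)
    have "a \<otimes> y \<otimes> r = (g \<otimes> x) \<otimes> (z \<otimes> h \<otimes> r)"
    proof -
      have "z \<otimes> (g \<otimes> x) = (g \<otimes> x) \<otimes> z" using z(1) g x by (intro center_commute) auto
      moreover have "a \<otimes> y \<otimes> r = z \<otimes> (g \<otimes> x) \<otimes> h \<otimes> r"
        using in_G unfolding z(2) h(2) by (simp add: m_assoc)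
      ultimately show ?thesis using in_G by (simp add: m_assoc)
    qed
    then have "a \<otimes> y \<otimes> r \<in> (g \<otimes> x) <# H" using k by (auto simp: l_coset_def)
    then show ?thesis using l_repr_independence[OF _ _ subgroup_H] g x by simp
  qed
  have "(g \<otimes> x \<otimes> \<one>) <# H \<in> {(a \<otimes> y \<otimes> r) <# H | a r y. r \<in> R_subgroup G \<pi> \<and> (a, H #> r) \<in> tau g \<and> y \<in> x <# H}"
  proof -
    have "(g, H #> \<one>) \<in> tau g" unfolding tau_eq[OF g] using g Z_closed(3) by force
    moreover have "x \<in> x <# H" using x subgroup.one_closed[OF subgroup_H] by (force simp: l_coset_def)
    ultimately show ?thesis using one_R_subgroup by blast
  qed
  then have "{(a \<otimes> y \<otimes> r) <# H | a r y. r \<in> R_subgroup G \<pi> \<and> (a, H #> r) \<in> tau g \<and> y \<in> x <# H} =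
      {(g \<otimes> x) <# H}"
    using elt by blast
  then show ?thesis by (simp add: E_action_def)
qed

lemma siegel_action_coset:
  assumes g: "g \<in> carrier G" and x: "x \<in> carrier G"
  shows "siegel_action G (Z #> g) (x <# U) = (g \<otimes> x) <# U"
proof -
  have zg: "z \<otimes> g \<otimes> (x \<otimes> u) = g \<otimes> x \<otimes> (z \<otimes> u)" if "z \<in> Z" "u \<in> U" for z u
  proof -
    have "z \<otimes> (g \<otimes> x) = (g \<otimes> x) \<otimes> z" using that g x by (intro center_commute) auto
    then show ?thesis
      using that g x center_carrier[OF that(1)] U_tilde_carrier[OF that(2)] by (simp add: m_assoc[symmetric])
  qed
  have "(Z #> g) <#> (x <# U) = (g \<otimes> x) <# U"
  proof (intro subset_antisym subsetI)
    fix a assume "a \<in> (Z #> g) <#> (x <# U)"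
    then obtain z u where zu: "z \<in> Z" "u \<in> U" "a = z \<otimes> g \<otimes> (x \<otimes> u)"
      by (auto simp: set_mult_def r_coset_def l_coset_def)
    then have "a = g \<otimes> x \<otimes> (z \<otimes> u)" using zg by simp
    then show "a \<in> (g \<otimes> x) <# U" using U_closed(1)[OF center_U[OF zu(1)] zu(2)] by (auto simp: l_coset_def)
  next
    fix a assume "a \<in> (g \<otimes> x) <# U"
    then obtain u where u: "u \<in> U" "a = \<one> \<otimes> g \<otimes> (x \<otimes> u)"
      using g x U_tilde_carrier by (auto simp: l_coset_def m_assoc)
    then show "a \<in> (Z #> g) <#> (x <# U)"
      unfolding set_mult_def r_coset_def l_coset_def using Z_closed(3) by blast
  qed
  then show ?thesis by (simp add: siegel_action_def)
qed

end

section \<open>Discreteness, proper discontinuity and compactness\<close>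

lemma continuous_map_quotient_topology:
  "continuous_map X Y (f \<circ> q) \<Longrightarrow> continuous_map (quotient_topology X q) Y f"
  by (rule continuous_compose_quotient_map[OF quotient_map_quotient_topology])

lemma discrete_inI:
  assumes "S \<subseteq> topspace T" "\<And>x. x \<in> S \<Longrightarrow> \<exists>U. openin T U \<and> U \<inter> S = {x}"
  shows "discrete_in T S"
proof -
  have "discrete_topology S = subtopology T S"
    unfolding discrete_topology_unique openin_subtopology
  proof (intro conjI ballI)
    show "\<exists>U. openin T U \<and> {x} = U \<inter> S" if "x \<in> S" for x
      using assms(2)[OF that] by metis
  qed (use assms(1) in auto)
  then show ?thesis using assms(1) by (simp add: discrete_in_def)
qed

lemma discrete_inD:
  assumes "discrete_in T S" "x \<in> S"
  obtains U where "openin T U" "U \<inter> S = {x}"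
proof -
  have "openin (subtopology T S) {x}" using assms by (simp add: discrete_in_def)
  then show ?thesis using that by (auto simp: openin_subtopology)
qed

text \<open>The map \<open>f\<close> factors through the compact space \<open>Y\<close>. It is
  applied with \<open>X\<close> the group \<open>G\<close>, \<open>Y\<close> the coset space of
  \<open>L\<close>, and \<open>W\<close> an orbit space.\<close>

lemma compact_space_quotient_image:
  assumes q: "quotient_map X Y q" and f: "continuous_map X W f" "f ` topspace X = topspace W"
    and const: "\<And>x y. x \<in> topspace X \<Longrightarrow> y \<in> topspace X \<Longrightarrow> q x = q y \<Longrightarrow> f x = f y"
    and Y: "compact_space Y"
  shows "compact_space W"
proof -
  obtain g where g: "continuous_map Y W g" "g ` topspace Y = f ` topspace X"
    by (rule quotient_map_lift_exists[OF q f(1) const])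
  then show ?thesis using image_compactin[OF _ g(1), of "topspace Y"] Y f(2) by (simp add: compact_space_def)
qed

section \<open>PSp as a quotient of Sp\<close>

abbreviation sign_coset :: "('n::finite) real_2n_matrix \<Rightarrow> 'n real_2n_matrix set" where
  "sign_coset M \<equiv> {mat 1, - mat 1} #>\<^bsub>Sp\<^esub> M"

lemma sign_coset: "sign_coset M = {M, - M}"
  by (auto simp: r_coset_def)

lemma sign_coset_eq_iff: "sign_coset M = sign_coset N \<longleftrightarrow> M = N \<or> M = - N"
  unfolding sign_coset by (auto simp: doubleton_eq_iff)

lemma normal_signs: "{mat 1, - mat 1} \<lhd> (Sp :: ('n::finite) real_2n_matrix monoid)"
proof (rule group.central_subgroup_normal[OF group_Sp])
  have "Sp_inv (mat 1) = (mat 1 :: 'n real_2n_matrix)" "Sp_inv (- mat 1) = (- mat 1 :: 'n real_2n_matrix)"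
    by (simp_all add: Sp_inv_def transpose_mat)
  then show "subgroup {mat 1, - mat 1} (Sp :: 'n real_2n_matrix monoid)"
    by (intro group.subgroupI[OF group_Sp]) (auto simp: inv_Sp Sp_one Sp_uminus)
qed auto

lemma group_PSp: "group PSp"
  unfolding PSp_def by (rule normal.factorgroup_is_group[OF normal_signs])

lemma sign_coset_hom: "sign_coset \<in> hom Sp PSp"
  unfolding PSp_def by (rule normal.r_coset_hom_Mod[OF normal_signs])

lemma one_PSp: "\<one>\<^bsub>PSp\<^esub> = sign_coset (mat 1)"
  by (simp add: PSp_def sign_coset)

lemma carrier_PSp: "carrier PSp = sign_coset ` carrier Sp"
  by (auto simp: PSp_def FactGroup_def RCOSETS_def)

lemma quotient_map_sign_coset: "quotient_map (top_of_set (carrier Sp)) PSp_topology sign_coset"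
  unfolding PSp_topology_def rcoset_topology_def by (rule quotient_map_quotient_topology)

lemma norm_matrix_square:
  fixes M :: "real^'n^'m"
  shows "(norm M)\<^sup>2 = trace (M ** transpose M)"
  by (simp add: norm_vec_def[of M] L2_set_def sum_nonneg trace_def matrix_mult_transpose_dot_row row_def
      power2_norm_eq_inner)

text \<open>The squared norm is tr (M M^T), which does not see an orthogonal right factor; so the
  norm of \<open>\<pi> g\<close> depends only on the coset \<open>gU\<close>.\<close>

lemma norm_mult_U:
  assumes "u \<in> U_subgroup"
  shows "norm (M ** u) = norm M"
proof -
  have "u ** transpose u = mat 1" using assms by (simp add: mem_U_subgroup matrix_left_right_inverse)
  then have "M ** (u ** transpose u) ** transpose M = M ** transpose M" by simp
  then have "M ** u ** transpose (M ** u) = M ** transpose M"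
    by (simp only: matrix_mul_assoc matrix_transpose_mul)
  then have "(norm (M ** u))\<^sup>2 = (norm M)\<^sup>2" by (simp only: norm_matrix_square)
  then show ?thesis by simp
qed

section \<open>Continuous invariants on coset spaces and on \<E>\<close>

context symplectic_cover
begin

lemma topspace_lcoset_space: "topspace (lcoset_space G V) = (\<lambda>g. g <# V) ` carrier G"
  by (simp add: lcoset_space_def topspace_quotient_topology)

lemma quotient_map_lcoset: "quotient_map (top_of_set (carrier G)) (lcoset_space G V) (\<lambda>g. g <# V)"
  unfolding lcoset_space_def by (rule quotient_map_quotient_topology)

definition coset_norm :: "'g set \<Rightarrow> real" where
  "coset_norm S = the_elem ((\<lambda>g. norm (\<pi> g)) ` S)"

lemma coset_norm:
  assumes V: "subgroup V G" "V \<subseteq> U" and x: "x \<in> carrier G"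
  shows "coset_norm (x <# V) = norm (\<pi> x)"
proof -
  have "norm (\<pi> (x \<otimes> v)) = norm (\<pi> x)" if "v \<in> V" for v
    using that V(2) x by (auto simp: mem_U_tilde norm_mult_U)
  then have "(\<lambda>v. norm (\<pi> (x \<otimes> v))) ` V = (\<lambda>v. norm (\<pi> x)) ` V" by (intro image_cong) auto
  moreover have "(\<lambda>g. norm (\<pi> g)) ` (x <# V) = (\<lambda>v. norm (\<pi> (x \<otimes> v))) ` V"
    by (auto simp: l_coset_def)
  ultimately have "(\<lambda>g. norm (\<pi> g)) ` (x <# V) = {norm (\<pi> x)}"
    using subgroup.one_closed[OF V(1)] by auto
  then show ?thesis by (simp add: coset_norm_def)
qed

text \<open>A compact set of cosets is not lifted to a compact subset of \<open>G\<close>. Instead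
  the norm descends to a continuous function on the coset space, which is bounded on
  \<open>K\<close>.\<close>

lemma compact_coset_norm_bounded:
  assumes V: "subgroup V G" "V \<subseteq> U" and K: "compactin (lcoset_space G V) K"
  obtains R where "\<And>x. x \<in> carrier G \<Longrightarrow> x <# V \<in> K \<Longrightarrow> norm (\<pi> x) \<le> R"
proof -
  have "continuous_map (top_of_set (carrier G)) euclideanreal (\<lambda>g. norm (\<pi> g))"
    by (simp add: continuous_on_norm continuous_on_cover)
  then have "continuous_map (top_of_set (carrier G)) euclideanreal (coset_norm \<circ> (\<lambda>g. g <# V))"
    by (rule continuous_map_eq) (simp add: coset_norm[OF V])
  then have "continuous_map (lcoset_space G V) euclideanreal coset_norm"
    unfolding lcoset_space_def by (rule continuous_map_quotient_topology)
  then have "compactin euclideanreal (coset_norm ` K)" by (rule image_compactin[OF K])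
  then have "compact (coset_norm ` K)" by simp
  then obtain R where "\<And>s. s \<in> K \<Longrightarrow> norm (coset_norm s) \<le> R"
    using compact_imp_bounded bounded_iff by (metis imageI)
  then show ?thesis using coset_norm[OF V] by (intro that[of R]) force
qed

text \<open>The angle is not additive under left translation by a general \<open>g\<close>, so the
  translated function gets its own continuity statement.\<close>

lemma continuous_map_coset_angle:
  assumes g: "g \<in> carrier G"
  shows "continuous_map (lcoset_space G H) euclideanreal (\<lambda>s. coset_angle (g <# s))"
proof -
  have "continuous_on (carrier G) (\<lambda>x. angle (g \<otimes> x))"
    using g by (intro continuous_on_compose2[OF continuous_on_angle] continuous_on_G_mult) auto
  then have "continuous_map (top_of_set (carrier G)) euclideanreal (\<lambda>x. angle (g \<otimes> x))" by simp
  then have "continuous_map (top_of_set (carrier G)) euclideanreal ((\<lambda>s. coset_angle (g <# s)) \<circ> (\<lambda>g. g <# H))"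
    by (rule continuous_map_eq)
      (use g in \<open>simp add: lcos_m_assoc subgroup.subset[OF subgroup_H] angle_l_coset\<close>)
  then show ?thesis unfolding lcoset_space_def by (rule continuous_map_quotient_topology)
qed

lemma topspace_E: "topspace (E_topology G \<pi>) = carrier E"
  by (simp add: E_topology_def topspace_quotient_topology HR_mod_H_topology_def rcoset_topology_def
      carrier_E HR_mod_H_carrier HR_subgroup_eq DirProd_def)

lemma continuous_map_HR_mod_H_angle: "continuous_map (HR_mod_H_topology G \<pi>) euclideanreal coset_angle"
  unfolding HR_mod_H_topology_def rcoset_topology_def
proof (rule continuous_map_quotient_topology)
  have "continuous_on U angle"
    by (rule continuous_on_subset[OF continuous_on_angle]) (auto simp: mem_U_tilde)
  then have "continuous_map (top_of_set (HR_subgroup G \<pi>)) euclideanreal angle"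
    by (simp add: HR_subgroup_eq)
  then show "continuous_map (top_of_set (HR_subgroup G \<pi>)) euclideanreal (coset_angle \<circ> (\<lambda>g. H #> g))"
    by (rule continuous_map_eq) (simp add: HR_subgroup_eq angle_r_coset)
qed

lemma topspace_HR_mod_H: "topspace (HR_mod_H_topology G \<pi>) = (\<lambda>u. H #> u) ` U"
  by (simp add: HR_mod_H_topology_def rcoset_topology_def topspace_quotient_topology HR_subgroup_eq)

lemma continuous_map_E_angle: "continuous_map (E_topology G \<pi>) euclideanreal E_angle"
  unfolding E_topology_def
proof (rule continuous_map_quotient_topology)
  let ?P = "prod_topology (top_of_set (carrier G)) (HR_mod_H_topology G \<pi>)"
  have "continuous_map (top_of_set (carrier G)) euclideanreal angle" by (simp add: continuous_on_angle)
  then have "continuous_map ?P euclideanreal (\<lambda>x. angle (fst x) + coset_angle (snd x))"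
    by (intro continuous_map_add continuous_map_compose[OF continuous_map_fst, unfolded o_def]
        continuous_map_compose[OF continuous_map_snd continuous_map_HR_mod_H_angle, unfolded o_def])
  then show "continuous_map ?P euclideanreal (E_angle \<circ> theta G \<pi>)"
    by (rule continuous_map_eq) (auto simp: topspace_HR_mod_H E_angle_theta angle_r_coset)
qed

lemma continuous_map_eta: "continuous_map (E_topology G \<pi>) (G_mod_center_topology G) (eta G)"
  unfolding E_topology_def
proof (rule continuous_map_quotient_topology)
  let ?P = "prod_topology (top_of_set (carrier G)) (HR_mod_H_topology G \<pi>)"
  have "continuous_map (top_of_set (carrier G)) (G_mod_center_topology G) (\<lambda>g. Z #> g)"
    unfolding G_mod_center_topology_def rcoset_topology_def
    by (rule quotient_imp_continuous_map[OF quotient_map_quotient_topology])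
  then have "continuous_map ?P (G_mod_center_topology G) (\<lambda>x. Z #> fst x)"
    by (rule continuous_map_compose[OF continuous_map_fst, unfolded o_def])
  then show "continuous_map ?P (G_mod_center_topology G) (eta G \<circ> theta G \<pi>)"
    by (rule continuous_map_eq) (auto simp: topspace_HR_mod_H eta_theta)
qed

text \<open>The center is the full preimage of {1, -1}, so this is the identification of G/Z with
  PSp.\<close>

lemma Z_coset_eq_iff_sign:
  assumes "g \<in> carrier G" "h \<in> carrier G"
  shows "Z #> g = Z #> h \<longleftrightarrow> sign_coset (\<pi> g) = sign_coset (\<pi> h)"
proof -
  have inv_h: "\<pi> h ** Sp_inv (\<pi> h) = mat 1" "Sp_inv (\<pi> h) ** \<pi> h = mat 1"
    using Sp_inv[OF cover_in[OF assms(2)]] by auto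
  have "(\<exists>z\<in>Z. g = z \<otimes> h) \<longleftrightarrow> g \<otimes> inv h \<in> Z"
    using assms center_carrier by (metis inv_closed inv_solve_right m_closed inv_solve_right')
  also have "\<dots> \<longleftrightarrow> \<pi> g ** Sp_inv (\<pi> h) = mat 1 \<or> \<pi> g ** Sp_inv (\<pi> h) = - mat 1"
    using assms by (simp add: group_center_eq)
  also have "\<dots> \<longleftrightarrow> \<pi> g = \<pi> h \<or> \<pi> g = - \<pi> h"
  proof -
    have "\<pi> g ** Sp_inv (\<pi> h) = A \<longleftrightarrow> \<pi> g = A ** \<pi> h" for A
    proof
      assume "\<pi> g ** Sp_inv (\<pi> h) = A"
      then have "A ** \<pi> h = \<pi> g ** (Sp_inv (\<pi> h) ** \<pi> h)" by (simp add: matrix_mul_assoc)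
      then show "\<pi> g = A ** \<pi> h" using inv_h by simp
    next
      assume "\<pi> g = A ** \<pi> h"
      then have "\<pi> g ** Sp_inv (\<pi> h) = A ** (\<pi> h ** Sp_inv (\<pi> h))" by (simp add: matrix_mul_assoc)
      then show "\<pi> g ** Sp_inv (\<pi> h) = A" using inv_h by simp
    qed
    then show ?thesis by simp
  qed
  finally show ?thesis unfolding Z_coset_eq_iff[OF assms] sign_coset_eq_iff .
qed

end

section \<open>The preimages of the lattice in Sp and in G\<close>

locale arising_lattice = symplectic_cover G \<pi>
  for G :: "'g::topological_space monoid" (structure) and \<pi> :: "'g \<Rightarrow> ('n::finite) real_2n_matrix" +
  fixes L :: "'n real_2n_matrix set set"
  assumes lattice: "cocompact_lattice_in PSp PSp_topology L"
    and torsion_free_L: "torsion_free PSp L"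
begin

text \<open>The intermediate preimage in matrices, where the norm is available and bounded closed
  sets are compact.\<close>

definition L_hat :: "'n real_2n_matrix set" where
  "L_hat = {M \<in> carrier Sp. sign_coset M \<in> L}"

definition L_lift :: "'g set" where
  "L_lift = {g \<in> carrier G. sign_coset (\<pi> g) \<in> L}"

lemma subgroup_L: "subgroup L PSp" and discrete_L: "discrete_in PSp_topology L"
  and cocompact_L: "compact_space (rcoset_topology PSp PSp_topology L)"
  using lattice by (auto simp: cocompact_lattice_in_def lattice_in_def)

lemma sign_coset_in: "g \<in> carrier G \<Longrightarrow> sign_coset (\<pi> g) \<in> carrier PSp"
  by (simp add: carrier_PSp)

lemma sign_cover_hom: "(\<lambda>g. sign_coset (\<pi> g)) \<in> hom G PSp"
  using Group.hom_compose[OF cover_hom sign_coset_hom] by (simp add: o_def)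

sublocale sign: group_hom G PSp "\<lambda>g. sign_coset (\<pi> g)"
  by (rule group_hom.intro[OF group_axioms group_PSp group_hom_axioms.intro[OF sign_cover_hom]])

lemma subgroup_L_lift: "subgroup L_lift G"
proof (rule subgroupI)
  have "\<one> \<in> L_lift"
    using subgroup.one_closed[OF subgroup_L] sign.hom_one by (simp add: L_lift_def)
  then show "L_lift \<noteq> {}" by blast
  show "inv a \<in> L_lift" if "a \<in> L_lift" for a
    using that subgroup.m_inv_closed[OF subgroup_L] sign.hom_inv[of a] by (simp add: L_lift_def)
  show "a \<otimes> b \<in> L_lift" if "a \<in> L_lift" "b \<in> L_lift" for a b
    using that subgroup.m_closed[OF subgroup_L] sign.hom_mult[of a b] by (simp add: L_lift_def)
qed (auto simp: L_lift_def)

lemma L_lift_carrier: "g \<in> L_lift \<Longrightarrow> g \<in> carrier G"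
  by (simp add: L_lift_def)

lemma center_L_lift: "z \<in> Z \<Longrightarrow> z \<in> L_lift"
proof -
  assume z: "z \<in> Z"
  then have "sign_coset (\<pi> z) = \<one>\<^bsub>PSp\<^esub>"
    unfolding one_PSp sign_coset_eq_iff by (auto simp: group_center_eq)
  then show "z \<in> L_lift" using z subgroup.one_closed[OF subgroup_L] by (simp add: L_lift_def center_carrier)
qed

lemma arising_from_eq: "arising_from G \<pi> L = tau ` L_lift"
  by (auto simp: arising_from_def tau_def L_lift_def)

lemma torsion_L_lift:
  assumes g: "g \<in> L_lift" and k: "k > 0" and z: "g [^] (k::nat) \<in> Z"
  shows "g \<in> Z"
proof -
  have gG: "g \<in> carrier G" by (rule L_lift_carrier[OF g])
  have "sign_coset (\<pi> g) [^]\<^bsub>PSp\<^esub> k = sign_coset (\<pi> (g [^] k))" using sign.hom_nat_pow[OF gG] by simp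
  also have "\<dots> = \<one>\<^bsub>PSp\<^esub>"
    using z unfolding one_PSp sign_coset_eq_iff by (auto simp: group_center_eq)
  finally have "sign_coset (\<pi> g) = \<one>\<^bsub>PSp\<^esub>"
    using torsion_free_L g k unfolding torsion_free_def L_lift_def by blast
  then show "g \<in> Z" using gG unfolding one_PSp sign_coset_eq_iff by (simp add: group_center_eq)
qed

text \<open>Discreteness in PSp isolates only the pair {1, -1}; the radius is also kept below the
  distance from -1 to 1.\<close>

lemma L_hat_separated: "\<exists>e>0. \<forall>M\<in>L_hat. dist M (mat 1) < e \<longrightarrow> M = mat 1"
proof -
  have one: "sign_coset (mat 1) \<in> L" using subgroup.one_closed[OF subgroup_L] by (simp add: one_PSp)
  obtain W where W: "openin PSp_topology W" "W \<inter> L = {sign_coset (mat 1)}"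
    using discrete_inD[OF discrete_L one] by blast
  have "open_Sp {M \<in> topspace (top_of_set (carrier Sp)). sign_coset M \<in> W}"
    by (rule openin_continuous_map_preimage[OF quotient_imp_continuous_map[OF quotient_map_sign_coset] W(1)])
  moreover have "mat 1 \<in> {M \<in> topspace (top_of_set (carrier Sp)). sign_coset M \<in> W}"
    using W(2) Sp_one by auto
  ultimately obtain e where e: "e > 0" "ball (mat 1) e \<inter> carrier Sp \<subseteq> {M \<in> carrier Sp. sign_coset M \<in> W}"
    unfolding openin_contains_ball by auto
  have "(mat 1 :: 'n real_2n_matrix) \<noteq> - mat 1"
  proof
    assume "(mat 1 :: 'n real_2n_matrix) = - mat 1"
    from arg_cong[OF this, of "\<lambda>A. A $ undefined $ undefined"] show False by (simp add: mat_def)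
  qed
  then have d: "dist (- mat 1) (mat 1 :: 'n real_2n_matrix) > 0" by (metis zero_less_dist_iff)
  have "M = mat 1" if "M \<in> L_hat" "dist M (mat 1) < min e (dist (- mat 1) (mat 1 :: 'n real_2n_matrix))" for M
  proof -
    have "M \<in> ball (mat 1) e \<inter> carrier Sp" using that by (simp add: L_hat_def dist_commute)
    then have "sign_coset M \<in> W" using e(2) by blast
    then have "sign_coset M = sign_coset (mat 1)" using that(1) W(2) by (auto simp: L_hat_def)
    then have "M = mat 1 \<or> M = - mat 1" by (simp only: sign_coset_eq_iff)
    then show ?thesis using that(2) by auto
  qed
  then show ?thesis using e(1) d by (intro exI[of _ "min e (dist (- mat 1) (mat 1 :: 'n real_2n_matrix))"]) auto
qed

lemma L_hat_quotient:
  assumes "M \<in> L_hat" "N \<in> L_hat"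
  shows "Sp_inv M ** N \<in> L_hat"
proof -
  obtain g h where gh: "g \<in> carrier G" "h \<in> carrier G" "\<pi> g = M" "\<pi> h = N"
    using assms cover_surj unfolding L_hat_def by (metis (no_types, lifting) imageE mem_Collect_eq)
  then have "g \<in> L_lift" "h \<in> L_lift" using assms by (auto simp: L_hat_def L_lift_def)
  then have "inv g \<otimes> h \<in> L_lift"
    by (intro subgroup.m_closed[OF subgroup_L_lift] subgroup.m_inv_closed[OF subgroup_L_lift])
  then show ?thesis using gh assms by (simp add: L_hat_def L_lift_def Sp_mult Sp_inv_in)
qed

text \<open>An infinite bounded part would accumulate at a point of the closed set
  \<open>Sp\<close>. Two distinct elements \<open>M\<close>, \<open>N\<close> near that point have
  M^(-1) N close to 1, against \<open>L_hat_separated\<close>.\<close>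

lemma finite_L_hat_bounded:
  assumes "bounded B"
  shows "finite (L_hat \<inter> B)"
proof (rule ccontr)
  assume inf: "infinite (L_hat \<inter> B)"
  have "compact (carrier Sp \<inter> closure B)"
    by (intro closed_Int_compact closed_Sp) (simp add: assms)
  moreover have "L_hat \<inter> B \<subseteq> carrier Sp \<inter> closure B"
    using closure_subset by (auto simp: L_hat_def)
  ultimately obtain p where p: "p \<in> carrier Sp" "p islimpt (L_hat \<inter> B)"
    using Heine_Borel_imp_Bolzano_Weierstrass[OF _ inf] by blast
  obtain e where e: "e > 0" "\<And>M. M \<in> L_hat \<Longrightarrow> dist M (mat 1) < e \<Longrightarrow> M = mat 1"
    using L_hat_separated by blast
  have "continuous_on UNIV (\<lambda>x :: 'n real_2n_matrix \<times> 'n real_2n_matrix. Sp_inv (fst x) ** snd x)"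
    by (intro continuous_intros)
  then obtain d where d: "d > 0" "\<And>x. dist x (p, p) < d \<Longrightarrow> dist (Sp_inv (fst x) ** snd x) (Sp_inv p ** p) < e"
    unfolding continuous_on_iff using e(1) by (metis UNIV_I fst_conv snd_conv)
  have "infinite ((L_hat \<inter> B) \<inter> ball p (d / 2))"
    using p(2) d(1) by (simp add: islimpt_eq_infinite_ball)
  then have "\<exists>M\<in>(L_hat \<inter> B) \<inter> ball p (d / 2). \<exists>N\<in>(L_hat \<inter> B) \<inter> ball p (d / 2). M \<noteq> N"
    by (metis finite.simps is_singletonI' is_singleton_def)
  then obtain M N where MN: "M \<in> L_hat" "N \<in> L_hat" "dist p M < d / 2" "dist p N < d / 2" "M \<noteq> N"
    by auto
  have "dist (M, N) (p, p) \<le> dist M p + dist N p"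
    unfolding dist_Pair_Pair by (simp add: sqrt_sum_squares_le_sum)
  also have "\<dots> < d" using MN by (simp add: dist_commute)
  finally have "dist (Sp_inv M ** N) (mat 1) < e" using d(2)[of "(M, N)"] by (simp add: Sp_inv[OF p(1)])
  then have "Sp_inv M ** N = mat 1" by (intro e(2) L_hat_quotient MN)
  then have "M ** (Sp_inv M ** N) = M" by simp
  then have "N = M" using MN(1) by (simp add: L_hat_def matrix_mul_assoc Sp_inv)
  then show False using MN(5) by simp
qed

text \<open>If both x V and g x V lie in \<open>K\<close>, then \<pi>(x) and \<pi>(g x) are bounded,
  and so is \<pi>(g) = \<pi>(g x) \<pi>(x)^(-1). Only the images in \<open>Sp\<close> are shown to
  be finite in number; the fibres of \<open>\<pi>\<close> are treated separately.\<close>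

lemma finite_displacement:
  assumes V: "subgroup V G" "V \<subseteq> U" and K: "compactin (lcoset_space G V) K"
  shows "finite {\<pi> g | g. g \<in> L_lift \<and> (\<exists>x\<in>carrier G. x <# V \<in> K \<and> (g \<otimes> x) <# V \<in> K)}" (is "finite ?D")
proof -
  obtain R where R: "\<And>x. x \<in> carrier G \<Longrightarrow> x <# V \<in> K \<Longrightarrow> norm (\<pi> x) \<le> R"
    using compact_coset_norm_bounded[OF V K] by blast
  let ?B = "(\<lambda>(A, B). A ** Sp_inv B) ` (cball 0 R \<times> cball (0 :: 'n real_2n_matrix) R)"
  have "compact ?B"
    by (intro compact_continuous_image compact_Times compact_cball)
      (auto simp: case_prod_unfold intro!: continuous_intros)
  then have "finite (L_hat \<inter> ?B)" by (intro finite_L_hat_bounded compact_imp_bounded)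
  moreover have "?D \<subseteq> L_hat \<inter> ?B"
  proof clarify
    fix g x assume g: "g \<in> L_lift" and x: "x \<in> carrier G" "x <# V \<in> K" "g \<otimes> x <# V \<in> K"
    have gG: "g \<in> carrier G" by (rule L_lift_carrier[OF g])
    have "norm (\<pi> (g \<otimes> x)) \<le> R" "norm (\<pi> x) \<le> R" using R x gG m_closed by blast+
    then have "(\<pi> (g \<otimes> x), \<pi> x) \<in> cball 0 R \<times> cball 0 R" by (simp del: cover_mult)
    moreover have "\<pi> g = \<pi> (g \<otimes> x) ** Sp_inv (\<pi> x)"
      using gG x(1) Sp_inv(2)[OF cover_in[OF x(1)]] by (simp add: matrix_mul_assoc[symmetric])
    ultimately have "\<pi> g \<in> ?B" by (metis (mono_tags, lifting) case_prod_conv image_eqI)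
    moreover have "\<pi> g \<in> L_hat" using g by (simp add: L_lift_def L_hat_def)
    ultimately show "\<pi> g \<in> L_hat \<inter> ?B" by blast
  qed
  ultimately show ?thesis by (rule finite_subset[rotated])
qed

text \<open>The orbit map on \<open>G\<close> factors through the compact space of cosets of
  \<open>L\<close> in PSp: if \<open>x\<close> and \<open>y\<close> have the same coset, then x
  y^(-1) lies in \<open>L_lift\<close> and the orbits agree. The coset space and the action are left
  general so as to cover both \<X> and the Siegel space.\<close>

lemma cocompact_action_lcoset:
  fixes A :: "('a, 'm) monoid_scheme"
  assumes A: "carrier A = a ` L_lift"
    and act: "\<And>l x. l \<in> L_lift \<Longrightarrow> x \<in> carrier G \<Longrightarrow> act (a l) (x <# V) = (l \<otimes> x) <# V"
  shows "cocompact_action A (lcoset_space G V) act"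
  unfolding cocompact_action_def
proof (rule compact_space_quotient_image[OF _ _ _ _ cocompact_L])
  let ?q = "\<lambda>b. L #>\<^bsub>PSp\<^esub> b"
  have "quotient_map (top_of_set (carrier G)) PSp_topology (sign_coset \<circ> \<pi>)"
    by (rule quotient_map_compose[OF quotient_map_cover quotient_map_sign_coset])
  then show "quotient_map (top_of_set (carrier G)) (rcoset_topology PSp PSp_topology L) (?q \<circ> (sign_coset \<circ> \<pi>))"
    unfolding rcoset_topology_def by (rule quotient_map_compose[OF _ quotient_map_quotient_topology])
  let ?f = "orbit A act \<circ> (\<lambda>g. g <# V)"
  have "quotient_map (top_of_set (carrier G)) (quotient_topology (lcoset_space G V) (orbit A act)) ?f"
    by (rule quotient_map_compose[OF quotient_map_lcoset quotient_map_quotient_topology])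
  then show "continuous_map (top_of_set (carrier G)) (quotient_topology (lcoset_space G V) (orbit A act)) ?f"
    and "?f ` topspace (top_of_set (carrier G)) = topspace (quotient_topology (lcoset_space G V) (orbit A act))"
    by (rule quotient_imp_continuous_map, rule quotient_imp_surjective_map)
  have orb: "?f x = {(l \<otimes> x) <# V | l. l \<in> L_lift}" if "x \<in> carrier G" for x
    unfolding orbit_def A using act that by auto
  fix x y assume "x \<in> topspace (top_of_set (carrier G))" "y \<in> topspace (top_of_set (carrier G))"
    and eq: "(?q \<circ> (sign_coset \<circ> \<pi>)) x = (?q \<circ> (sign_coset \<circ> \<pi>)) y"
  then have xy: "x \<in> carrier G" "y \<in> carrier G" by auto
  have "sign_coset (\<pi> x) \<in> L #>\<^bsub>PSp\<^esub> sign_coset (\<pi> y)"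
    using group.rcos_self[OF group_PSp sign_coset_in[OF xy(1)] subgroup_L] eq by simp
  then obtain b where b: "b \<in> L" "sign_coset (\<pi> x) = b \<otimes>\<^bsub>PSp\<^esub> sign_coset (\<pi> y)"
    by (auto simp: r_coset_def)
  have "sign_coset (\<pi> (x \<otimes> inv y)) = sign_coset (\<pi> x) \<otimes>\<^bsub>PSp\<^esub> inv\<^bsub>PSp\<^esub> sign_coset (\<pi> y)"
    using sign.hom_mult[OF xy(1) inv_closed[OF xy(2)]] sign.hom_inv[OF xy(2)] by simp
  also have "\<dots> = b"
    using b sign_coset_in[OF xy(2)] subgroup.mem_carrier[OF subgroup_L b(1)] group_PSp
    by (simp add: group.inv_solve_right' sign.H.m_assoc)
  finally have l: "x \<otimes> inv y \<in> L_lift" using b(1) xy by (simp add: L_lift_def)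
  have "{(m \<otimes> x) <# V | m. m \<in> L_lift} = {(m \<otimes> y) <# V | m. m \<in> L_lift}"
  proof (intro subset_antisym subsetI; clarify)
    fix m assume m: "m \<in> L_lift"
    have "m \<otimes> x = (m \<otimes> (x \<otimes> inv y)) \<otimes> y" using m xy by (simp add: m_assoc L_lift_carrier)
    then show "\<exists>m'. m \<otimes> x <# V = m' \<otimes> y <# V \<and> m' \<in> L_lift"
      using subgroup.m_closed[OF subgroup_L_lift m l] by metis
    have "m \<otimes> y = (m \<otimes> inv (x \<otimes> inv y)) \<otimes> x"
      using m xy by (simp add: m_assoc L_lift_carrier inv_mult_group)
    then show "\<exists>m'. m \<otimes> y <# V = m' \<otimes> x <# V \<and> m' \<in> L_lift"
      using subgroup.m_closed[OF subgroup_L_lift m subgroup.m_inv_closed[OF subgroup_L_lift l]] by metis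
  qed
  then show "?f x = ?f y" by (simp only: orb xy)
qed

section \<open>Discreteness and torsion\<close>

lemma eta_image: "eta G ` tau ` L_lift = (\<lambda>g. Z #> g) ` L_lift"
  using eta_tau L_lift_carrier by (auto simp: image_image intro!: image_cong)

lemma group_mod_center: "group (G_mod_center G)"
  unfolding G_mod_center_def by (rule normal.factorgroup_is_group[OF normal_center])

lemma Z_coset_pow:
  assumes "g \<in> carrier G"
  shows "(Z #> g) [^]\<^bsub>G_mod_center G\<^esub> (k::nat) = Z #> (g [^] k)"
  using hom_nat_pow[OF normal.r_coset_hom_Mod[OF normal_center] assms group_axioms] group_mod_center
  by (simp add: G_mod_center_def)

lemma one_mod_center: "\<one>\<^bsub>G_mod_center G\<^esub> = Z"
  by (simp add: G_mod_center_def)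

lemma Z_coset_eq_center: "g \<in> carrier G \<Longrightarrow> Z #> g = Z \<longleftrightarrow> g \<in> Z"
  using coset_join1[OF _ _ subgroup_center] coset_join2[OF _ subgroup_center] by blast

text \<open>An open set of PSp isolating a point of \<open>L\<close> is pulled back to
  \<open>G\<close>. The pullback is a union of Z-cosets, so its image in G/Z is open and isolates
  the corresponding coset.\<close>

lemma discrete_eta: "discrete_in (G_mod_center_topology G) ((\<lambda>g. Z #> g) ` L_lift)"
proof (rule discrete_inI)
  show "(\<lambda>g. Z #> g) ` L_lift \<subseteq> topspace (G_mod_center_topology G)"
    by (auto simp: G_mod_center_topology_def rcoset_topology_def topspace_quotient_topology L_lift_carrier)
  fix a assume "a \<in> (\<lambda>g. Z #> g) ` L_lift"
  then obtain g where g: "g \<in> L_lift" "a = Z #> g" by blast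
  have gG: "g \<in> carrier G" by (rule L_lift_carrier[OF g(1)])
  have "sign_coset (\<pi> g) \<in> L" using g(1) by (simp add: L_lift_def)
  then obtain W where W: "openin PSp_topology W" "W \<inter> L = {sign_coset (\<pi> g)}"
    using discrete_inD[OF discrete_L] by blast
  let ?W = "(\<lambda>h. Z #> h) ` {h \<in> carrier G. sign_coset (\<pi> h) \<in> W}"
  have "quotient_map (top_of_set (carrier G)) PSp_topology (sign_coset \<circ> \<pi>)"
    by (rule quotient_map_compose[OF quotient_map_cover quotient_map_sign_coset])
  from openin_continuous_map_preimage[OF quotient_imp_continuous_map[OF this] W(1)]
  have "open_G {h \<in> carrier G. sign_coset (\<pi> h) \<in> W}" by simp
  moreover have "{h \<in> carrier G. Z #> h \<in> ?W} = {h \<in> carrier G. sign_coset (\<pi> h) \<in> W}"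
  proof (intro subset_antisym subsetI)
    fix h assume "h \<in> {h \<in> carrier G. Z #> h \<in> ?W}"
    then obtain l where "h \<in> carrier G" "l \<in> carrier G" "sign_coset (\<pi> l) \<in> W" "Z #> h = Z #> l"
      by blast
    then show "h \<in> {h \<in> carrier G. sign_coset (\<pi> h) \<in> W}" using Z_coset_eq_iff_sign[of h l] by simp
  qed blast
  ultimately have "openin (G_mod_center_topology G) ?W"
    by (auto simp: G_mod_center_topology_def rcoset_topology_def openin_quotient_topology)
  moreover have "?W \<inter> (\<lambda>g. Z #> g) ` L_lift = {a}"
  proof (intro subset_antisym subsetI)
    fix b assume "b \<in> ?W \<inter> (\<lambda>g. Z #> g) ` L_lift"
    then obtain h l where hl: "h \<in> carrier G" "sign_coset (\<pi> h) \<in> W" "l \<in> L_lift" "b = Z #> h" "b = Z #> l"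
      by blast
    have lG: "l \<in> carrier G" by (rule L_lift_carrier[OF hl(3)])
    have "sign_coset (\<pi> l) = sign_coset (\<pi> h)" using hl lG Z_coset_eq_iff_sign by metis
    then have "sign_coset (\<pi> l) \<in> W \<inter> L" using hl(2,3) by (simp add: L_lift_def)
    then have "sign_coset (\<pi> l) = sign_coset (\<pi> g)" using W(2) by blast
    then show "b \<in> {a}" using Z_coset_eq_iff_sign[OF lG gG] hl(5) g(2) by blast
  next
    fix b assume "b \<in> {a}"
    moreover have "sign_coset (\<pi> g) \<in> W" using W(2) by blast
    ultimately show "b \<in> ?W \<inter> (\<lambda>g. Z #> g) ` L_lift" using g gG by blast
  qed
  ultimately show "\<exists>W. openin (G_mod_center_topology G) W \<and> W \<inter> (\<lambda>g. Z #> g) ` L_lift = {a}" by blast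
qed

lemma torsion_free_eta: "torsion_free (G_mod_center G) ((\<lambda>g. Z #> g) ` L_lift)"
  unfolding torsion_free_def
proof (intro ballI allI impI; elim imageE conjE)
  fix x g and k :: nat
  assume g: "x = Z #> g" "g \<in> L_lift" and k: "0 < k" "x [^]\<^bsub>G_mod_center G\<^esub> k = \<one>\<^bsub>G_mod_center G\<^esub>"
  have gG: "g \<in> carrier G" by (rule L_lift_carrier[OF g(2)])
  have "Z #> (g [^] k) = Z" using k(2) Z_coset_pow[OF gG] by (simp add: g(1) one_mod_center)
  then have "g [^] k \<in> Z" using Z_coset_eq_center gG by simp
  then have "g \<in> Z" by (rule torsion_L_lift[OF g(2) k(1)])
  then show "x = \<one>\<^bsub>G_mod_center G\<^esub>" using Z_coset_eq_center[OF gG] by (simp add: g(1) one_mod_center)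
qed

lemma angle_nat_pow:
  assumes "z \<in> Z"
  shows "z [^] (k::nat) \<in> Z \<and> angle (z [^] k) = real k * angle z"
proof (induction k)
  case (Suc k)
  then show ?case
    using assms Z_closed(1) angle_center_mult[of "z [^] k" z] center_carrier by (simp add: algebra_simps)
qed (simp add: Z_closed(3))

text \<open>A torsion element \<open>tau g\<close> has a power of \<open>g\<close> in the center, so
  \<open>g\<close> itself is central because \<open>L\<close> is torsion-free. On the center the
  angle of a power is the multiple of the angle; hence \<open>g\<close> has angle 0 and is killed by
  \<open>tau\<close>.\<close>

lemma torsion_free_arising: "torsion_free E (tau ` L_lift)"
  unfolding torsion_free_def
proof (intro ballI allI impI; elim imageE conjE)
  fix x g and k :: nat
  assume g: "x = tau g" "g \<in> L_lift" and k: "0 < k" "x [^]\<^bsub>E\<^esub> k = \<one>\<^bsub>E\<^esub>"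
  have gG: "g \<in> carrier G" by (rule L_lift_carrier[OF g(2)])
  have "tau (g [^] k) = tau \<one>" using k(2) tau.hom_nat_pow[OF gG] tau.hom_one by (simp add: g(1))
  then have *: "Z #> (g [^] k) = Z #> \<one>" "angle (g [^] k) = 0" 
    using tau_eq_iff[OF nat_pow_closed[OF gG] one_closed] by simp_all
  have Z1: "Z #> \<one> = Z" using Z_coset_eq_center[OF one_closed] Z_closed(3) by simp
  then have "g [^] k \<in> Z" using Z_coset_eq_center[OF nat_pow_closed[OF gG]] *(1) Z1 by simp
  then have gZ: "g \<in> Z" by (rule torsion_L_lift[OF g(2) k(1)])
  then have "angle g = 0" using angle_nat_pow[OF gZ, of k] *(2) k(1) by simp
  then have "tau g = tau \<one>" using tau_eq_iff[OF gG one_closed] gZ Z_coset_eq_center[OF gG] Z1 by simp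
  then show "x = \<one>\<^bsub>E\<^esub>" by (simp add: g(1))
qed

text \<open>A neighbourhood is cut out by \<open>eta\<close> and \<open>E_angle\<close> together.
  Elements with equal image under \<open>eta\<close> differ by a central element, whose angle is a
  multiple of pi; an angle window of radius 1 < pi leaves only one.\<close>

lemma discrete_arising: "discrete_in (E_topology G \<pi>) (tau ` L_lift)"
proof (rule discrete_inI)
  show "tau ` L_lift \<subseteq> topspace (E_topology G \<pi>)"
    using L_lift_carrier by (auto simp: topspace_E)
  fix e assume "e \<in> tau ` L_lift"
  then obtain g where g: "g \<in> L_lift" "e = tau g" by blast
  have gG: "g \<in> carrier G" by (rule L_lift_carrier[OF g(1)])
  have "Z #> g \<in> (\<lambda>g. Z #> g) ` L_lift" using g(1) by blast
  then obtain W where W: "openin (G_mod_center_topology G) W" "W \<inter> (\<lambda>g. Z #> g) ` L_lift = {Z #> g}"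
    using discrete_inD[OF discrete_eta] by blast
  let ?W = "{x \<in> topspace (E_topology G \<pi>). eta G x \<in> W} \<inter>
    {x \<in> topspace (E_topology G \<pi>). E_angle x \<in> ball (angle g) 1}"
  have "openin (E_topology G \<pi>) ?W"
    by (intro openin_Int openin_continuous_map_preimage[OF continuous_map_eta W(1)]
        openin_continuous_map_preimage[OF continuous_map_E_angle]) simp
  moreover have "?W \<inter> tau ` L_lift = {e}"
  proof (intro subset_antisym subsetI)
    fix x assume x: "x \<in> ?W \<inter> tau ` L_lift"
    then obtain h where h: "h \<in> L_lift" "x = tau h" by blast
    have hG: "h \<in> carrier G" by (rule L_lift_carrier[OF h(1)])
    have "Z #> h \<in> W" using x h eta_tau[OF hG] by simp
    then have Zh: "Z #> h = Z #> g" using W(2) h(1) by blast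
    then obtain z where z: "z \<in> Z" "h = z \<otimes> g" using Z_coset_eq_iff[OF hG gG] by blast
    obtain k :: int where k: "angle z = of_int k * pi" using angle_center[OF z(1)] .
    have "\<bar>angle z\<bar> < 1"
      using x h E_angle_tau[OF hG] angle_center_mult[OF z(1) gG] z(2) by (simp add: dist_real_def)
    then have "\<bar>real_of_int k\<bar> * pi < 1" by (simp add: k abs_mult)
    moreover have "1 * pi \<le> \<bar>real_of_int k\<bar> * pi" if "k \<noteq> 0"
      using that by (intro mult_right_mono) auto
    ultimately have "k = 0" using pi_gt3 by fastforce
    then have "angle h = angle g" using angle_center_mult[OF z(1) gG] z(2) k by simp
    then show "x \<in> {e}" using tau_eq_iff[OF hG gG] Zh by (simp add: h g)
  next
    fix x assume "x \<in> {e}"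
    moreover have "Z #> g \<in> W" using W(2) by blast
    ultimately show "x \<in> ?W \<inter> tau ` L_lift"
      using g gG by (auto simp: topspace_E eta_tau E_angle_tau)
  qed
  ultimately show "\<exists>W. openin (E_topology G \<pi>) W \<and> W \<inter> tau ` L_lift = {e}" by blast
qed

section \<open>Proper discontinuity\<close>

lemma lcoset_elem:
  assumes "compactin (lcoset_space G V) K" "S \<in> K"
  obtains x where "x \<in> carrier G" "S = x <# V"
  using compactin_subset_topspace[OF assms(1)] assms(2) by (auto simp: topspace_lcoset_space)

text \<open>A coset of the center is determined by the matrix \<open>\<pi> g\<close>, so
  \<open>finite_displacement\<close> suffices; the choice of a lift of each matrix does not affect
  its coset.\<close>

lemma properly_discontinuous_siegel:
  "properly_discontinuous_action (G_mod_center G\<lparr>carrier := (\<lambda>g. Z #> g) ` L_lift\<rparr>)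
     (siegel_space G \<pi>) (siegel_action G)"
  unfolding properly_discontinuous_action_def siegel_space_def
proof (intro allI impI)
  fix K assume K: "compactin (lcoset_space G U) K"
  define D where "D = {\<pi> g | g. g \<in> L_lift \<and> (\<exists>x\<in>carrier G. x <# U \<in> K \<and> (g \<otimes> x) <# U \<in> K)}"
  have fin: "finite D" unfolding D_def by (rule finite_displacement[OF subgroup_U_tilde subset_refl K])
  let ?S = "{a \<in> carrier (G_mod_center G\<lparr>carrier := (\<lambda>g. Z #> g) ` L_lift\<rparr>). siegel_action G a ` K \<inter> K \<noteq> {}}"
  have "?S \<subseteq> (\<lambda>M. Z #> (SOME g. g \<in> carrier G \<and> \<pi> g = M)) ` D"
  proof
    fix a assume "a \<in> ?S"
    then obtain g S where g: "g \<in> L_lift" "a = Z #> g" and S: "S \<in> K" "siegel_action G a S \<in> K"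
      by (auto simp: disjoint_iff)
    have gG: "g \<in> carrier G" by (rule L_lift_carrier[OF g(1)])
    obtain x where x: "x \<in> carrier G" "S = x <# U" using lcoset_elem[OF K S(1)] .
    have "(g \<otimes> x) <# U \<in> K" using S(2) siegel_action_coset[OF gG x(1)] by (simp add: g(2) x(2))
    then have D: "\<pi> g \<in> D" unfolding D_def using g(1) x S(1) by blast
    have "\<exists>h. h \<in> carrier G \<and> \<pi> h = \<pi> g" using gG by blast
    from someI_ex[OF this] have "Z #> (SOME h. h \<in> carrier G \<and> \<pi> h = \<pi> g) = Z #> g"
      using Z_coset_eq_iff_sign gG by simp
    then show "a \<in> (\<lambda>M. Z #> (SOME g. g \<in> carrier G \<and> \<pi> g = M)) ` D"
      using D by (auto simp: g(2) intro!: image_eqI[of _ _ "\<pi> g"])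
  qed
  then show "finite ?S" using fin by (rule finite_subset[OF _ finite_imageI])
qed

lemma finite_center_angles: "finite {angle z | z. z \<in> Z \<and> \<bar>angle z\<bar> \<le> B}"
proof -
  have "{angle z | z. z \<in> Z \<and> \<bar>angle z\<bar> \<le> B} \<subseteq> (\<lambda>k::int. of_int k * pi) ` {- \<lceil>B\<rceil>..\<lceil>B\<rceil>}"
  proof clarify
    fix z assume z: "z \<in> Z" "\<bar>angle z\<bar> \<le> B"
    obtain k :: int where k: "angle z = of_int k * pi" using angle_center[OF z(1)] .
    have "\<bar>real_of_int k\<bar> * 1 \<le> \<bar>real_of_int k\<bar> * pi" using pi_gt3 by (intro mult_left_mono) auto
    also have "\<dots> \<le> B" using z(2) by (simp add: k abs_mult)
    finally have "\<bar>k\<bar> \<le> \<lceil>B\<rceil>" by linarith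
    then show "angle z \<in> (\<lambda>k::int. of_int k * pi) ` {- \<lceil>B\<rceil>..\<lceil>B\<rceil>}" 
      using k by (intro image_eqI[of _ _ k]) auto
  qed
  then show ?thesis by (rule finite_subset) simp
qed

text \<open>\<open>finite_displacement\<close> leaves finitely many matrices. Over one of them, the
  elements of \<open>G\<close> are z a with \<open>z\<close> central, and the angles of g x and a x
  differ by the angle of \<open>z\<close>. Both are bounded on \<open>K\<close>, so few angles of
  \<open>z\<close> occur, and \<open>tau (z \<otimes> a)\<close> depends only on that angle.\<close>

lemma properly_discontinuous_X:
  "properly_discontinuous_action (E\<lparr>carrier := tau ` L_lift\<rparr>) (X_space G \<pi>) (E_action G \<pi>)"
  unfolding properly_discontinuous_action_def X_space_def
proof (intro allI impI)
  fix K assume K: "compactin (lcoset_space G H) K"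
  have HU: "H \<subseteq> U" by (auto simp: H_subgroup_eq)
  define moves where "moves = (\<lambda>g. g \<in> L_lift \<and> (\<exists>x\<in>carrier G. x <# H \<in> K \<and> (g \<otimes> x) <# H \<in> K))"
  have fin: "finite {\<pi> g | g. moves g}"
    unfolding moves_def by (rule finite_displacement[OF subgroup_H HU K])
  have fin_fibre: "finite (tau ` {g. moves g \<and> \<pi> g = \<pi> a})" if a: "a \<in> carrier G" for a
  proof -
    have "compactin euclideanreal ((\<lambda>s. coset_angle (g <# s)) ` K)" if "g \<in> carrier G" for g
      by (rule image_compactin[OF K continuous_map_coset_angle[OF that]])
    then have "bounded ((\<lambda>s. coset_angle (g <# s)) ` K)" if "g \<in> carrier G" for g
      using that by (simp add: compact_imp_bounded)
    then have "\<exists>B. \<forall>s\<in>K. \<bar>coset_angle (g <# s)\<bar> \<le> B" if "g \<in> carrier G" for g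
      using that unfolding bounded_iff by (metis imageI real_norm_def)
    \<comment> \<open>\<open>B1\<close> will bound the angle at the end point g x, whose coset is in
      \<open>K\<close>; \<open>B2\<close> bounds the angle at a x, the translate by the fixed
      \<open>a\<close> of a point whose coset is in \<open>K\<close>.\<close>
    then obtain B1 B2 where B: "\<And>s. s \<in> K \<Longrightarrow> \<bar>coset_angle (\<one> <# s)\<bar> \<le> B1"
        "\<And>s. s \<in> K \<Longrightarrow> \<bar>coset_angle (a <# s)\<bar> \<le> B2"
      using a one_closed by metis
    have angle_coset: "coset_angle (g <# (x <# H)) = angle (g \<otimes> x)" if "g \<in> carrier G" "x \<in> carrier G" for g x
      using that by (simp add: lcos_m_assoc subgroup.subset[OF subgroup_H] angle_l_coset)
    let ?A = "{angle z | z. z \<in> Z \<and> \<bar>angle z\<bar> \<le> B1 + B2}"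
    have "tau ` {g. moves g \<and> \<pi> g = \<pi> a} \<subseteq> (\<lambda>t. tau ((SOME z. z \<in> Z \<and> angle z = t) \<otimes> a)) ` ?A"
    proof clarify
      fix g assume g: "moves g" "\<pi> g = \<pi> a"
      then obtain x where x: "g \<in> carrier G" "x \<in> carrier G" "x <# H \<in> K" "(g \<otimes> x) <# H \<in> K"
        unfolding moves_def using L_lift_carrier by blast
      have "Z #> g = Z #> a" using Z_coset_eq_iff_sign[OF x(1) a] g(2) by simp
      then obtain z where z: "z \<in> Z" "g = z \<otimes> a" using Z_coset_eq_iff[OF x(1) a] by blast
      have "g \<otimes> x = z \<otimes> (a \<otimes> x)" using z x a center_carrier by (simp add: m_assoc)
      then have "angle (g \<otimes> x) = angle z + angle (a \<otimes> x)" using angle_center_mult[OF z(1)] a x(2) by simp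
      moreover have "\<bar>angle (g \<otimes> x)\<bar> \<le> B1" "\<bar>angle (a \<otimes> x)\<bar> \<le> B2"
        using B(1)[OF x(4)] B(2)[OF x(3)] angle_coset[OF one_closed, of "g \<otimes> x"] angle_coset[OF a x(2)] x a by auto
      ultimately have zB: "\<bar>angle z\<bar> \<le> B1 + B2" by linarith
      define y where "y = (SOME y. y \<in> Z \<and> angle y = angle z)"
      have y: "y \<in> Z" "angle y = angle z"
        using someI_ex[of "\<lambda>y. y \<in> Z \<and> angle y = angle z"] z(1) unfolding y_def by blast+
      have "Z #> (y \<otimes> a) = Z #> a" using y(1) a center_carrier by (subst Z_coset_eq_iff) auto
      then have "tau (y \<otimes> a) = tau g"
        using \<open>Z #> g = Z #> a\<close> y z a x(1) center_carrier[OF y(1)]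
        by (subst tau_eq_iff) (auto simp: angle_center_mult)
      then show "tau g \<in> (\<lambda>t. tau ((SOME z. z \<in> Z \<and> angle z = t) \<otimes> a)) ` ?A"
        using z(1) zB by (intro image_eqI[of _ _ "angle z"]) (auto simp: y_def)
    qed
    then show ?thesis using finite_center_angles by (rule finite_subset[OF _ finite_imageI])
  qed
  let ?S = "{e \<in> carrier (E\<lparr>carrier := tau ` L_lift\<rparr>). E_action G \<pi> e ` K \<inter> K \<noteq> {}}"
  have "?S \<subseteq> (\<Union>M\<in>{\<pi> g | g. moves g}. tau ` {g. moves g \<and> \<pi> g = M})"
  proof
    fix e assume "e \<in> ?S"
    then obtain g S where g: "g \<in> L_lift" "e = tau g" and S: "S \<in> K" "E_action G \<pi> e S \<in> K"
      by (auto simp: disjoint_iff)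
    have gG: "g \<in> carrier G" by (rule L_lift_carrier[OF g(1)])
    obtain x where x: "x \<in> carrier G" "S = x <# H" using lcoset_elem[OF K S(1)] .
    have "(g \<otimes> x) <# H \<in> K" using S(2) E_action_tau[OF gG x(1)] by (simp add: g(2) x(2))
    then have "moves g" unfolding moves_def using g(1) x S(1) by blast
    then show "e \<in> (\<Union>M\<in>{\<pi> g | g. moves g}. tau ` {g. moves g \<and> \<pi> g = M})" using g(2) by blast
  qed
  moreover have "finite (\<Union>M\<in>{\<pi> g | g. moves g}. tau ` {g. moves g \<and> \<pi> g = M})"
  proof (intro finite_UN_I fin)
    fix M assume "M \<in> {\<pi> g | g. moves g}"
    then obtain a where "moves a" "M = \<pi> a" by blast
    then show "finite (tau ` {g. moves g \<and> \<pi> g = M})"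
      using fin_fibre[of a] by (simp add: moves_def L_lift_carrier)
  qed
  ultimately show "finite ?S" by (rule finite_subset)
qed

section \<open>The infinite cyclic kernel\<close>

lemma angle_int_pow:
  assumes z: "z \<in> Z"
  shows "z [^] (k::int) \<in> Z" "angle (z [^] k) = of_int k * angle z"
proof -
  have "z [^] k \<in> Z \<and> angle (z [^] k) = of_int k * angle z"
  proof (cases k rule: int_cases2)
    case (nonneg n)
    then show ?thesis using angle_nat_pow[OF z, of n] by (simp add: int_pow_int)
  next
    case (nonpos n)
    then have "z [^] k = inv (z [^] n)"
      using int_pow_neg[OF center_carrier[OF z], of "int n"] by (simp add: int_pow_int)
    then show ?thesis
      using angle_nat_pow[OF z, of n] nonpos Z_closed(2) angle_inv_U[OF center_U] by simp
  qed
  then show "z [^] k \<in> Z" "angle (z [^] k) = of_int k * angle z" by auto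
qed

text \<open>The angles of the center form a nonzero subgroup of the multiples of pi; division with
  remainder shows that its least positive element generates it.\<close>

lemma center_angle_generator:
  obtains c where "c \<in> Z" "angle c \<noteq> 0" "\<And>z. z \<in> Z \<Longrightarrow> \<exists>k::int. angle z = of_int k * angle c"
proof -
  define P where "P = (\<lambda>m::nat. m > 0 \<and> (\<exists>z\<in>Z. angle z = real m * pi))"
  have "\<exists>m. P m"
  proof -
    obtain z where z: "z \<in> Z" "angle z \<noteq> 0" using center_infinite_order by blast
    obtain k :: int where k: "angle z = of_int k * pi" using angle_center[OF z(1)] .
    show ?thesis
    proof (cases "k > 0")
      case True
      then show ?thesis using z k by (intro exI[of _ "nat k"]) (auto simp: P_def)
    next
      case False
      then have "k < 0" using z(2) k by (cases "k = 0") auto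
      then show ?thesis using z k Z_closed(2)[OF z(1)] angle_inv_U[OF center_U[OF z(1)]]
        by (intro exI[of _ "nat (- k)"]) (auto simp: P_def)
    qed
  qed
  define m where "m = (LEAST m. P m)"
  have m: "P m" "\<And>j. P j \<Longrightarrow> m \<le> j"
    unfolding m_def using \<open>\<exists>m. P m\<close> by (auto intro: LeastI_ex Least_le)
  then obtain c where c: "m > 0" "c \<in> Z" "angle c = real m * pi" by (auto simp: P_def)
  have "\<exists>k::int. angle z = of_int k * angle c" if z: "z \<in> Z" for z
  proof -
    obtain j :: int where j: "angle z = of_int j * pi" using angle_center[OF z] .
    define q where "q = j div int m"
    have "z \<otimes> c [^] (- q) \<in> Z" using z angle_int_pow(1)[OF c(2)] Z_closed(1) by blast
    moreover have "angle (z \<otimes> c [^] (- q)) = real_of_int (j mod int m) * pi"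
    proof -
      have "angle (z \<otimes> c [^] (- q)) = of_int j * pi - of_int q * (real m * pi)"
        using angle_center_mult[OF z center_carrier[OF angle_int_pow(1)[OF c(2)]], of "- q"]
          angle_int_pow(2)[OF c(2), of "- q"] c(3) j by simp
      also have "\<dots> = of_int (j - int m * q) * pi" by (simp add: algebra_simps)
      also have "j - int m * q = j mod int m" by (simp add: q_def minus_mult_div_eq_mod)
      finally show ?thesis .
    qed
    moreover have nonneg: "0 \<le> j mod int m" "j mod int m < int m" using c(1) by auto
    ultimately have "j mod int m = 0"
      using m(2)[of "nat (j mod int m)"] unfolding P_def by (cases "j mod int m = 0") force+
    then have "j = q * int m" by (metis q_def mult.commute mod_0_imp_dvd dvd_mult_div_cancel)
    then show ?thesis using j c(3) by (intro exI[of _ q]) simp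
  qed
  then show ?thesis using that[of c] c by simp
qed

text \<open>The kernel of \<open>eta\<close> meets the arising group in the image of the center
  under \<open>tau\<close>. There an element is determined by its angle, so powers of a central
  element with generating angle exhaust it, and distinct powers stay distinct.\<close>

lemma kernel_infinite_cyclic:
  "E\<lparr>carrier := tau ` L_lift \<inter> kernel E (G_mod_center G) (eta G)\<rparr> \<cong> integer_group"
proof -
  have eq: "tau ` L_lift \<inter> kernel E (G_mod_center G) (eta G) = tau ` Z"
  proof (intro subset_antisym subsetI)
    fix x assume "x \<in> tau ` L_lift \<inter> kernel E (G_mod_center G) (eta G)"
    then obtain g where "g \<in> L_lift" "x = tau g" "eta G x = Z"
      by (auto simp: kernel_def one_mod_center)
    then have g: "g \<in> carrier G" "x = tau g" "eta G x = Z" by (auto simp: L_lift_carrier)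
    then have "g \<in> Z" using Z_coset_eq_center by (simp add: eta_tau)
    then show "x \<in> tau ` Z" using g by blast
  next
    fix x assume "x \<in> tau ` Z"
    then obtain z where z: "z \<in> Z" "x = tau z" by blast
    then show "x \<in> tau ` L_lift \<inter> kernel E (G_mod_center G) (eta G)"
      using center_L_lift[OF z(1)] center_carrier[OF z(1)] Z_coset_eq_center
      by (auto simp: kernel_def one_mod_center eta_tau)
  qed
  obtain c where c: "c \<in> Z" "angle c \<noteq> 0" "\<And>z. z \<in> Z \<Longrightarrow> \<exists>k::int. angle z = of_int k * angle c"
    using center_angle_generator by metis
  have pow: "c [^] (k::int) \<in> Z" "c [^] k \<in> carrier G" "angle (c [^] k) = of_int k * angle c" for k
    using angle_int_pow[OF c(1)] center_carrier by auto
  have Zeq: "Z #> z = Z" if "z \<in> Z" for z using that Z_coset_eq_center center_carrier by blast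
  have "(\<lambda>k::int. tau (c [^] k)) \<in> iso integer_group (E\<lparr>carrier := tau ` Z\<rparr>)"
  proof (intro isoI homI bij_betwI')
    show "tau (c [^] x) \<in> carrier (E\<lparr>carrier := tau ` Z\<rparr>)" for x :: int using pow(1) by simp
    then show "tau (c [^] x) \<in> carrier (E\<lparr>carrier := tau ` Z\<rparr>)" for x :: int .
    show "tau (c [^] (x \<otimes>\<^bsub>integer_group\<^esub> y)) = tau (c [^] x) \<otimes>\<^bsub>E\<lparr>carrier := tau ` Z\<rparr>\<^esub> tau (c [^] y)" for x y :: int
      using int_pow_mult[OF center_carrier[OF c(1)], of x y] tau.hom_mult[OF pow(2) pow(2), of x y] by simp
    show "(tau (c [^] x) = tau (c [^] y)) = (x = y)" for x y :: int
      using tau_eq_iff[OF pow(2) pow(2), of x y] pow(3) c(2) Zeq[OF pow(1)] by auto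
    fix e assume "e \<in> carrier (E\<lparr>carrier := tau ` Z\<rparr>)"
    then obtain z where z: "z \<in> Z" "e = tau z" by auto
    obtain k :: int where "angle z = of_int k * angle c" using c(3)[OF z(1)] by blast
    then have "e = tau (c [^] k)"
      unfolding z(2) using tau_eq_iff[OF center_carrier[OF z(1)] pow(2)] pow(3) Zeq[OF z(1)] Zeq[OF pow(1)] by simp
    then show "\<exists>k\<in>(carrier integer_group :: int set). e = tau (c [^] k)" by auto
  qed
  then have "integer_group \<cong> E\<lparr>carrier := tau ` Z\<rparr>" by (rule is_isoI)
  then show ?thesis unfolding eq by (rule group.iso_sym[OF group_integer_group])
qed

theorem siegel_seifert_arising: "siegel_seifert G \<pi> (arising_from G \<pi> L)"
  unfolding siegel_seifert_def Let_def arising_from_eq eta_image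
proof (intro conjI)
  show "subgroup (tau ` L_lift) E" by (rule tau.subgroup_img_is_subgroup[OF subgroup_L_lift])
  show "cocompact_action (E\<lparr>carrier := tau ` L_lift\<rparr>) (X_space G \<pi>) (E_action G \<pi>)"
    unfolding X_space_def
    by (rule cocompact_action_lcoset[of _ tau]) (simp_all add: E_action_tau L_lift_carrier)
  show "cocompact_action (G_mod_center G\<lparr>carrier := (\<lambda>g. Z #> g) ` L_lift\<rparr>) (siegel_space G \<pi>) (siegel_action G)"
    unfolding siegel_space_def
    by (rule cocompact_action_lcoset[of _ "\<lambda>g. Z #> g"]) (simp_all add: siegel_action_coset L_lift_carrier)
qed (intro discrete_arising torsion_free_arising properly_discontinuous_X discrete_eta torsion_free_eta
    properly_discontinuous_siegel kernel_infinite_cyclic)+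

end

theorem proposition6p2:
  fixes G :: "'g::topological_space monoid"
    and \<pi> :: "'g \<Rightarrow> real ^ ('n::finite + 'n) ^ ('n + 'n)"
    and L :: "(real ^ ('n + 'n) ^ ('n + 'n)) set set"
  assumes "CARD('n) \<ge> 2"
    and "universal_covering_group G Sp \<pi>"
    and "cocompact_lattice_in PSp PSp_topology L"
    and "torsion_free PSp L"
  shows "siegel_seifert G \<pi> (arising_from G \<pi> L)"
proof -
  interpret arising_lattice G \<pi> L
    by (intro arising_lattice.intro symplectic_cover.intro arising_lattice_axioms.intro assms)
  show ?thesis by (rule siegel_seifert_arising)
qed

end
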